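(* Let $f=f(x,y)$ be a smooth function and let $\mathcal{M}_f$ be the associated $3$-dimensional Lorentzian manifold with coordinates $(x,y,\tilde x)$ and metric whose (possibly) non-zero components are $g(\partial_x,\partial_x)=-2f(x,y)$, $g(\partial_x,\partial_{\tilde x})=g(\partial_y,\partial_y)=1$. Suppose $f_{yy}$ is never zero and non-constant. (1) If $f_{yyy}$ never vanishes, then $\mathcal{M}_f$ is homothety $1$-curvature homogeneous. (2) If $f_{yy}=\alpha(x)$ with $\alpha_x$ never zero, then $\mathcal{M}_f$ is homothety $1$-curvature homogeneous if and only if $f=a(x-x_0)^{-2}y^2+\beta(x)y+\gamma(x)$ for some $0\ne a\in\mathbb{R}$, some $x_0\in\mathbb{R}$, and some smooth functions $\beta,\gamma$. This manifold is locally homogeneous. (3) Assume that $\mathcal{M}_f$ is homothety $2$-curvature homogeneous, and that $f_{yy}$ and $f_{yyy}$ never vanish. Then $\mathcal{M}_f$ is locally isometric to one of the following examples: (a) $\mathcal{M}_{\pm e^{ay}}$ for some $a\ne0$, with $M=\mathbb{R}^3$. This manifold is homogeneous. (b) $\mathcal{M}_{\pm\ln(y)}$ with $M=\mathbb{R}\times(0,\infty)\times\mathbb{R}$. This manifold is homothety homogeneous but not locally homogeneous. (c) $\mathcal{M}_{\pm y^\varepsilon}$ for some $\varepsilon\in\mathbb{R}$ with $\varepsilon\ne0,1,2$, with $M=\mathbb{R}\times(0,\infty)\times\mathbb{R}$. This manifold is homothety homogeneous but not locally homogeneous.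
   Context: The function $f$ is defined on a product $I\times J$ of open intervals of $\mathbb{R}$ (with coordinates $x\in I$, $y\in J$), and the underlying manifold of $\mathcal{M}_f$ is $M=I\times J\times\mathbb{R}$ with coordinates $(x,y,\tilde x)$. Subscripts on $f$ and $\alpha$ denote partial derivatives. For a pseudo-Riemannian manifold $\mathcal{M}=(M,g)$, $R$ is the $(0,4)$ curvature tensor of the Levi-Civita connection and $\nabla^\ell R\in\otimes^{\ell+4}T^*M$ is its $\ell$-th covariant derivative. $\mathcal{M}$ is homothety $k$-curvature homogeneous if for any $P,Q\in M$ there exist a linear isometry $\Phi:T_PM\to T_QM$ and $0\neq\lambda\in\mathbb{R}$ (both may depend on $P,Q$) with $\Phi^*(\nabla^\ell R_Q)=\lambda^{-\ell-2}\nabla^\ell R_P$ for $0\le\ell\le k$. $\mathcal{M}$ is homogeneous if the group of isometries $\{T\text{ a diffeomorphism of }M: T^*g=g\}$ acts transitively on $M$; it is homothety homogeneous if the group of homotheties $\{T\text{ a diffeomorphism of }M:\exists\,0\ne\lambda\in\mathbb{R},\ T^*g=\lambda^2g\}$ acts transitively on $M$; it is locally homogeneous if for any $P,Q\in M$ there is an isometry from a neighborhood of $P$ onto a neighborhood of $Q$ sending $P$ to $Q$. $\mathcal{M}$ is locally isometric to $\mathcal{M}'$ if every point of $M$ has an open neighborhood isometric to an open subset of $\mathcal{M}'$. *)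

theory Defs
  imports "HOL-Analysis.Analysis"
begin

definition dir_deriv :: "'a \<Rightarrow> ('a::euclidean_space \<Rightarrow> 'b::real_normed_vector) \<Rightarrow> 'a \<Rightarrow> 'b" where
  "dir_deriv v h = (\<lambda>p. frechet_derivative h (at p) v)"

text \<open>Only meant for open \<open>S\<close>: the function is of class \<open>C\<^sup>\<infinity>\<close> on \<open>S\<close> because all its iterated
  directional derivatives exist and are (Frechet-)differentiable, hence continuous, on \<open>S\<close>.\<close>

definition smooth_on :: "'a::euclidean_space set \<Rightarrow> ('a \<Rightarrow> 'b::real_normed_vector) \<Rightarrow> bool" where
  "smooth_on S h \<longleftrightarrow> (\<forall>vs. foldr dir_deriv vs h differentiable_on S)"

definition diffeomorphism_on ::
  "'a::euclidean_space set \<Rightarrow> 'b::euclidean_space set \<Rightarrow> ('a \<Rightarrow> 'b) \<Rightarrow> bool" where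
  "diffeomorphism_on A B T \<longleftrightarrow> bij_betw T A B \<and> smooth_on A T \<and> smooth_on B (inv_into A T)"

definition partial_y :: "(real \<Rightarrow> real \<Rightarrow> real) \<Rightarrow> real \<Rightarrow> real \<Rightarrow> real" where
  "partial_y f = (\<lambda>x y. deriv (f x) y)"

text \<open>A field of bilinear forms \<open>g\<close> sends a point to a form on the tangent space, which is
  identified with \<open>'a\<close>. A tensor field of type \<open>(0,k)\<close> sends a point to a function of lists of
  \<open>k\<close> tangent vectors. A manifold \<open>(U, g)\<close> consists of an open set and a metric on it; the values
  of \<open>g\<close> outside \<open>U\<close> are irrelevant.\<close>

type_synonym 'a metric_field = "'a \<Rightarrow> 'a \<Rightarrow> 'a \<Rightarrow> real"
type_synonym 'a tensor_field = "'a \<Rightarrow> 'a list \<Rightarrow> real"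
type_synonym 'a manifold = "'a set \<times> 'a metric_field"

text \<open>The Levi-Civita connection is given by the bilinear maps \<open>G\<close> with \<open>G u v = \<nabla>\<^sub>u v\<close> for
  constant vector fields \<open>u\<close>, \<open>v\<close>. As such fields commute, vanishing torsion is
  symmetry of \<open>G\<close>; the last condition is \<open>\<nabla>g = 0\<close>.\<close>

definition is_levi_civita_at ::
  "'a::euclidean_space metric_field \<Rightarrow> 'a \<Rightarrow> ('a \<Rightarrow> 'a \<Rightarrow> 'a) \<Rightarrow> bool" where
  "is_levi_civita_at g p G \<longleftrightarrow>
     bilinear G \<and> (\<forall>u v. G u v = G v u) \<and>
     (\<forall>u v w. dir_deriv u (\<lambda>q. g q v w) p = g p (G u v) w + g p v (G u w))"

definition levi_civita :: "'a::euclidean_space metric_field \<Rightarrow> 'a \<Rightarrow> 'a \<Rightarrow> 'a \<Rightarrow> 'a" where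
  "levi_civita g p = (THE G. is_levi_civita_at g p G)"

lemma levi_civita_eqI:
  assumes bil: "bilinear (g p)" and sym: "\<And>u v. g p u v = g p v u"
    and nondeg: "\<And>u. (\<And>v. g p u v = 0) \<Longrightarrow> u = 0"
    and G: "is_levi_civita_at g p G"
  shows "levi_civita g p = G"
proof -
  have uniq: "H = G" if H: "is_levi_civita_at g p H" for H
  proof (intro ext)
    fix u v
    define B where "B u v w = g p (H u v - G u v) w" for u v w
    have lsub: "g p (a - b) c = g p a c - g p b c" for a b c
      using bil bilinear_lsub by blast
    have B: "B u v w = g p (H u v) w - g p (G u v) w" for u v w
      by (simp add: B_def lsub)
    have s: "B u v w = B v u w" for u v w
      using G H unfolding B_def is_levi_civita_at_def by metis
    have k: "B u v w = - B u w v" for u v w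
    proof -
      have "g p (H u v) w + g p v (H u w) = g p (G u v) w + g p v (G u w)"
        using G H unfolding is_levi_civita_at_def by metis
      then show ?thesis
        unfolding B using sym[of v "H u w"] sym[of v "G u w"] by linarith
    qed
    have "B u v w = 0" for w
      using s[of u v w] k[of v u w] s[of v w u] k[of w v u] s[of w u v] k[of u w v] by linarith
    then show "H u v = G u v"
      using nondeg[of "H u v - G u v"] unfolding B_def by simp
  qed
  show ?thesis
    unfolding levi_civita_def using G uniq by (rule the_equality)
qed

text \<open>The covariant derivative \<open>\<nabla>\<^sub>v X\<close> of a vector field \<open>X\<close> along a constant field \<open>v\<close>.\<close>

definition cov_deriv_vec ::
  "'a::euclidean_space metric_field \<Rightarrow> 'a \<Rightarrow> ('a \<Rightarrow> 'a) \<Rightarrow> 'a \<Rightarrow> 'a" where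
  "cov_deriv_vec g v X = (\<lambda>p. dir_deriv v X p + levi_civita g p v (X p))"

text \<open>\<open>R(u,v,w,z) = g(\<nabla>\<^sub>u\<nabla>\<^sub>v w - \<nabla>\<^sub>v\<nabla>\<^sub>u w - \<nabla>\<^bsub>[u,v]\<^esub> w, z)\<close>, evaluated on constant fields, for
  which \<open>[u,v] = 0\<close>.\<close>

definition curvature :: "'a::euclidean_space metric_field \<Rightarrow> 'a \<Rightarrow> 'a \<Rightarrow> 'a \<Rightarrow> 'a \<Rightarrow> 'a \<Rightarrow> real" where
  "curvature g p u v w z =
     g p (cov_deriv_vec g u (cov_deriv_vec g v (\<lambda>_. w)) p -
          cov_deriv_vec g v (cov_deriv_vec g u (\<lambda>_. w)) p) z"

text \<open>Direction of differentiation in the first slot: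
  \<open>(\<nabla>T)(v, w\<^sub>1, \<dots>, w\<^sub>k) = v(T(w\<^sub>1, \<dots>, w\<^sub>k)) - \<Sum>\<^sub>i T(w\<^sub>1, \<dots>, \<nabla>\<^sub>v w\<^sub>i, \<dots>, w\<^sub>k)\<close>.\<close>

definition cov_deriv_tensor ::
  "'a::euclidean_space metric_field \<Rightarrow> 'a tensor_field \<Rightarrow> 'a tensor_field" where
  "cov_deriv_tensor g T p vs =
     (let v = hd vs; ws = tl vs in
       dir_deriv v (\<lambda>q. T q ws) p -
       (\<Sum>i<length ws. T p (ws[i := cov_deriv_vec g v (\<lambda>_. ws ! i) p])))"

text \<open>\<open>nabla_R g l\<close> is \<open>\<nabla>\<^sup>lR\<close>, to be evaluated on lists of length \<open>l + 4\<close>.\<close>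

primrec nabla_R :: "'a::euclidean_space metric_field \<Rightarrow> nat \<Rightarrow> 'a tensor_field" where
  "nabla_R g 0 = (\<lambda>p vs. curvature g p (vs ! 0) (vs ! 1) (vs ! 2) (vs ! 3))"
| "nabla_R g (Suc l) = cov_deriv_tensor g (nabla_R g l)"

definition linear_isometry_at ::
  "'a::euclidean_space metric_field \<Rightarrow> 'a \<Rightarrow> 'a \<Rightarrow> ('a \<Rightarrow> 'a) \<Rightarrow> bool" where
  "linear_isometry_at g P Q \<Phi> \<longleftrightarrow>
     linear \<Phi> \<and> bij \<Phi> \<and> (\<forall>u v. g Q (\<Phi> u) (\<Phi> v) = g P u v)"

definition homothety_curvature_homogeneous :: "nat \<Rightarrow> 'a::euclidean_space manifold \<Rightarrow> bool" where
  "homothety_curvature_homogeneous k = (\<lambda>(U, g).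
     \<forall>P\<in>U. \<forall>Q\<in>U. \<exists>\<Phi> c. linear_isometry_at g P Q \<Phi> \<and> c \<noteq> 0 \<and>
       (\<forall>l\<le>k. \<forall>vs. length vs = l + 4 \<longrightarrow>
          nabla_R g l Q (map \<Phi> vs) = c powi (- int l - 2) * nabla_R g l P vs))"

definition scaled_isometry ::
  "real \<Rightarrow> 'a::euclidean_space manifold \<Rightarrow> 'b::euclidean_space manifold \<Rightarrow> ('a \<Rightarrow> 'b) \<Rightarrow> bool" where
  "scaled_isometry c = (\<lambda>(A, g) (B, h) T.
     diffeomorphism_on A B T \<and>
     (\<forall>p\<in>A. \<forall>u v. h (T p) (dir_deriv u T p) (dir_deriv v T p) = c * g p u v))"

definition isometry ::
  "'a::euclidean_space manifold \<Rightarrow> 'b::euclidean_space manifold \<Rightarrow> ('a \<Rightarrow> 'b) \<Rightarrow> bool" where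
  "isometry = scaled_isometry 1"

definition homothety ::
  "'a::euclidean_space manifold \<Rightarrow> 'b::euclidean_space manifold \<Rightarrow> ('a \<Rightarrow> 'b) \<Rightarrow> bool" where
  "homothety M N T \<longleftrightarrow> (\<exists>c. c \<noteq> 0 \<and> scaled_isometry (c\<^sup>2) M N T)"

definition homogeneous :: "'a::euclidean_space manifold \<Rightarrow> bool" where
  "homogeneous M \<longleftrightarrow> (\<forall>P\<in>fst M. \<forall>Q\<in>fst M. \<exists>T. isometry M M T \<and> T P = Q)"

definition homothety_homogeneous :: "'a::euclidean_space manifold \<Rightarrow> bool" where
  "homothety_homogeneous M \<longleftrightarrow> (\<forall>P\<in>fst M. \<forall>Q\<in>fst M. \<exists>T. homothety M M T \<and> T P = Q)"

definition locally_homogeneous :: "'a::euclidean_space manifold \<Rightarrow> bool" where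
  "locally_homogeneous = (\<lambda>(U, g).
     \<forall>P\<in>U. \<forall>Q\<in>U. \<exists>A B T. open A \<and> P \<in> A \<and> A \<subseteq> U \<and> open B \<and> Q \<in> B \<and> B \<subseteq> U \<and>
       isometry (A, g) (B, g) T \<and> T P = Q)"

definition locally_isometric ::
  "'a::euclidean_space manifold \<Rightarrow> 'b::euclidean_space manifold \<Rightarrow> bool" where
  "locally_isometric = (\<lambda>(U, g) (V, h).
     \<forall>P\<in>U. \<exists>A B T. open A \<and> P \<in> A \<and> A \<subseteq> U \<and> open B \<and> B \<subseteq> V \<and> isometry (A, g) (B, h) T)"

text \<open>The coordinates are \<open>(x, y, t)\<close>, where \<open>t\<close> stands for \<open>x\<close> with a tilde.\<close>

definition metric_f :: "(real \<Rightarrow> real \<Rightarrow> real) \<Rightarrow> (real \<times> real \<times> real) metric_field" where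
  "metric_f f = (\<lambda>(x, y, t) (u1, u2, u3) (v1, v2, v3).
     - 2 * f x y * u1 * v1 + u1 * v3 + u3 * v1 + u2 * v2)"

definition manifold_f ::
  "real set \<Rightarrow> real set \<Rightarrow> (real \<Rightarrow> real \<Rightarrow> real) \<Rightarrow> (real \<times> real \<times> real) manifold" where
  "manifold_f I J f = (I \<times> J \<times> UNIV, metric_f f)"

definition open_interval :: "real set \<Rightarrow> bool" where
  "open_interval I \<longleftrightarrow> open I \<and> is_interval I \<and> I \<noteq> {}"

end

theory Submission
  imports Defs
begin

text \<open>
The form \<open>\<omega> = dx \<and> dy\<close> is parallel and \<open>R = h \<omega> \<otimes> \<omega>\<close> up to order of the arguments, where \<open>h = f\<^sub>y\<^sub>y\<close>; hence
\<open>\<nabla>\<^sup>\<ell>R = \<nabla>\<^sup>\<ell>h \<otimes> \<omega> \<otimes> \<omega>\<close>, and homothety \<open>k\<close>-curvature homogeneity is a system of algebraic equations between the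
values of \<open>h\<close>, \<open>dh\<close>, \<open>\<nabla>\<^sup>2h\<close> at two points. For \<open>k = 1\<close> it is solvable if \<open>h\<^sub>y \<noteq> 0\<close>, and says that
\<open>\<alpha>\<^sub>x\<^sup>2 / \<alpha>\<^sup>3\<close> is constant if \<open>h = \<alpha>(x)\<close>. For \<open>k = 2\<close> and \<open>X = \<partial>\<^sub>x + b\<partial>\<^sub>y\<close> with \<open>Xh = 0\<close>, the three functions
\<open>hh\<^sub>y\<^sub>y / h\<^sub>y\<^sup>2\<close>, \<open>\<nabla>\<^sup>2h(X,\<partial>\<^sub>y)\<^sup>2 / (hh\<^sub>y\<^sup>2)\<close> and \<open>\<nabla>\<^sup>2h(X,X) / h\<^sup>2\<close> are constant. The second constant turns out to be
\<open>0\<close>, so that \<open>b\<close> depends only on \<open>x\<close>; then \<open>h\<close> is a function of \<open>y + \<eta>(x)\<close> with \<open>\<eta>' = -b\<close>, the first constant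
gives an ordinary differential equation for it, and the third one determines \<open>f\<close>.

All isometries and homotheties that are needed have the form
\<open>(x, y, t) \<mapsto> (rx + b, \<mu>y + \<eta>(x), (\<mu>\<^sup>2t - \<mu>\<eta>'(x)y + \<zeta>(x)) / r)\<close>. Conversely a local isometry \<open>T\<close> of \<open>\<M>\<^sub>f\<close> with
\<open>f = k(y)\<close> satisfies \<open>D\<^sup>2T(u,v) + \<Gamma>(DTu, DTv) = DT \<Gamma>(u,v)\<close>, which forces \<open>k'''(y)\<^sup>2 / k''(y)\<^sup>2\<close> to be invariant.
\<close>

subsection \<open>Smooth functions\<close>

text \<open>Where h is nonzero, the kernel of the curvature is the line spanned by
  \<open>\<partial>\<^sub>t\<close>. A linear isometry that matches curvatures preserves this line,
  which leaves the parameters \<open>s\<close>, \<open>n\<close>, \<open>\<tau>\<close> with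
  \<open>\<tau>\<^sup>2 = 1\<close>, and the scale \<open>c\<close>. At order 1 the shear
  \<open>n\<close> absorbs h_x as soon as h_y is nonzero; at order 2 no freedom is left and
  invariants appear. The second constant vanishes by integrability: the first one makes w = h / h_y
  affine in y, equality of the mixed derivatives of w gives b_yy = 0, and b_y^2 = \<kappa> h then
  differentiates to \<kappa> h_y = 0. The third constant is not free either: differentiating the
  resulting formula for f_y ties it to the first constant and excludes the value 2 for the latter.
  Smoothness is handled without a general chain rule. Only composition with affine and linear maps
  is used; other composites are shown to be smooth by a differential equation, by integration, or by
  expressing them through h.\<close>

lemma dir_deriv_eqI: "(h has_derivative D) (at p) \<Longrightarrow> dir_deriv v h p = D v"
  by (simp add: dir_deriv_def frechet_derivative_at[symmetric])

lemma dir_deriv_real: "(h has_real_derivative D) (at x) \<Longrightarrow> dir_deriv v h x = D * v"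
  by (auto simp: has_field_derivative_def intro: dir_deriv_eqI)

lemma has_derivative_dir_deriv:
  "h differentiable at p \<Longrightarrow> (h has_derivative (\<lambda>v. dir_deriv v h p)) (at p)"
  by (simp add: dir_deriv_def frechet_derivative_works)

text \<open>Both functions have the same derivatives in the sense of \<open>has_derivative\<close>,
  so the choice inside \<open>frechet_derivative\<close> gives the same value, even where there is
  no derivative at all.\<close>

lemma dir_deriv_cong:
  assumes "open S" "p \<in> S" "\<And>q. q \<in> S \<Longrightarrow> h q = k q"
  shows "dir_deriv v h p = dir_deriv v k p"
proof -
  have "(h has_derivative D) (at p) \<longleftrightarrow> (k has_derivative D) (at p)" for D
    using assms by (metis has_derivative_transform_within_open)
  then show ?thesis by (simp add: dir_deriv_def frechet_derivative_def)
qed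

text \<open>A finite order of smoothness gives an induction variable: derivatives of products and
  quotients change their shape, so closure properties are proved by lowering the order by
  one.\<close>

definition smooth_upto :: "nat \<Rightarrow> 'a::euclidean_space set \<Rightarrow> ('a \<Rightarrow> 'b::real_normed_vector) \<Rightarrow> bool" where
  "smooth_upto n S h \<longleftrightarrow> (\<forall>vs. length vs \<le> n \<longrightarrow> foldr dir_deriv vs h differentiable_on S)"

lemma smooth_on_iff_upto: "smooth_on S h \<longleftrightarrow> (\<forall>n. smooth_upto n S h)"
  by (auto simp: smooth_on_def smooth_upto_def)

lemma smooth_upto_0: "smooth_upto 0 S h \<longleftrightarrow> h differentiable_on S"
  by (simp add: smooth_upto_def)

lemma smooth_upto_Suc:
  "smooth_upto (Suc n) S h \<longleftrightarrow> h differentiable_on S \<and> (\<forall>v. smooth_upto n S (dir_deriv v h))"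
proof
  assume L: "smooth_upto (Suc n) S h"
  have "foldr dir_deriv vs (dir_deriv v h) differentiable_on S" if "length vs \<le> n" for vs v
    using L[unfolded smooth_upto_def, rule_format, of "vs @ [v]"] that by simp
  moreover have "h differentiable_on S"
    using L[unfolded smooth_upto_def, rule_format, of "[]"] by simp
  ultimately show "h differentiable_on S \<and> (\<forall>v. smooth_upto n S (dir_deriv v h))"
    by (auto simp: smooth_upto_def)
next
  assume R: "h differentiable_on S \<and> (\<forall>v. smooth_upto n S (dir_deriv v h))"
  show "smooth_upto (Suc n) S h"
    unfolding smooth_upto_def
  proof (intro allI impI)
    fix vs :: "'a list" assume "length vs \<le> Suc n"
    \<comment> \<open>\<open>foldr\<close> applies the last entry first, so the innermost derivative
      is found at the end of the list.\<close>
    then show "foldr dir_deriv vs h differentiable_on S"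
      using R by (cases vs rule: rev_cases) (auto simp: smooth_upto_def)
  qed
qed

lemma differentiable_on_cong_open:
  assumes "open S" "\<And>q. q \<in> S \<Longrightarrow> h q = k q" "h differentiable_on S"
  shows "k differentiable_on S"
  using assms by (metis differentiable_on_def differentiable_def has_derivative_transform)

lemma smooth_upto_cong:
  assumes "open S" "\<And>q. q \<in> S \<Longrightarrow> h q = k q" "smooth_upto n S h"
  shows "smooth_upto n S k"
  using assms(2,3)
proof (induction n arbitrary: h k)
  case 0
  then show ?case using differentiable_on_cong_open[OF assms(1)] by (auto simp: smooth_upto_0)
next
  case (Suc n)
  have "dir_deriv v h q = dir_deriv v k q" if "q \<in> S" for v q
    using dir_deriv_cong[OF assms(1) that] Suc.prems by blast
  then show ?case
    using Suc.IH[of "dir_deriv _ h" "dir_deriv _ k"] Suc.prems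
      differentiable_on_cong_open[OF assms(1)]
    unfolding smooth_upto_Suc by blast
qed

lemma smooth_on_cong:
  assumes "open S" "\<And>q. q \<in> S \<Longrightarrow> h q = k q" "smooth_on S h"
  shows "smooth_on S k"
  using assms smooth_upto_cong unfolding smooth_on_iff_upto by blast

lemma smooth_upto_SucI:
  assumes "open S" "\<And>p. p \<in> S \<Longrightarrow> (h has_derivative D p) (at p)"
    and "\<And>v. smooth_upto n S (\<lambda>p. D p v)"
  shows "smooth_upto (Suc n) S h"
proof -
  have "h differentiable_on S"
    using assms(1,2) by (meson differentiable_def differentiable_on_eq_differentiable_at)
  moreover have "smooth_upto n S (dir_deriv v h)" for v
    by (rule smooth_upto_cong[OF assms(1) _ assms(3)[of v]])
      (metis assms(2) dir_deriv_eqI)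
  ultimately show ?thesis by (simp add: smooth_upto_Suc)
qed

lemma smooth_upto_SucD: "smooth_upto (Suc n) S h \<Longrightarrow> smooth_upto n S h"
  by (simp add: smooth_upto_def)

lemma smooth_upto_differentiable:
  assumes "smooth_upto n S h" "open S" "p \<in> S"
  shows "h differentiable at p"
  using assms(1)[unfolded smooth_upto_def, rule_format, of "[]"] assms(2,3)
  by (simp add: differentiable_on_eq_differentiable_at)

lemma smooth_on_differentiable:
  assumes "smooth_on S h" "open S" "p \<in> S"
  shows "h differentiable at p"
  using assms smooth_upto_differentiable smooth_on_iff_upto by blast

lemma smooth_on_has_derivative:
  assumes "smooth_on S h" "open S" "p \<in> S"
  shows "(h has_derivative (\<lambda>v. dir_deriv v h p)) (at p)"
  using has_derivative_dir_deriv smooth_on_differentiable assms by blast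

lemma smooth_upto_has_derivative:
  assumes "smooth_upto n S h" "open S" "p \<in> S"
  shows "(h has_derivative (\<lambda>v. dir_deriv v h p)) (at p)"
  using has_derivative_dir_deriv smooth_upto_differentiable assms by blast

lemma smooth_on_continuous:
  assumes "smooth_on S h" "open S"
  shows "continuous_on S h"
  using assms by (meson continuous_at_imp_continuous_on differentiable_imp_continuous_within
      smooth_on_differentiable)

lemma smooth_on_dir_deriv: "smooth_on S h \<Longrightarrow> smooth_on S (dir_deriv v h)"
  unfolding smooth_on_iff_upto using smooth_upto_Suc by blast

lemma smooth_on_subset: "smooth_on S h \<Longrightarrow> T \<subseteq> S \<Longrightarrow> smooth_on T h"
  unfolding smooth_on_def using differentiable_on_subset by blast

lemma smooth_upto_const: "smooth_upto n S (\<lambda>_. c)"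
proof (induction n arbitrary: c)
  case (Suc n)
  have "dir_deriv v (\<lambda>_. c) = (\<lambda>_. 0)" for v :: 'a
    by (rule ext, rule dir_deriv_eqI) simp
  then show ?case by (simp add: smooth_upto_Suc Suc.IH)
qed (simp add: smooth_upto_0)

lemma smooth_on_const: "smooth_on S (\<lambda>_. c)"
  by (simp add: smooth_on_iff_upto smooth_upto_const)

lemma smooth_on_bounded_linear:
  assumes "bounded_linear l"
  shows "smooth_on S l"
  unfolding smooth_on_iff_upto
proof
  fix n
  have l: "(l has_derivative l) (at p)" for p
    using assms by (simp add: bounded_linear_imp_has_derivative)
  have "dir_deriv v l = (\<lambda>_. l v)" for v
    by (rule ext, rule dir_deriv_eqI) (rule l)
  moreover have "l differentiable_on S"
    using l by (meson differentiable_at_withinI differentiable_def differentiable_on_def)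
  ultimately show "smooth_upto n S l"
    by (cases n) (simp_all add: smooth_upto_0 smooth_upto_Suc smooth_upto_const)
qed

lemma smooth_upto_add:
  assumes S: "open S" and "smooth_upto n S f" "smooth_upto n S g"
  shows "smooth_upto n S (\<lambda>p. f p + g p)"
  using assms(2,3)
proof (induction n arbitrary: f g)
  case (Suc n)
  show ?case
    by (rule smooth_upto_SucI[OF S has_derivative_add[OF
            smooth_upto_has_derivative[OF Suc.prems(1) S]
            smooth_upto_has_derivative[OF Suc.prems(2) S]]])
      (use Suc in \<open>auto simp: smooth_upto_Suc\<close>)
qed (auto simp: smooth_upto_0)

lemma smooth_upto_bilinear:
  assumes S: "open S" and B: "bounded_bilinear B"
    and "smooth_upto n S h" "smooth_upto n S k"
  shows "smooth_upto n S (\<lambda>p. B (h p) (k p))"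
  using assms(3,4)
proof (induction n arbitrary: h k)
  case 0
  have "((\<lambda>p. B (h p) (k p)) has_derivative
      (\<lambda>v. B (h p) (dir_deriv v k p) + B (dir_deriv v h p) (k p))) (at p)" if "p \<in> S" for p
    using bounded_bilinear.FDERIV[OF B smooth_upto_has_derivative[OF 0(1) S that]
        smooth_upto_has_derivative[OF 0(2) S that]] .
  then show ?case
    using S by (auto simp: smooth_upto_0 differentiable_on_eq_differentiable_at differentiable_def)
next
  case (Suc n)
  have D: "((\<lambda>p. B (h p) (k p)) has_derivative
      (\<lambda>v. B (h p) (dir_deriv v k p) + B (dir_deriv v h p) (k p))) (at p)" if "p \<in> S" for p
    using bounded_bilinear.FDERIV[OF B smooth_upto_has_derivative[OF Suc.prems(1) S that]
        smooth_upto_has_derivative[OF Suc.prems(2) S that]] .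
  have "smooth_upto n S h" "smooth_upto n S k"
    "smooth_upto n S (dir_deriv v h)" "smooth_upto n S (dir_deriv v k)" for v
    using Suc.prems smooth_upto_SucD smooth_upto_Suc by blast+
  then show ?case
    by (intro smooth_upto_SucI[OF S D] smooth_upto_add S Suc.IH)
qed

lemma smooth_upto_Pair:
  assumes S: "open S" and "smooth_upto n S f" "smooth_upto n S g"
  shows "smooth_upto n S (\<lambda>p. (f p, g p))"
  using assms(2,3)
proof (induction n arbitrary: f g)
  case 0
  have "((\<lambda>p. (f p, g p)) has_derivative (\<lambda>v. (dir_deriv v f p, dir_deriv v g p))) (at p)"
    if "p \<in> S" for p
    using has_derivative_Pair[OF smooth_upto_has_derivative[OF 0(1) S that]
        smooth_upto_has_derivative[OF 0(2) S that]] .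
  then show ?case
    unfolding smooth_upto_0 differentiable_on_eq_differentiable_at[OF S] differentiable_def by blast
next
  case (Suc n)
  show ?case
    by (rule smooth_upto_SucI[OF S has_derivative_Pair[OF
            smooth_upto_has_derivative[OF Suc.prems(1) S]
            smooth_upto_has_derivative[OF Suc.prems(2) S]]])
      (use Suc in \<open>auto simp: smooth_upto_Suc\<close>)
qed

text \<open>The derivative of 1/h is again built from 1/h and dh, so the induction hypothesis
  applies to it through the product rule.\<close>

lemma smooth_upto_inverse:
  fixes h :: "'a::euclidean_space \<Rightarrow> real"
  assumes S: "open S" and "smooth_upto n S h" and nz: "\<And>p. p \<in> S \<Longrightarrow> h p \<noteq> 0"
  shows "smooth_upto n S (\<lambda>p. inverse (h p))"
  using assms(2)
proof (induction n)
  case 0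
  then show ?case
    using S nz by (auto simp: smooth_upto_0 differentiable_on_eq_differentiable_at)
next
  case (Suc n)
  have D: "((\<lambda>p. inverse (h p)) has_derivative
      (\<lambda>v. (-1) * (inverse (h p) * dir_deriv v h p * inverse (h p)))) (at p)" if "p \<in> S" for p
    using Deriv.has_derivative_inverse[OF nz[OF that] smooth_upto_has_derivative[OF Suc.prems S that]]
    by simp
  have "smooth_upto n S h" "smooth_upto n S (dir_deriv v h)" for v
    using Suc.prems smooth_upto_SucD smooth_upto_Suc by blast+
  then show ?case
    by (intro smooth_upto_SucI[OF S D] smooth_upto_bilinear[OF S bounded_bilinear_mult]
        smooth_upto_const Suc.IH)
qed

text \<open>Since \<open>l\<close> is the same at all points, a directional derivative of the
  composite is a directional derivative of \<open>h\<close> composed with the same \<open>L\<close>;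
  this keeps the induction closed.\<close>

lemma smooth_upto_compose_affine:
  assumes S: "open S" and T: "open T" and L: "\<And>p. p \<in> T \<Longrightarrow> (L has_derivative l) (at p)"
    and LT: "L ` T \<subseteq> S" and "smooth_upto n S h"
  shows "smooth_upto n T (\<lambda>p. h (L p))"
  using assms(5)
proof (induction n arbitrary: h)
  case 0
  have "(\<lambda>p. h (L p)) differentiable (at p)" if "p \<in> T" for p
    using has_derivative_compose[OF L[OF that] smooth_upto_has_derivative[OF 0 S]] LT that
    unfolding differentiable_def by blast
  then show ?case
    using T by (simp add: smooth_upto_0 differentiable_on_eq_differentiable_at)
next
  case (Suc n)
  have "((\<lambda>p. h (L p)) has_derivative (\<lambda>v. dir_deriv (l v) h (L p))) (at p)" if "p \<in> T" for p
    using has_derivative_compose[OF L[OF that] smooth_upto_has_derivative[OF Suc.prems S]] LT that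
    by blast
  then show ?case
    by (rule smooth_upto_SucI[OF T]) (use Suc in \<open>auto simp: smooth_upto_Suc\<close>)
qed

lemma smooth_on_add:
  "open S \<Longrightarrow> smooth_on S f \<Longrightarrow> smooth_on S g \<Longrightarrow> smooth_on S (\<lambda>p. f p + g p)"
  by (simp add: smooth_on_iff_upto smooth_upto_add)

lemma smooth_on_mult:
  fixes f g :: "'a::euclidean_space \<Rightarrow> real"
  shows "open S \<Longrightarrow> smooth_on S f \<Longrightarrow> smooth_on S g \<Longrightarrow> smooth_on S (\<lambda>p. f p * g p)"
  by (simp add: smooth_on_iff_upto smooth_upto_bilinear[OF _ bounded_bilinear_mult])

lemma smooth_on_minus:
  fixes f :: "'a::euclidean_space \<Rightarrow> real"
  shows "open S \<Longrightarrow> smooth_on S f \<Longrightarrow> smooth_on S (\<lambda>p. - f p)"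
  using smooth_on_mult[OF _ smooth_on_const[of S "-1"], of f] by simp

lemma smooth_on_diff:
  fixes f g :: "'a::euclidean_space \<Rightarrow> real"
  shows "open S \<Longrightarrow> smooth_on S f \<Longrightarrow> smooth_on S g \<Longrightarrow> smooth_on S (\<lambda>p. f p - g p)"
  using smooth_on_add[OF _ _ smooth_on_minus, of S f g] by simp

lemma smooth_on_inverse:
  fixes f :: "'a::euclidean_space \<Rightarrow> real"
  shows "open S \<Longrightarrow> smooth_on S f \<Longrightarrow> (\<And>p. p \<in> S \<Longrightarrow> f p \<noteq> 0) \<Longrightarrow> smooth_on S (\<lambda>p. inverse (f p))"
  by (simp add: smooth_on_iff_upto smooth_upto_inverse)

lemma smooth_on_divide:
  fixes f g :: "'a::euclidean_space \<Rightarrow> real"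
  shows "open S \<Longrightarrow> smooth_on S f \<Longrightarrow> smooth_on S g \<Longrightarrow> (\<And>p. p \<in> S \<Longrightarrow> g p \<noteq> 0) \<Longrightarrow>
    smooth_on S (\<lambda>p. f p / g p)"
  using smooth_on_mult[OF _ _ smooth_on_inverse, of S f g] by (simp add: divide_inverse)

lemma smooth_on_power:
  fixes f :: "'a::euclidean_space \<Rightarrow> real"
  shows "open S \<Longrightarrow> smooth_on S f \<Longrightarrow> smooth_on S (\<lambda>p. f p ^ n)"
  by (induction n) (simp_all add: smooth_on_const smooth_on_mult)

lemma smooth_on_Pair:
  "open S \<Longrightarrow> smooth_on S f \<Longrightarrow> smooth_on S g \<Longrightarrow> smooth_on S (\<lambda>p. (f p, g p))"
  by (simp add: smooth_on_iff_upto smooth_upto_Pair)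

lemma smooth_on_compose_affine:
  assumes "smooth_on S h" "open S" "open T" "\<And>p. p \<in> T \<Longrightarrow> (L has_derivative l) (at p)"
    and "L ` T \<subseteq> S"
  shows "smooth_on T (\<lambda>p. h (L p))"
  unfolding smooth_on_iff_upto
proof
  show "smooth_upto n T (\<lambda>p. h (L p))" for n
    using smooth_upto_compose_affine[where S = S and L = L and l = l and h = h and n = n] assms
    unfolding smooth_on_iff_upto by fast
qed

lemmas smooth_on_projections =
  smooth_on_bounded_linear[OF bounded_linear_ident]
  smooth_on_bounded_linear[OF bounded_linear_fst]
  smooth_on_bounded_linear[OF bounded_linear_snd]
  smooth_on_bounded_linear[OF bounded_linear_compose[OF bounded_linear_fst bounded_linear_snd]]
  smooth_on_bounded_linear[OF bounded_linear_compose[OF bounded_linear_snd bounded_linear_snd]]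

lemmas smooth_intros = smooth_on_const smooth_on_add smooth_on_mult smooth_on_minus smooth_on_diff
  smooth_on_divide smooth_on_inverse smooth_on_power smooth_on_Pair smooth_on_projections

text \<open>The mean value theorem is applied twice, first along \<open>u\<close> and then along
  \<open>v\<close>. The second difference on the left is symmetric in \<open>u\<close> and
  \<open>v\<close>, which is what yields the symmetry of second derivatives.\<close>

lemma mixed_difference:
  fixes h :: "'a::euclidean_space \<Rightarrow> real"
  assumes h: "smooth_on S h" and S: "open S" and s: "s > 0"
    and dom: "\<And>a b. 0 \<le> a \<Longrightarrow> a \<le> s \<Longrightarrow> 0 \<le> b \<Longrightarrow> b \<le> s \<Longrightarrow> p + a *\<^sub>R u + b *\<^sub>R v \<in> S"
  obtains a b where "0 \<le> a" "a \<le> s" "0 \<le> b" "b \<le> s"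
    "h (p + s *\<^sub>R u + s *\<^sub>R v) - h (p + s *\<^sub>R u) - h (p + s *\<^sub>R v) + h p
      = s\<^sup>2 * dir_deriv v (dir_deriv u h) (p + a *\<^sub>R u + b *\<^sub>R v)"
proof -
  have line: "((\<lambda>a. k (q + a *\<^sub>R w)) has_real_derivative dir_deriv w k (q + a *\<^sub>R w)) (at a)"
    if "smooth_on S k" "q + a *\<^sub>R w \<in> S" for k :: "'a \<Rightarrow> real" and q w a
  proof -
    have L: "((\<lambda>a. q + a *\<^sub>R w) has_derivative (\<lambda>t. t *\<^sub>R w)) (at a)"
      by (auto intro!: derivative_eq_intros)
    have D: "(k has_derivative (\<lambda>v. dir_deriv v k (q + a *\<^sub>R w))) (at (q + a *\<^sub>R w))"
      using smooth_on_has_derivative[OF that(1) S that(2)] .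
    have "dir_deriv (t *\<^sub>R w) k (q + a *\<^sub>R w) = t * dir_deriv w k (q + a *\<^sub>R w)" for t
      using linear_scale[OF has_derivative_linear[OF D]] by simp
    then show ?thesis
      using has_derivative_compose[OF L D]
      by (simp add: has_field_derivative_def mult.commute[of _ "dir_deriv w k (q + a *\<^sub>R w)"])
  qed
  define g where "g a = h (p + s *\<^sub>R v + a *\<^sub>R u) - h (p + a *\<^sub>R u)" for a
  have in1: "p + s *\<^sub>R v + a *\<^sub>R u \<in> S" "p + a *\<^sub>R u \<in> S" if "0 \<le> a" "a \<le> s" for a
    using dom[of a s] dom[of a 0] that s by (auto simp: algebra_simps)
  have "(g has_real_derivative dir_deriv u h (p + s *\<^sub>R v + a *\<^sub>R u) - dir_deriv u h (p + a *\<^sub>R u)) (at a)"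
    if "0 \<le> a" "a \<le> s" for a
    unfolding g_def using in1[OF that] line[OF h] by (intro DERIV_diff) auto
  from MVT2[OF s this] obtain a where a: "0 < a" "a < s"
    "g s - g 0 = s * (dir_deriv u h (p + s *\<^sub>R v + a *\<^sub>R u) - dir_deriv u h (p + a *\<^sub>R u))"
    by auto
  have "((\<lambda>b. dir_deriv u h (p + a *\<^sub>R u + b *\<^sub>R v)) has_real_derivative
      dir_deriv v (dir_deriv u h) (p + a *\<^sub>R u + b *\<^sub>R v)) (at b)" if "0 \<le> b" "b \<le> s" for b
    using line[OF smooth_on_dir_deriv[OF h]] dom[of a b] a that by auto
  from MVT2[OF s this] obtain b where b: "0 < b" "b < s"
    "dir_deriv u h (p + a *\<^sub>R u + s *\<^sub>R v) - dir_deriv u h (p + a *\<^sub>R u) =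
      s * dir_deriv v (dir_deriv u h) (p + a *\<^sub>R u + b *\<^sub>R v)"
    by auto
  have "g s - g 0 = s\<^sup>2 * dir_deriv v (dir_deriv u h) (p + a *\<^sub>R u + b *\<^sub>R v)"
    using a(3) b(3) by (simp add: power2_eq_square algebra_simps)
  then show ?thesis
    using that[of a b] a b by (simp add: g_def algebra_simps)
qed

lemma dir_deriv_commute:
  fixes h :: "'a::euclidean_space \<Rightarrow> real"
  assumes h: "smooth_on S h" and S: "open S" and p: "p \<in> S"
  shows "dir_deriv v (dir_deriv u h) p = dir_deriv u (dir_deriv v h) p"
proof (rule ccontr)
  define A where "A = dir_deriv v (dir_deriv u h)"
  define B where "B = dir_deriv u (dir_deriv v h)"
  assume "dir_deriv v (dir_deriv u h) p \<noteq> dir_deriv u (dir_deriv v h) p"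
  then have e: "\<bar>A p - B p\<bar> / 2 > 0" by (simp add: A_def B_def)
  have "isCont A p" "isCont B p"
    unfolding A_def B_def
    using h p S smooth_on_dir_deriv smooth_on_continuous continuous_on_eq_continuous_at by blast+
  then obtain d1 d2 where d: "d1 > 0" "d2 > 0"
    "\<And>q. dist q p < d1 \<Longrightarrow> dist (A q) (A p) < \<bar>A p - B p\<bar> / 2"
    "\<And>q. dist q p < d2 \<Longrightarrow> dist (B q) (B p) < \<bar>A p - B p\<bar> / 2"
    using e unfolding continuous_at_eps_delta by metis
  obtain d3 where d3: "d3 > 0" "ball p d3 \<subseteq> S" using S p openE by blast
  define d where "d = min d1 (min d2 d3)"
  \<comment> \<open>The factor 2 keeps the parallelogram with sides \<open>s *\<^sub>R u\<close> and
    \<open>s *\<^sub>R v\<close> within distance d/2 of \<open>p\<close>; the summand 1 keeps the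
    denominator positive when \<open>u\<close> and \<open>v\<close> are both zero.\<close>
  define s where "s = d / (2 * (norm u + norm v + 1))"
  have "d > 0" using d d3 by (simp add: d_def)
  then have s: "s > 0" unfolding s_def
    by (intro divide_pos_pos) (auto intro: add_nonneg_pos)
  have close: "dist (p + a *\<^sub>R u + b *\<^sub>R v) p < d" if "0 \<le> a" "a \<le> s" "0 \<le> b" "b \<le> s" for a b
  proof -
    have "dist (p + a *\<^sub>R u + b *\<^sub>R v) p = norm (a *\<^sub>R u + b *\<^sub>R v)"
      by (simp add: dist_norm add.assoc)
    also have "\<dots> \<le> a * norm u + b * norm v"
      using norm_triangle_ineq[of "a *\<^sub>R u" "b *\<^sub>R v"] that by simp
    also have "\<dots> \<le> s * norm u + s * norm v"
      using that by (intro add_mono mult_right_mono) auto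
    also have "\<dots> \<le> s * (norm u + norm v + 1)" using s by (simp add: algebra_simps)
    also have "\<dots> = d / 2"
      using norm_ge_zero[of u] norm_ge_zero[of v] unfolding s_def
      by (simp add: divide_simps del: norm_ge_zero)
    finally show ?thesis using \<open>d > 0\<close> by linarith
  qed
  then have dom: "p + a *\<^sub>R u + b *\<^sub>R v \<in> S" if "0 \<le> a" "a \<le> s" "0 \<le> b" "b \<le> s" for a b
    using that d3(2) by (force simp: d_def dist_commute)
  then have dom': "p + a *\<^sub>R v + b *\<^sub>R u \<in> S" if "0 \<le> a" "a \<le> s" "0 \<le> b" "b \<le> s" for a b
    using that dom[of b a] by (simp add: algebra_simps)
  obtain a b where ab: "0 \<le> a" "a \<le> s" "0 \<le> b" "b \<le> s"
    "h (p + s *\<^sub>R u + s *\<^sub>R v) - h (p + s *\<^sub>R u) - h (p + s *\<^sub>R v) + h p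
      = s\<^sup>2 * A (p + a *\<^sub>R u + b *\<^sub>R v)"
    using mixed_difference[OF h S s dom] unfolding A_def by blast
  obtain a' b' where ab': "0 \<le> a'" "a' \<le> s" "0 \<le> b'" "b' \<le> s"
    "h (p + s *\<^sub>R v + s *\<^sub>R u) - h (p + s *\<^sub>R v) - h (p + s *\<^sub>R u) + h p
      = s\<^sup>2 * B (p + a' *\<^sub>R v + b' *\<^sub>R u)"
    using mixed_difference[OF h S s dom'] unfolding B_def by blast
  have e: "p + s *\<^sub>R v + s *\<^sub>R u = p + s *\<^sub>R u + s *\<^sub>R v"
    "p + a' *\<^sub>R v + b' *\<^sub>R u = p + b' *\<^sub>R u + a' *\<^sub>R v"
    by (simp_all add: algebra_simps)
  have "s\<^sup>2 * A (p + a *\<^sub>R u + b *\<^sub>R v) = s\<^sup>2 * B (p + b' *\<^sub>R u + a' *\<^sub>R v)"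
    using ab(5) ab'(5) unfolding e by linarith
  then have "A (p + a *\<^sub>R u + b *\<^sub>R v) = B (p + b' *\<^sub>R u + a' *\<^sub>R v)" using s by simp
  moreover have "dist (A (p + a *\<^sub>R u + b *\<^sub>R v)) (A p) < \<bar>A p - B p\<bar> / 2"
    "dist (B (p + b' *\<^sub>R u + a' *\<^sub>R v)) (B p) < \<bar>A p - B p\<bar> / 2"
    using d(3,4) close[OF ab(1-4)] close[OF ab'(3,4) ab'(1,2)] by (auto simp: d_def)
  ultimately show False by (smt (verit) dist_real_def field_sum_of_halves)
qed

subsection \<open>Functions of two variables\<close>

abbreviation pd1 :: "(real \<times> real \<Rightarrow> real) \<Rightarrow> real \<times> real \<Rightarrow> real" where
  "pd1 \<equiv> dir_deriv (1, 0)"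

abbreviation pd2 :: "(real \<times> real \<Rightarrow> real) \<Rightarrow> real \<times> real \<Rightarrow> real" where
  "pd2 \<equiv> dir_deriv (0, 1)"

lemma dir_deriv_plane:
  assumes "h differentiable at p"
  shows "dir_deriv (a, b) h p = a * pd1 h p + b * pd2 h p"
proof -
  have "linear (\<lambda>v. dir_deriv v h p)"
    using has_derivative_linear[OF has_derivative_dir_deriv[OF assms]] .
  from linear_add[OF this, of "(a, 0)" "(0, b)"] linear_scale[OF this, of a "(1, 0)"]
    linear_scale[OF this, of b "(0, 1)"]
  show ?thesis by simp
qed

lemma has_derivative_plane:
  assumes "h differentiable at p"
  shows "(h has_derivative (\<lambda>v. fst v * pd1 h p + snd v * pd2 h p)) (at p)"
proof -
  have "dir_deriv v h p = fst v * pd1 h p + snd v * pd2 h p" for v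
    using dir_deriv_plane[OF assms, of "fst v" "snd v"] by simp
  then show ?thesis
    by (intro has_derivative_eq_rhs[OF has_derivative_dir_deriv[OF assms]] ext)
qed

lemma has_real_derivative_pd1:
  assumes "h differentiable at (x, y)"
  shows "((\<lambda>x. h (x, y)) has_real_derivative pd1 h (x, y)) (at x)"
proof -
  have "((\<lambda>x. (x, y)) has_derivative (\<lambda>v. (v, 0))) (at x)"
    by (auto intro!: derivative_eq_intros)
  from has_derivative_compose[OF this has_derivative_plane[OF assms]]
  show ?thesis by (simp add: has_field_derivative_def mult.commute[of _ "pd1 h (x, y)"])
qed

lemma has_real_derivative_pd2:
  assumes "h differentiable at (x, y)"
  shows "((\<lambda>y. h (x, y)) has_real_derivative pd2 h (x, y)) (at y)"
proof -
  have "((\<lambda>y. (x, y)) has_derivative (\<lambda>v. (0, v))) (at y)"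
    by (auto intro!: derivative_eq_intros)
  from has_derivative_compose[OF this has_derivative_plane[OF assms]]
  show ?thesis by (simp add: has_field_derivative_def mult.commute[of _ "pd2 h (x, y)"])
qed

text \<open>The curried and the uncurried derivative are compared through values on \<open>J\<close>
  alone, so the comparison can be iterated although the two sides may differ outside the
  domain.\<close>

lemma partial_y_eq_pd2:
  assumes "open J" "y \<in> J" "\<And>y. y \<in> J \<Longrightarrow> f x y = h (x, y)" "h differentiable at (x, y)"
  shows "partial_y f x y = pd2 h (x, y)"
proof -
  have "(f x has_real_derivative pd2 h (x, y)) (at y)"
    using has_field_derivative_transform_within_open[OF has_real_derivative_pd2[OF assms(4)]] assms
    by metis
  then show ?thesis by (simp add: partial_y_def DERIV_imp_deriv)
qed

lemma dir_deriv_pullback: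
  fixes u :: "real \<times> real \<times> real"
  assumes "h differentiable at (fst p, fst (snd p))"
  shows "((\<lambda>q. h (fst q, fst (snd q))) has_derivative (\<lambda>u. fst u * pd1 h (fst p, fst (snd p)) +
            fst (snd u) * pd2 h (fst p, fst (snd p)))) (at p)"
    and "dir_deriv u (\<lambda>q. h (fst q, fst (snd q))) p =
      fst u * pd1 h (fst p, fst (snd p)) + fst (snd u) * pd2 h (fst p, fst (snd p))"
proof -
  have "((\<lambda>q. (fst q, fst (snd q))) has_derivative (\<lambda>u. (fst u, fst (snd u)))) (at p)"
    by (auto intro!: derivative_eq_intros)
  from has_derivative_compose[OF this has_derivative_plane[OF assms]]
  show *: "((\<lambda>q. h (fst q, fst (snd q))) has_derivative (\<lambda>u. fst u * pd1 h (fst p, fst (snd p)) +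
            fst (snd u) * pd2 h (fst p, fst (snd p)))) (at p)" by simp
  show "dir_deriv u (\<lambda>q. h (fst q, fst (snd q))) p =
      fst u * pd1 h (fst p, fst (snd p)) + fst (snd u) * pd2 h (fst p, fst (snd p))"
    using dir_deriv_eqI[OF *] .
qed

subsection \<open>The curvature of the metric\<close>

lemma metric_f_eq:
  "metric_f f p u v = - 2 * f (fst p) (fst (snd p)) * fst u * fst v + fst u * snd (snd v) +
     snd (snd u) * fst v + fst (snd u) * fst (snd v)"
  by (simp add: metric_f_def case_prod_beta)

text \<open>On coordinate fields the values that need not vanish are
  \<open>\<nabla>\<^sub>x\<partial>\<^sub>x = F\<^sub>y\<partial>\<^sub>y -
  F\<^sub>x\<partial>\<^sub>t\<close> and \<open>\<nabla>\<^sub>x\<partial>\<^sub>y =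
  \<nabla>\<^sub>y\<partial>\<^sub>x = - F\<^sub>y\<partial>\<^sub>t\<close>. The zero in the first
  component says that dx is parallel.\<close>

definition christoffel ::
  "(real \<times> real \<Rightarrow> real) \<Rightarrow> real \<times> real \<times> real \<Rightarrow> real \<times> real \<times> real \<Rightarrow> real \<times> real \<times> real \<Rightarrow>
     real \<times> real \<times> real" where
  "christoffel F p u v = (let q = (fst p, fst (snd p)) in
     (0, pd2 F q * (fst u * fst v),
      - (pd1 F q * (fst u * fst v)) - pd2 F q * (fst u * fst (snd v) + fst (snd u) * fst v)))"

lemma is_levi_civita_at_christoffel:
  assumes "case_prod f differentiable at (fst p, fst (snd p))"
  shows "is_levi_civita_at (metric_f f) p (christoffel (case_prod f) p)"
proof -
  have "bilinear (christoffel (case_prod f) p)"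
    unfolding bilinear_def christoffel_def Let_def
    by (intro conjI allI linearI) (simp_all add: algebra_simps)
  moreover have "dir_deriv u (\<lambda>q. metric_f f q v w) p =
      metric_f f p (christoffel (case_prod f) p u v) w +
      metric_f f p v (christoffel (case_prod f) p u w)" for u v w
  proof -
    have *: "((\<lambda>q. metric_f f q v w) has_derivative (\<lambda>u. - 2 * (fst u * pd1 (case_prod f) (fst p, fst (snd p)) +
            fst (snd u) * pd2 (case_prod f) (fst p, fst (snd p))) * fst v * fst w)) (at p)"
      unfolding metric_f_eq
      using dir_deriv_pullback(1)[OF assms]
      by (auto intro!: derivative_eq_intros simp: algebra_simps)
    show ?thesis
      unfolding dir_deriv_eqI[OF *]
      by (simp add: metric_f_eq christoffel_def Let_def algebra_simps)
  qed
  ultimately show ?thesis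
    by (simp add: is_levi_civita_at_def christoffel_def algebra_simps)
qed

lemma metric_f_bilinear: "bilinear (metric_f f p)"
  unfolding bilinear_def metric_f_eq by (intro conjI allI linearI) (simp_all add: algebra_simps)

lemma metric_f_sym: "metric_f f p u v = metric_f f p v u"
  by (simp add: metric_f_eq)

lemma metric_f_nondegenerate:
  assumes "\<And>v. metric_f f p u v = 0"
  shows "u = 0"
proof -
  have "fst u = 0" using assms[of "(0, 0, 1)"] by (simp add: metric_f_eq)
  moreover have "fst (snd u) = 0" using assms[of "(0, 1, 0)"] by (simp add: metric_f_eq)
  ultimately show ?thesis
    using assms[of "(1, 0, 0)"] by (simp add: metric_f_eq prod_eq_iff)
qed

lemma levi_civita_metric_f:
  assumes "case_prod f differentiable at (fst p, fst (snd p))"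
  shows "levi_civita (metric_f f) p = christoffel (case_prod f) p"
  by (rule levi_civita_eqI[OF metric_f_bilinear metric_f_sym metric_f_nondegenerate
        is_levi_civita_at_christoffel[OF assms]])

definition bivector :: "real \<times> real \<times> real \<Rightarrow> real \<times> real \<times> real \<Rightarrow> real" where
  "bivector u v = fst u * fst (snd v) - fst (snd u) * fst v"

locale plane_wave =
  fixes I J :: "real set" and f :: "real \<Rightarrow> real \<Rightarrow> real"
  assumes open_I: "open I" and open_J: "open J" and smooth: "smooth_on (I \<times> J) (case_prod f)"
begin

abbreviation "F \<equiv> case_prod f"
abbreviation "D \<equiv> I \<times> J"
abbreviation "U \<equiv> I \<times> J \<times> (UNIV :: real set)"
abbreviation "h \<equiv> pd2 (pd2 F)"

lemma open_D: "open D" and open_U: "open U"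
  using open_I open_J by (simp_all add: open_Times)

lemma smooth_iterated:
  "smooth_on D F" "smooth_on D (pd1 F)" "smooth_on D (pd2 F)" "smooth_on D h"
  "smooth_on D (pd1 h)" "smooth_on D (pd2 h)"
  "smooth_on D (pd1 (pd1 h))" "smooth_on D (pd1 (pd2 h))"
  "smooth_on D (pd2 (pd1 h))" "smooth_on D (pd2 (pd2 h))"
  by (intro smooth_on_dir_deriv smooth)+

lemmas differentiable_iterated = smooth_iterated[THEN smooth_on_differentiable, OF open_D]

lemma base_in_D: "p \<in> U \<Longrightarrow> (fst p, fst (snd p)) \<in> D"
  by auto

lemma levi_civita: "p \<in> U \<Longrightarrow> levi_civita (metric_f f) p = christoffel F p"
  by (rule levi_civita_metric_f[OF differentiable_iterated(1)[OF base_in_D]])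

lemma cov_deriv_vec_const:
  "p \<in> U \<Longrightarrow> cov_deriv_vec (metric_f f) v (\<lambda>_. w) p = christoffel F p v w"
  by (simp add: cov_deriv_vec_def levi_civita dir_deriv_eqI[OF has_derivative_const])

lemma cov_deriv_vec_2:
  assumes p: "p \<in> U"
  shows "cov_deriv_vec (metric_f f) u (cov_deriv_vec (metric_f f) v (\<lambda>_. w)) p =
    (let q = (fst p, fst (snd p)); dx = fst u * pd1 (pd1 F) q + fst (snd u) * pd2 (pd1 F) q;
       dy = fst u * pd1 (pd2 F) q + fst (snd u) * pd2 (pd2 F) q in
     (0, dy * (fst v * fst w),
      - (dx * (fst v * fst w)) - dy * (fst v * fst (snd w) + fst (snd v) * fst w))) +
    christoffel F p u (christoffel F p v w)"
proof -
  have "dir_deriv u (cov_deriv_vec (metric_f f) v (\<lambda>_. w)) p =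
      dir_deriv u (\<lambda>q. christoffel F q v w) p"
    by (rule dir_deriv_cong[OF open_U p]) (rule cov_deriv_vec_const)
  moreover have "((\<lambda>q. christoffel F q v w) has_derivative (\<lambda>u.
    (let q = (fst p, fst (snd p)); dx = fst u * pd1 (pd1 F) q + fst (snd u) * pd2 (pd1 F) q;
       dy = fst u * pd1 (pd2 F) q + fst (snd u) * pd2 (pd2 F) q in
     (0, dy * (fst v * fst w),
      - (dx * (fst v * fst w)) - dy * (fst v * fst (snd w) + fst (snd v) * fst w))))) (at p)"
    unfolding christoffel_def Let_def
    using dir_deriv_pullback(1)[OF differentiable_iterated(2)[OF base_in_D[OF p]]]
      dir_deriv_pullback(1)[OF differentiable_iterated(3)[OF base_in_D[OF p]]]
    by (auto intro!: derivative_eq_intros)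
  ultimately show ?thesis
    using p unfolding cov_deriv_vec_def[of _ u]
    by (simp add: levi_civita cov_deriv_vec_const dir_deriv_eqI)
qed

text \<open>The terms quadratic in the connection are symmetric in \<open>u\<close> and
  \<open>v\<close> and cancel, and the mixed derivatives of F cancel by symmetry; only F_yy
  survives. The order \<open>z\<close>, \<open>w\<close> in the second factor accounts for the
  sign.\<close>

lemma curvature_eq:
  assumes p: "p \<in> U"
  shows "curvature (metric_f f) p u v w z =
    h (fst p, fst (snd p)) * bivector u v * bivector z w"
proof -
  have c: "pd2 (pd1 F) (fst p, fst (snd p)) = pd1 (pd2 F) (fst p, fst (snd p))"
    using dir_deriv_commute[OF smooth open_D base_in_D[OF p]] .
  show ?thesis
    unfolding curvature_def cov_deriv_vec_2[OF p]
    by (simp add: metric_f_eq christoffel_def bivector_def Let_def c algebra_simps)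
qed

text \<open>This is the parallelism of dx \<and> dy. It makes the four corrections in the curvature
  slots sum to zero in every covariant derivative below.\<close>

lemma bivector_christoffel:
  "bivector (christoffel F p d u) v + bivector u (christoffel F p d v) = 0"
  by (simp add: christoffel_def bivector_def Let_def)

lemma nabla_R_0:
  assumes p: "p \<in> U"
  shows "nabla_R (metric_f f) 0 p [u, v, w, z] =
    h (fst p, fst (snd p)) * (bivector u v * bivector z w)"
  using p by (simp add: curvature_eq numeral_2_eq_2 numeral_3_eq_3)

lemma nabla_R_1:
  assumes p: "p \<in> U"
  shows "nabla_R (metric_f f) 1 p [d, u, v, w, z] =
    (fst d * pd1 h (fst p, fst (snd p)) + fst (snd d) * pd2 h (fst p, fst (snd p))) *
    (bivector u v * bivector z w)"
proof -
  let ?\<Omega> = "\<lambda>u v w z. bivector u v * bivector z w"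
  let ?G = "christoffel F p d"
  let ?h = "h (fst p, fst (snd p))"
  have "dir_deriv d (\<lambda>q. nabla_R (metric_f f) 0 q [u, v, w, z]) p =
      dir_deriv d (\<lambda>q. h (fst q, fst (snd q)) * ?\<Omega> u v w z) p"
    by (rule dir_deriv_cong[OF open_U p]) (rule nabla_R_0)
  moreover have "dir_deriv d (\<lambda>q. h (fst q, fst (snd q)) * ?\<Omega> u v w z) p =
      (fst d * pd1 h (fst p, fst (snd p)) + fst (snd d) * pd2 h (fst p, fst (snd p))) * ?\<Omega> u v w z"
    using dir_deriv_eqI[OF has_derivative_mult_left[OF dir_deriv_pullback(1)[OF
            differentiable_iterated(4)[OF base_in_D[OF p]]]]] .
  moreover have "?\<Omega> (?G u) v w z + ?\<Omega> u (?G v) w z + ?\<Omega> u v (?G w) z + ?\<Omega> u v w (?G z) = 0"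
    using bivector_christoffel[of p d u v] bivector_christoffel[of p d z w] by algebra
  then have "?h * ?\<Omega> (?G u) v w z + ?h * ?\<Omega> u (?G v) w z + ?h * ?\<Omega> u v (?G w) z + ?h * ?\<Omega> u v w (?G z) = 0"
    by algebra
  ultimately show ?thesis
    using p
    by (simp add: cov_deriv_tensor_def cov_deriv_vec_const nabla_R_0[OF p]
        numeral_eq_Suc del: nabla_R.simps(1))
qed

text \<open>Of the correction terms only the one in the slot of \<open>d\<close> survives. It is dh
  applied to \<open>christoffel F p e d\<close>, that is F_y h_y times the first components; here
  F_y enters, which later determines f itself.\<close>

lemma nabla_R_2:
  assumes p: "p \<in> U"
  shows "nabla_R (metric_f f) 2 p [e, d, u, v, w, z] =
    (let q = (fst p, fst (snd p)) in
     fst d * (fst e * pd1 (pd1 h) q + fst (snd e) * pd2 (pd1 h) q) +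
     fst (snd d) * (fst e * pd1 (pd2 h) q + fst (snd e) * pd2 (pd2 h) q) -
     pd2 F q * pd2 h q * (fst e * fst d)) * (bivector u v * bivector z w)"
proof -
  let ?\<Omega> = "\<lambda>u v w z. bivector u v * bivector z w"
  let ?G = "christoffel F p e"
  let ?q = "(fst p, fst (snd p))"
  define dh where "dh d q = fst d * pd1 h (fst q, fst (snd q)) + fst (snd d) * pd2 h (fst q, fst (snd q))"
    for d q :: "real \<times> real \<times> real"
  have n1: "nabla_R (metric_f f) 1 q [d, u, v, w, z] = dh d q * ?\<Omega> u v w z" if "q \<in> U" for q d u v w z
    using nabla_R_1[OF that] by (simp add: dh_def)
  have D1: "dir_deriv e (\<lambda>q. nabla_R (metric_f f) 1 q [d, u, v, w, z]) p =
      dir_deriv e (\<lambda>q. dh d q * ?\<Omega> u v w z) p"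
    by (rule dir_deriv_cong[OF open_U p]) (rule n1)
  have "((\<lambda>q. dh d q * ?\<Omega> u v w z) has_derivative
      (\<lambda>e. (fst d * (fst e * pd1 (pd1 h) ?q + fst (snd e) * pd2 (pd1 h) ?q) +
       fst (snd d) * (fst e * pd1 (pd2 h) ?q + fst (snd e) * pd2 (pd2 h) ?q)) * ?\<Omega> u v w z)) (at p)"
    unfolding dh_def
    by (intro has_derivative_mult_left has_derivative_add has_derivative_mult_right
        dir_deriv_pullback(1) differentiable_iterated base_in_D p)
  note D2 = dir_deriv_eqI[OF this, of e]
  have "?\<Omega> (?G u) v w z + ?\<Omega> u (?G v) w z + ?\<Omega> u v (?G w) z + ?\<Omega> u v w (?G z) = 0"
    using bivector_christoffel[of p e u v] bivector_christoffel[of p e z w] by algebra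
  then have sum: "dh d p * ?\<Omega> (?G u) v w z + dh d p * ?\<Omega> u (?G v) w z + dh d p * ?\<Omega> u v (?G w) z +
      dh d p * ?\<Omega> u v w (?G z) = 0"
    by algebra
  have dhG: "dh (?G d) p = pd2 F ?q * pd2 h ?q * (fst e * fst d)"
    by (simp add: dh_def christoffel_def Let_def)
  have split: "nabla_R (metric_f f) 2 p [e, d, u, v, w, z] =
      dir_deriv e (\<lambda>q. nabla_R (metric_f f) 1 q [d, u, v, w, z]) p -
      (nabla_R (metric_f f) 1 p [?G d, u, v, w, z] + nabla_R (metric_f f) 1 p [d, ?G u, v, w, z] +
       nabla_R (metric_f f) 1 p [d, u, ?G v, w, z] + nabla_R (metric_f f) 1 p [d, u, v, ?G w, z] +
       nabla_R (metric_f f) 1 p [d, u, v, w, ?G z])"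
    unfolding numeral_2_eq_2 nabla_R.simps(2)[of _ "Suc 0"] One_nat_def cov_deriv_tensor_def[of _ "nabla_R _ (Suc 0)"]
    using p by (simp add: cov_deriv_vec_const numeral_eq_Suc del: nabla_R.simps)
  show ?thesis
    unfolding split D1 D2 n1[OF p] dhG Let_def using sum by algebra
qed

end

section \<open>Linear isometries and the pointwise equations for curvature homogeneity\<close>

lemma length_Suc_decomp:
  "length vs = 4 \<Longrightarrow> \<exists>u v w z. vs = [u, v, w, z]"
  "length vs = 5 \<Longrightarrow> \<exists>d u v w z. vs = [d, u, v, w, z]"
  by (auto simp: length_Suc_conv numeral_eq_Suc)

text \<open>\<open>\<partial>\<^sub>x \<mapsto> s\<partial>\<^sub>x + n\<partial>\<^sub>y + \<dots>\<close>, \<open>\<partial>\<^sub>y \<mapsto> \<tau>\<partial>\<^sub>y + \<dots>\<close> extends uniquely to an isometry; these are all the isometries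
  preserving the line spanned by the null direction \<open>\<partial>\<^sub>t\<close>.\<close>

lemma linear_isometry_exists:
  assumes s: "s \<noteq> 0" and \<tau>: "\<tau>\<^sup>2 = (1::real)"
  obtains \<Phi> where "linear_isometry_at (metric_f f) P Q \<Phi>"
    "\<And>u. fst (\<Phi> u) = s * fst u" "\<And>u. fst (snd (\<Phi> u)) = n * fst u + \<tau> * fst (snd u)"
proof -
  let ?a = "- 2 * f (fst P) (fst (snd P))" and ?b = "- 2 * f (fst Q) (fst (snd Q))"
  \<comment> \<open>The value of \<open>m\<close> is forced by the length of the image of
    \<open>\<partial>\<^sub>x\<close>. The other entries of the third component come from the
    orthogonality of the images of \<open>\<partial>\<^sub>x\<close> and
    \<open>\<partial>\<^sub>y\<close> and from the pairing of \<open>\<partial>\<^sub>x\<close> with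
    \<open>\<partial>\<^sub>t\<close>.\<close>
  define m where "m = (?a - ?b * s\<^sup>2 - n\<^sup>2) / (2 * s)"
  define \<Phi> :: "real \<times> real \<times> real \<Rightarrow> real \<times> real \<times> real" where
    "\<Phi> u = (s * fst u, n * fst u + \<tau> * fst (snd u),
       m * fst u - n * \<tau> / s * fst (snd u) + snd (snd u) / s)" for u
  have lin: "linear \<Phi>"
    by (rule linearI) (auto simp: \<Phi>_def algebra_simps add_divide_distrib)
  have "2 * s * m = ?a - ?b * s\<^sup>2 - n\<^sup>2" using s by (simp add: m_def)
  then have m: "?b * (s * s) + 2 * s * m + n * n = ?a" by (simp add: power2_eq_square)
  have iso: "metric_f f Q (\<Phi> u) (\<Phi> v) = metric_f f P u v" for u v
  proof -
    have "metric_f f Q (\<Phi> u) (\<Phi> v) = (?b * (s * s) + 2 * s * m + n * n) * fst u * fst v +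
        fst u * snd (snd v) + snd (snd u) * fst v + \<tau>\<^sup>2 * fst (snd u) * fst (snd v)"
      using s by (simp add: \<Phi>_def metric_f_eq power2_eq_square field_simps)
    then show ?thesis unfolding m \<tau> by (simp add: metric_f_eq)
  qed
  have "u = 0" if "\<Phi> u = 0" for u
    using iso[of u] that metric_f_nondegenerate[of f P u] by (simp add: metric_f_eq)
  then have "inj \<Phi>" using lin linear_injective_0 by blast
  then have "bij \<Phi>" using lin linear_injective_imp_surjective bij_def by blast
  then have "linear_isometry_at (metric_f f) P Q \<Phi>"
    using lin iso by (simp add: linear_isometry_at_def)
  then show thesis by (rule that) (auto simp: \<Phi>_def)
qed

text \<open>The hypothesis on \<open>bivector\<close> is the curvature equation with nonzero
  curvature at the target. It sends the kernel direction \<open>e3\<close> to the kernel direction,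
  and the metric products with \<open>e3\<close> and of \<open>e2\<close> with itself fix the
  rest.\<close>

lemma linear_isometry_shape:
  assumes iso: "linear_isometry_at (metric_f f) P Q \<Phi>"
    and k: "k \<noteq> 0" "\<And>u v w z. k * bivector (\<Phi> u) (\<Phi> v) * bivector (\<Phi> z) (\<Phi> w) = k' * bivector u v * bivector z w"
  obtains s \<tau> n where "s \<noteq> 0" "\<tau>\<^sup>2 = 1" "\<And>u. fst (\<Phi> u) = s * fst u"
    "\<And>u. fst (snd (\<Phi> u)) = n * fst u + \<tau> * fst (snd u)"
proof -
  have lin: "linear \<Phi>" and bij: "bij \<Phi>" and g: "metric_f f Q (\<Phi> u) (\<Phi> v) = metric_f f P u v" for u v
    using iso unfolding linear_isometry_at_def by blast+
  define e1 e2 e3 :: "real \<times> real \<times> real" where "e1 = (1, 0, 0)" and "e2 = (0, 1, 0)" and "e3 = (0, 0, 1)"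
  have basis: "\<Phi> u = fst u *\<^sub>R \<Phi> e1 + fst (snd u) *\<^sub>R \<Phi> e2 + snd (snd u) *\<^sub>R \<Phi> e3" for u
  proof -
    have "u = fst u *\<^sub>R e1 + fst (snd u) *\<^sub>R e2 + snd (snd u) *\<^sub>R e3"
      by (simp add: e1_def e2_def e3_def prod_eq_iff)
    from arg_cong[OF this, of \<Phi>] show ?thesis
      unfolding linear_add[OF lin] linear_scale[OF lin] .
  qed
  have e3: "bivector e3 v = 0" for v by (simp add: bivector_def e3_def)
  \<comment> \<open>The arguments \<open>e3, v', e3, v'\<close> turn the left side of the curvature
    equation into a nonzero multiple of the square of the wanted value.\<close>
  have z: "bivector (\<Phi> e3) v = 0" for v
  proof -
    obtain v' where "v = \<Phi> v'" using bij by (meson bij_pointE)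
    then have "k * bivector (\<Phi> e3) v * bivector (\<Phi> e3) v = 0"
      using k(2)[of e3 v' e3 v'] e3[of v'] by simp
    then show ?thesis using k(1) by simp
  qed
  have 3: "fst (\<Phi> e3) = 0" "fst (snd (\<Phi> e3)) = 0"
    using z[of e2] z[of e1] by (simp_all add: bivector_def e1_def e2_def)
  have 13: "fst (\<Phi> e1) * snd (snd (\<Phi> e3)) = 1"
    using g[of e1 e3] 3 by (simp add: metric_f_eq e1_def e3_def)
  have 2: "fst (\<Phi> e2) = 0"
    using g[of e2 e3] 3 13 by (auto simp: metric_f_eq e2_def e3_def)
  have "(fst (snd (\<Phi> e2)))\<^sup>2 = 1"
    using g[of e2 e2] 2 by (simp add: metric_f_eq e2_def power2_eq_square)
  moreover have "fst (\<Phi> e1) \<noteq> 0" using 13 by auto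
  moreover have "fst (\<Phi> u) = fst (\<Phi> e1) * fst u" "fst (snd (\<Phi> u)) = fst (snd (\<Phi> e1)) * fst u + fst (snd (\<Phi> e2)) * fst (snd u)" for u
    using 2 3 by (subst basis; simp)+
  ultimately show thesis using that by blast
qed

context plane_wave
begin

text \<open>The map of parameters \<open>s\<close>, \<open>\<tau>\<close>, \<open>n\<close>
  multiplies dx \<and> dy by \<open>s * \<tau>\<close>, hence its tensor square by
  \<open>s\<^sup>2\<close>. The equations compare h and the two components of dh, and the powers of
  \<open>c\<close> are the homothety weights.\<close>

lemma homogeneous_1I:
  assumes "\<And>p q. p \<in> D \<Longrightarrow> q \<in> D \<Longrightarrow> \<exists>s \<tau> n c. s \<noteq> 0 \<and> c \<noteq> 0 \<and> \<tau>\<^sup>2 = 1 \<and>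
    s\<^sup>2 * c\<^sup>2 * h q = h p \<and> \<tau> * s\<^sup>2 * c ^ 3 * pd2 h q = pd2 h p \<and>
    s\<^sup>2 * c ^ 3 * (s * pd1 h q + n * pd2 h q) = pd1 h p"
  shows "homothety_curvature_homogeneous 1 (manifold_f I J f)"
  unfolding homothety_curvature_homogeneous_def manifold_f_def prod.case
proof (intro ballI)
  fix P Q assume PQ: "P \<in> U" "Q \<in> U"
  let ?p = "(fst P, fst (snd P))" and ?q = "(fst Q, fst (snd Q))"
  obtain s \<tau> n c where c: "s \<noteq> 0" "c \<noteq> 0" "\<tau>\<^sup>2 = 1"
    and e: "h ?p = s\<^sup>2 * c\<^sup>2 * h ?q" "pd2 h ?p = \<tau> * s\<^sup>2 * c ^ 3 * pd2 h ?q"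
    "pd1 h ?p = s\<^sup>2 * c ^ 3 * (s * pd1 h ?q + n * pd2 h ?q)"
    using assms[OF PQ[THEN base_in_D]] by metis
  obtain \<Phi> where \<Phi>: "linear_isometry_at (metric_f f) P Q \<Phi>"
    and \<Phi>1: "\<And>u. fst (\<Phi> u) = s * fst u" "\<And>u. fst (snd (\<Phi> u)) = n * fst u + \<tau> * fst (snd u)"
    using linear_isometry_exists[OF c(1,3), of f P Q n] by blast
  have b: "bivector (\<Phi> u) (\<Phi> v) * bivector (\<Phi> z) (\<Phi> w) = s\<^sup>2 * (bivector u v * bivector z w)" for u v w z
  proof -
    have "bivector (\<Phi> u) (\<Phi> v) = s * \<tau> * bivector u v" for u v
      by (simp add: bivector_def \<Phi>1 algebra_simps)
    then have "bivector (\<Phi> u) (\<Phi> v) * bivector (\<Phi> z) (\<Phi> w) = s\<^sup>2 * \<tau>\<^sup>2 * (bivector u v * bivector z w)"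
      by (simp add: power2_eq_square)
    then show ?thesis by (simp add: c)
  qed
  have p2: "c powi - 2 = 1 / c\<^sup>2" and p3: "c powi - 3 = 1 / c ^ 3"
    by (simp_all add: power_int_minus divide_inverse)
  show "\<exists>\<Phi> c. linear_isometry_at (metric_f f) P Q \<Phi> \<and> c \<noteq> 0 \<and> (\<forall>l\<le>1. \<forall>vs. length vs = l + 4 \<longrightarrow>
      nabla_R (metric_f f) l Q (map \<Phi> vs) = c powi (- int l - 2) * nabla_R (metric_f f) l P vs)"
  proof (intro exI conjI allI impI)
    fix l :: nat and vs :: "(real \<times> real \<times> real) list" assume "l \<le> 1" "length vs = l + 4"
    then consider u v w z where "l = 0" "vs = [u, v, w, z]" | d u v w z where "l = 1" "vs = [d, u, v, w, z]"
      using length_Suc_decomp[of vs] by (auto simp: le_Suc_eq)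
    then show "nabla_R (metric_f f) l Q (map \<Phi> vs) = c powi (- int l - 2) * nabla_R (metric_f f) l P vs"
    proof cases
      case 1
      then show ?thesis
        using c by (simp add: nabla_R_0[OF PQ(1)] nabla_R_0[OF PQ(2)] b e p2 del: nabla_R.simps)
    next
      case 2
      have "nabla_R (metric_f f) 1 Q (map \<Phi> vs) = 1 / c ^ 3 * nabla_R (metric_f f) 1 P vs"
        unfolding 2 list.map nabla_R_1[OF PQ(1)] nabla_R_1[OF PQ(2)] b e \<Phi>1
        using c by (simp add: field_simps)
      then show ?thesis using 2 p3 by simp
    qed
  qed (fact \<Phi> c)+
qed

text \<open>Since h does not vanish at \<open>q\<close>, the equation for R alone gives the isometry
  its normal form; the other equations are then read off on coordinate vectors.\<close>

lemma homogeneousE: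
  assumes hom: "homothety_curvature_homogeneous k (manifold_f I J f)" and k: "k \<ge> 1"
    and p: "p \<in> D" and q: "q \<in> D" and nz: "h q \<noteq> 0"
  obtains s \<tau> n c where "s \<noteq> 0" "c \<noteq> 0" "\<tau>\<^sup>2 = 1"
    "s\<^sup>2 * c\<^sup>2 * h q = h p" "\<tau> * s\<^sup>2 * c ^ 3 * pd2 h q = pd2 h p"
    "s\<^sup>2 * c ^ 3 * (s * pd1 h q + n * pd2 h q) = pd1 h p"
    "k \<ge> 2 \<Longrightarrow> s\<^sup>2 * c ^ 4 * pd2 (pd2 h) q = pd2 (pd2 h) p"
    "k \<ge> 2 \<Longrightarrow> \<tau> * s\<^sup>2 * c ^ 4 * (s * pd2 (pd1 h) q + n * pd2 (pd2 h) q) = pd2 (pd1 h) p"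
    "k \<ge> 2 \<Longrightarrow> s\<^sup>2 * c ^ 4 * (s\<^sup>2 * pd1 (pd1 h) q + s * n * (pd2 (pd1 h) q + pd1 (pd2 h) q) +
       n\<^sup>2 * pd2 (pd2 h) q - pd2 F q * pd2 h q * s\<^sup>2) = pd1 (pd1 h) p - pd2 F p * pd2 h p"
proof -
  define P Q where "P = (fst p, snd p, 0::real)" and "Q = (fst q, snd q, 0::real)"
  have PQ: "P \<in> U" "Q \<in> U" and PQ': "(fst P, fst (snd P)) = p" "(fst Q, fst (snd Q)) = q"
    using p q by (auto simp: P_def Q_def)
  obtain \<Phi> c where \<Phi>: "linear_isometry_at (metric_f f) P Q \<Phi>" and c: "c \<noteq> 0"
    and R: "\<And>l vs. l \<le> k \<Longrightarrow> length vs = l + 4 \<Longrightarrow>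
      nabla_R (metric_f f) l Q (map \<Phi> vs) = c powi (- int l - 2) * nabla_R (metric_f f) l P vs"
    using hom PQ unfolding homothety_curvature_homogeneous_def manifold_f_def prod.case by meson
  have R0: "c\<^sup>2 * (h q * (bivector (\<Phi> u) (\<Phi> v) * bivector (\<Phi> z) (\<Phi> w))) = h p * (bivector u v * bivector z w)"
    for u v w z
    using R[of 0 "[u, v, w, z]"] c
    by (simp add: nabla_R_0[OF PQ(1)] nabla_R_0[OF PQ(2)] PQ' power_int_minus field_simps del: nabla_R.simps)
  have "c\<^sup>2 * h q \<noteq> 0" using c nz by simp
  from linear_isometry_shape[OF \<Phi> this, of "h p"] R0 obtain s \<tau> n where s: "s \<noteq> 0" and \<tau>: "\<tau>\<^sup>2 = 1"
    and \<Phi>1: "\<And>u. fst (\<Phi> u) = s * fst u" "\<And>u. fst (snd (\<Phi> u)) = n * fst u + \<tau> * fst (snd u)"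
    by (auto simp: mult.assoc)
  have b: "bivector (\<Phi> u) (\<Phi> v) * bivector (\<Phi> z) (\<Phi> w) = s\<^sup>2 * (bivector u v * bivector z w)" for u v w z
  proof -
    have "bivector (\<Phi> u) (\<Phi> v) = s * \<tau> * bivector u v" for u v
      by (simp add: bivector_def \<Phi>1 algebra_simps)
    then have "bivector (\<Phi> u) (\<Phi> v) * bivector (\<Phi> z) (\<Phi> w) = s\<^sup>2 * \<tau>\<^sup>2 * (bivector u v * bivector z w)"
      by (simp add: power2_eq_square)
    then show ?thesis by (simp add: \<tau>)
  qed
  define e1 e2 :: "real \<times> real \<times> real" where "e1 = (1, 0, 0)" and "e2 = (0, 1, 0)"
  note E = e1_def e2_def bivector_def
  have p3: "c powi - 3 = 1 / c ^ 3" and p4: "c powi - 4 = 1 / c ^ 4"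
    by (simp_all add: power_int_minus divide_inverse)
  \<comment> \<open>The curvature slots will always hold \<open>e1, e2, e2, e1\<close>, where the
    tensor square of dx \<and> dy is 1, so that only the derivatives of h remain.\<close>
  have e12: "bivector e1 e2 * bivector e1 e2 = 1" by (simp add: E)
  have clear: "k * a = b" if "a = 1 / k * b" "k \<noteq> 0" for a b k :: real
    using that by simp
  have R1: "c ^ 3 * (s\<^sup>2 * (s * fst d * pd1 h q + (n * fst d + \<tau> * fst (snd d)) * pd2 h q)) =
      fst d * pd1 h p + fst (snd d) * pd2 h p" for d :: "real \<times> real \<times> real"
  proof -
    have "nabla_R (metric_f f) 1 Q (map \<Phi> [d, e1, e2, e2, e1]) =
        1 / c ^ 3 * nabla_R (metric_f f) 1 P [d, e1, e2, e2, e1]"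
      using R[of 1 "[d, e1, e2, e2, e1]"] k p3 by simp
    note clear[OF this]
    then show ?thesis
      using c unfolding list.map nabla_R_1[OF PQ(1)] nabla_R_1[OF PQ(2)] PQ' \<Phi>1 b e12
      by (simp add: mult_ac)
  qed
  have R2: "c ^ 4 * (s\<^sup>2 * (s * fst d * (s * fst e * pd1 (pd1 h) q + (n * fst e + \<tau> * fst (snd e)) * pd2 (pd1 h) q) +
     (n * fst d + \<tau> * fst (snd d)) * (s * fst e * pd1 (pd2 h) q + (n * fst e + \<tau> * fst (snd e)) * pd2 (pd2 h) q) -
     pd2 F q * pd2 h q * (s * fst e * (s * fst d)))) =
     fst d * (fst e * pd1 (pd1 h) p + fst (snd e) * pd2 (pd1 h) p) +
     fst (snd d) * (fst e * pd1 (pd2 h) p + fst (snd e) * pd2 (pd2 h) p) -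
     pd2 F p * pd2 h p * (fst e * fst d)" if "k \<ge> 2"
    for d e :: "real \<times> real \<times> real"
  proof -
    have "nabla_R (metric_f f) 2 Q (map \<Phi> [e, d, e1, e2, e2, e1]) =
        1 / c ^ 4 * nabla_R (metric_f f) 2 P [e, d, e1, e2, e2, e1]"
      using R[of 2 "[e, d, e1, e2, e2, e1]"] that p4 by simp
    note clear[OF this]
    then show ?thesis
      using c unfolding list.map nabla_R_2[OF PQ(1)] nabla_R_2[OF PQ(2)] PQ' \<Phi>1 b e12 Let_def
      by (simp add: mult_ac)
  qed
  show thesis
  proof (rule that[OF s c \<tau>])
    show "s\<^sup>2 * c\<^sup>2 * h q = h p"
      using R0[of e1 e2 e1 e2] b[of e1 e2 e1 e2] by (simp add: E mult_ac)
    show "\<tau> * s\<^sup>2 * c ^ 3 * pd2 h q = pd2 h p"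
      using R1[of e2] by (simp add: E mult_ac)
    show "s\<^sup>2 * c ^ 3 * (s * pd1 h q + n * pd2 h q) = pd1 h p"
      using R1[of e1] by (simp add: E mult_ac)
    show "s\<^sup>2 * c ^ 4 * pd2 (pd2 h) q = pd2 (pd2 h) p" if "k \<ge> 2"
    proof -
      have "c ^ 4 * (s\<^sup>2 * (\<tau>\<^sup>2 * pd2 (pd2 h) q)) = pd2 (pd2 h) p"
        using R2[OF that, of e2 e2] by (simp add: E power2_eq_square mult_ac)
      then show ?thesis by (simp add: \<tau> mult_ac)
    qed
    show "\<tau> * s\<^sup>2 * c ^ 4 * (s * pd2 (pd1 h) q + n * pd2 (pd2 h) q) = pd2 (pd1 h) p" if "k \<ge> 2"
      using R2[OF that, of e1 e2] by (simp add: E algebra_simps)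
    show "s\<^sup>2 * c ^ 4 * (s\<^sup>2 * pd1 (pd1 h) q + s * n * (pd2 (pd1 h) q + pd1 (pd2 h) q) +
       n\<^sup>2 * pd2 (pd2 h) q - pd2 F q * pd2 h q * s\<^sup>2) = pd1 (pd1 h) p - pd2 F p * pd2 h p" if "k \<ge> 2"
      using R2[OF that, of e1 e1] by (simp add: E power2_eq_square algebra_simps)
  qed
qed

end

subsection \<open>Homotheties between plane waves\<close>

lemma smooth_on_real_deriv:
  fixes k :: "real \<Rightarrow> real"
  assumes "smooth_on I k" "open I" "\<And>x. x \<in> I \<Longrightarrow> (k has_real_derivative k' x) (at x)"
  shows "smooth_on I k'"
  by (rule smooth_on_cong[OF assms(2) _ smooth_on_dir_deriv[OF assms(1), of 1]])
    (use dir_deriv_real[OF assms(3), of _ 1] in simp)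

lemma smooth_upto_SucI_real:
  fixes k :: "real \<Rightarrow> real"
  assumes "smooth_upto n I k'" "open I" "\<And>x. x \<in> I \<Longrightarrow> (k has_real_derivative k' x) (at x)"
  shows "smooth_upto (Suc n) I k"
proof (rule smooth_upto_SucI[OF assms(2)])
  show "(k has_derivative (\<lambda>v. k' x * v)) (at x)" if "x \<in> I" for x
    using assms(3)[OF that] by (simp add: has_field_derivative_def)
  show "smooth_upto n I (\<lambda>x. k' x * v)" for v
    using smooth_upto_bilinear[OF assms(2) bounded_bilinear_mult assms(1) smooth_upto_const] .
qed

lemma smooth_on_antiderivative:
  fixes k :: "real \<Rightarrow> real"
  assumes "smooth_on I k'" "open I" "\<And>x. x \<in> I \<Longrightarrow> (k has_real_derivative k' x) (at x)"
  shows "smooth_on I k"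
  using smooth_upto_SucI_real[OF _ assms(2,3)] assms(1) smooth_upto_SucD
  unfolding smooth_on_iff_upto by blast

text \<open>The argument \<open>\<eta>'\<close> is meant to be the derivative of
  \<open>\<eta>\<close>. The term with \<open>\<eta>'\<close> in the last component cancels the
  product dx dy that the shift by \<open>\<eta>\<close> creates in the metric.\<close>

definition wave_map ::
  "real \<Rightarrow> real \<Rightarrow> real \<Rightarrow> (real \<Rightarrow> real) \<Rightarrow> (real \<Rightarrow> real) \<Rightarrow> (real \<Rightarrow> real) \<Rightarrow>
     real \<times> real \<times> real \<Rightarrow> real \<times> real \<times> real" where
  "wave_map r b \<mu> \<eta> \<eta>' \<zeta> p = (r * fst p + b, \<mu> * fst (snd p) + \<eta> (fst p),
     (\<mu>\<^sup>2 * snd (snd p) - \<mu> * \<eta>' (fst p) * fst (snd p) + \<zeta> (fst p)) / r)"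

text \<open>The explicit inverse makes the smoothness of \<open>inv_into\<close> and the openness of
  images visible from a formula, without the inverse function theorem.\<close>

definition wave_map_inv ::
  "real \<Rightarrow> real \<Rightarrow> real \<Rightarrow> (real \<Rightarrow> real) \<Rightarrow> (real \<Rightarrow> real) \<Rightarrow> (real \<Rightarrow> real) \<Rightarrow>
     real \<times> real \<times> real \<Rightarrow> real \<times> real \<times> real" where
  "wave_map_inv r b \<mu> \<eta> \<eta>' \<zeta> p = ((fst p - b) / r, (fst (snd p) - \<eta> ((fst p - b) / r)) / \<mu>,
     (r * snd (snd p) + \<eta>' ((fst p - b) / r) * (fst (snd p) - \<eta> ((fst p - b) / r)) -
        \<zeta> ((fst p - b) / r)) / \<mu>\<^sup>2)"

lemma wave_map_inverse:
  assumes "r \<noteq> 0" "\<mu> \<noteq> 0"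
  shows "wave_map_inv r b \<mu> \<eta> \<eta>' \<zeta> (wave_map r b \<mu> \<eta> \<eta>' \<zeta> p) = p"
    and "wave_map r b \<mu> \<eta> \<eta>' \<zeta> (wave_map_inv r b \<mu> \<eta> \<eta>' \<zeta> p) = p"
  using assms by (simp_all add: wave_map_def wave_map_inv_def field_simps)

lemma wave_map_image:
  assumes "r \<noteq> 0" "\<mu> \<noteq> 0"
  shows "wave_map r b \<mu> \<eta> \<eta>' \<zeta> ` A = wave_map_inv r b \<mu> \<eta> \<eta>' \<zeta> -` A"
proof (intro set_eqI iffI)
  fix q assume "q \<in> wave_map_inv r b \<mu> \<eta> \<eta>' \<zeta> -` A"
  then show "q \<in> wave_map r b \<mu> \<eta> \<eta>' \<zeta> ` A"
    by (intro image_eqI[of _ _ "wave_map_inv r b \<mu> \<eta> \<eta>' \<zeta> q"]) (auto simp: wave_map_inverse[OF assms])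
qed (auto simp: wave_map_inverse[OF assms])

lemma smooth_wave_map:
  assumes "open I" "smooth_on I \<eta>" "smooth_on I \<eta>'" "smooth_on I \<zeta>" and r: "r \<noteq> 0" and "\<mu> \<noteq> 0"
  shows "smooth_on (I \<times> UNIV) (wave_map r b \<mu> \<eta> \<eta>' \<zeta>)"
    and "open ((\<lambda>p. (fst p - b) / r) -` I :: (real \<times> real \<times> real) set)"
    and "smooth_on ((\<lambda>p. (fst p - b) / r) -` I) (wave_map_inv r b \<mu> \<eta> \<eta>' \<zeta>)"
proof -
  have fst: "smooth_on (I \<times> UNIV) (\<lambda>p :: real \<times> real \<times> real. k (fst p))" if "smooth_on I k" for k :: "real \<Rightarrow> real"
    by (rule smooth_on_compose_affine[OF that assms(1), of _ fst fst])
      (auto intro!: derivative_eq_intros open_Times assms(1))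
  show "smooth_on (I \<times> UNIV) (wave_map r b \<mu> \<eta> \<eta>' \<zeta>)"
    unfolding wave_map_def
    by (intro smooth_intros fst assms open_Times open_UNIV)
  let ?W = "(\<lambda>p. (fst p - b) / r) -` I :: (real \<times> real \<times> real) set"
  show W: "open ?W"
    by (rule open_vimage[OF assms(1)]) (use r in \<open>auto intro!: continuous_intros\<close>)
  have fst': "smooth_on ?W (\<lambda>p. k ((fst p - b) / r))" if "smooth_on I k" for k :: "real \<Rightarrow> real"
    by (rule smooth_on_compose_affine[OF that assms(1) W, of _ "\<lambda>v. fst v / r"])
      (use r in \<open>auto intro!: derivative_eq_intros\<close>)
  show "smooth_on ?W (wave_map_inv r b \<mu> \<eta> \<eta>' \<zeta>)"
    unfolding wave_map_inv_def
    by (intro smooth_intros fst' assms W) (use assms in auto)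
qed

text \<open>All coefficients of the pulled back metric except that of dx^2 agree automatically;
  \<open>eq\<close> is the comparison of this last one.\<close>

lemma scaled_isometry_wave_map:
  assumes I: "open I" and A: "open A" "A \<subseteq> I \<times> UNIV"
    and smooth: "smooth_on I \<eta>" "smooth_on I \<zeta>"
    and \<eta>: "\<And>x. x \<in> I \<Longrightarrow> (\<eta> has_real_derivative \<eta>' x) (at x)"
      "\<And>x. x \<in> I \<Longrightarrow> (\<eta>' has_real_derivative \<eta>'' x) (at x)"
    and \<zeta>: "\<And>x. x \<in> I \<Longrightarrow> (\<zeta> has_real_derivative \<zeta>' x) (at x)"
    and r: "r \<noteq> 0" and \<mu>: "\<mu> \<noteq> 0"
    and eq: "\<And>x y t. (x, y, t) \<in> A \<Longrightarrow>
      \<mu>\<^sup>2 * f x y = r\<^sup>2 * k (r * x + b) (\<mu> * y + \<eta> x) + \<mu> * \<eta>'' x * y - \<zeta>' x - (\<eta>' x)\<^sup>2 / 2"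
  defines "T \<equiv> wave_map r b \<mu> \<eta> \<eta>' \<zeta>"
  shows "open (T ` A)" and "scaled_isometry (\<mu>\<^sup>2) (A, metric_f f) (T ` A, metric_f k) T"
proof -
  let ?S = "wave_map_inv r b \<mu> \<eta> \<eta>' \<zeta>"
  let ?W = "(\<lambda>p. (fst p - b) / r) -` I :: (real \<times> real \<times> real) set"
  have sm: "smooth_on I \<eta>'"
    using smooth_on_real_deriv[OF smooth(1) I \<eta>(1)] .
  note swm = smooth_wave_map[OF I smooth(1) sm smooth(2) r \<mu>, of b]
  \<comment> \<open>The image becomes the preimage of an open set under the inverse formula,
    restricted to the open set on which this formula is continuous.\<close>
  have img: "T ` A = ?W \<inter> ?S -` A"
    unfolding T_def wave_map_image[OF r \<mu>] using A(2) by (auto simp: wave_map_inv_def)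
  show op: "open (T ` A)"
    unfolding img by (rule continuous_open_preimage[OF smooth_on_continuous[OF swm(3,2)] swm(2) A(1)])
  have inj: "inj_on T A"
    unfolding T_def by (rule inj_on_inverseI) (rule wave_map_inverse(1)[OF r \<mu>])
  have "smooth_on (T ` A) ?S"
    by (rule smooth_on_subset[OF swm(3)]) (auto simp: img)
  moreover have "?S q = inv_into A T q" if "q \<in> T ` A" for q
    using that inj by (auto simp: T_def wave_map_inverse[OF r \<mu>])
  ultimately have "smooth_on (T ` A) (inv_into A T)"
    using smooth_on_cong[OF op] by blast
  moreover have "smooth_on A T"
    unfolding T_def by (rule smooth_on_subset[OF swm(1) A(2)])
  ultimately have diffeo: "diffeomorphism_on A (T ` A) T"
    using inj by (simp add: diffeomorphism_on_def bij_betw_def)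
  have "metric_f k (T p) (dir_deriv u T p) (dir_deriv v T p) = \<mu>\<^sup>2 * metric_f f p u v"
    if p: "p \<in> A" for p u v
  proof -
    obtain x y t where xyt: "p = (x, y, t)" by (cases p)
    have x: "x \<in> I" using p A(2) xyt by auto
    have comp: "((\<lambda>p. g (fst p)) has_derivative (\<lambda>v. fst v * g' x)) (at p)"
      if "(g has_real_derivative g' x) (at x)" for g g' :: "real \<Rightarrow> real"
      using has_derivative_compose[OF has_derivative_fst[OF has_derivative_ident], of g "\<lambda>v. v * g' x" p UNIV]
        that xyt by (simp add: has_field_derivative_def mult.commute[of _ "g' x"])
    define T' where "T' v = (r * fst v, \<mu> * fst (snd v) + fst v * \<eta>' x,
      (\<mu>\<^sup>2 * snd (snd v) - (\<mu> * \<eta>' x * fst (snd v) + \<mu> * (fst v * \<eta>'' x) * y) + fst v * \<zeta>' x) / r)" for v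
    have "(T has_derivative T') (at p)"
      unfolding T_def wave_map_def[abs_def] T'_def[abs_def]
      using comp[of \<eta> \<eta>', OF \<eta>(1)[OF x]] comp[of \<eta>' \<eta>'', OF \<eta>(2)[OF x]] comp[of \<zeta> \<zeta>', OF \<zeta>[OF x]] xyt r
      by (auto intro!: derivative_eq_intros)
    note dT = dir_deriv_eqI[OF this]
    let ?K = "k (r * x + b) (\<mu> * y + \<eta> x)"
    have "metric_f k (T p) (T' u) (T' v) =
        (- 2 * (r\<^sup>2 * ?K) - 2 * (\<mu> * \<eta>'' x * y) + 2 * \<zeta>' x + (\<eta>' x)\<^sup>2) * (fst u * fst v) +
        \<mu>\<^sup>2 * (fst u * snd (snd v) + snd (snd u) * fst v + fst (snd u) * fst (snd v))"
      using r by (simp add: metric_f_eq T_def wave_map_def xyt T'_def power2_eq_square field_simps)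
    also have "\<dots> = (- 2 * (\<mu>\<^sup>2 * f x y)) * (fst u * fst v) +
        \<mu>\<^sup>2 * (fst u * snd (snd v) + snd (snd u) * fst v + fst (snd u) * fst (snd v))"
    proof -
      have "- 2 * (r\<^sup>2 * ?K) - 2 * (\<mu> * \<eta>'' x * y) + 2 * \<zeta>' x + (\<eta>' x)\<^sup>2 = - 2 * (\<mu>\<^sup>2 * f x y)"
        using eq[of x y t] p xyt by simp
      then show ?thesis by presburger
    qed
    also have "\<dots> = \<mu>\<^sup>2 * metric_f f p u v"
      by (simp add: metric_f_eq xyt algebra_simps)
    finally show ?thesis by (simp add: dT)
  qed
  with diffeo show "scaled_isometry (\<mu>\<^sup>2) (A, metric_f f) (T ` A, metric_f k) T"
    by (simp add: scaled_isometry_def)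
qed

section \<open>Homotheties of the model spaces\<close>

lemma real_derivative_affine: "((\<lambda>x. a * x + b) has_real_derivative a) (at x)"
  by (auto intro!: derivative_eq_intros)

lemma smooth_on_affine: "open S \<Longrightarrow> smooth_on S (\<lambda>x::real. a * x + b)"
  by (intro smooth_intros)

text \<open>Here the shift of y is constant and \<open>\<zeta>\<close> is affine: its slope
  \<open>e\<close> absorbs an additive constant in the law for f, and its intercept moves
  \<open>tP\<close> to \<open>tQ\<close>.\<close>

lemma model_homothety:
  assumes J: "open J" and r: "r \<noteq> 0" and \<mu>: "\<mu> \<noteq> 0" and J': "\<And>y. \<mu> * y + d \<in> J \<longleftrightarrow> y \<in> J"
    and eq: "\<And>x y. y \<in> J \<Longrightarrow> \<mu>\<^sup>2 * f x y = r\<^sup>2 * f (r * x + b) (\<mu> * y + d) - e"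
    and PQ: "b = xQ - r * xP" "d = yQ - \<mu> * yP"
  shows "\<exists>T. scaled_isometry (\<mu>\<^sup>2) (manifold_f UNIV J f) (manifold_f UNIV J f) T \<and> T (xP, yP, tP) = (xQ, yQ, tQ)"
proof -
  let ?A = "UNIV \<times> J \<times> UNIV :: (real \<times> real \<times> real) set"
  define c where "c = r * tQ - \<mu>\<^sup>2 * tP - e * xP"
  define T where "T = wave_map r b \<mu> (\<lambda>x. 0 * x + d) (\<lambda>x. 0 * x + 0) (\<lambda>x. e * x + c)"
  have "scaled_isometry (\<mu>\<^sup>2) (?A, metric_f f) (T ` ?A, metric_f f) T"
    unfolding T_def
  proof (rule scaled_isometry_wave_map(2)[where I = UNIV and \<eta>'' = "\<lambda>_. 0" and \<zeta>' = "\<lambda>_. e"])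
    show "open ?A" using J by (simp add: open_Times)
    show "\<mu>\<^sup>2 * f x y = r\<^sup>2 * f (r * x + b) (\<mu> * y + (0 * x + d)) + \<mu> * 0 * y - e - (0 * x + 0)\<^sup>2 / 2"
      if "(x, y, t) \<in> ?A" for x y t
      using that eq by simp
  qed (use r \<mu> in \<open>auto intro: real_derivative_affine smooth_on_affine smooth_on_const simp del: mult_zero_left\<close>)
  moreover have "q \<in> T ` ?A \<longleftrightarrow> q \<in> ?A" for q
  proof -
    have "\<mu> * ((fst (snd q) - d) / \<mu>) + d = fst (snd q)" using \<mu> by simp
    then have "(fst (snd q) - d) / \<mu> \<in> J \<longleftrightarrow> fst (snd q) \<in> J"
      using J' by metis
    then show ?thesis
      unfolding T_def wave_map_image[OF r \<mu>] by (simp add: wave_map_inv_def mem_Times_iff)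
  qed
  then have "T ` ?A = ?A" by blast
  moreover have "T (xP, yP, tP) = (xQ, yQ, tQ)"
    using r PQ by (simp add: T_def wave_map_def c_def)
  ultimately show ?thesis by (auto simp: manifold_f_def)
qed

lemma homogeneous_exp:
  assumes "a \<noteq> 0"
  shows "homogeneous (manifold_f UNIV UNIV (\<lambda>x y. s * exp (a * y)))"
  unfolding homogeneous_def isometry_def
proof (intro ballI)
  fix P Q :: "real \<times> real \<times> real"
  obtain xP yP tP xQ yQ tQ where PQ: "P = (xP, yP, tP)" "Q = (xQ, yQ, tQ)" by (metis prod_cases3)
  define d where "d = yQ - yP"
  \<comment> \<open>Shifting y by \<open>d\<close> multiplies the profile by exp (a d). As f enters
    with the square of the scaling of x, half of the exponent with opposite sign
    compensates.\<close>
  have "(exp (- a * d / 2))\<^sup>2 * exp (a * (y + d)) = exp (a * y)" for y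
    by (simp add: power2_eq_square mult_exp_exp algebra_simps)
  then show "\<exists>T. scaled_isometry 1 (manifold_f UNIV UNIV (\<lambda>x y. s * exp (a * y)))
      (manifold_f UNIV UNIV (\<lambda>x y. s * exp (a * y))) T \<and> T P = Q"
    using model_homothety[of UNIV "exp (- a * d / 2)" 1 d "\<lambda>x y. s * exp (a * y)" _ 0 xQ xP yQ yP tP tQ]
    by (simp add: PQ d_def mult.left_commute)
qed

text \<open>Dilating y by the quotient of the two y-coordinates scales dy^2 by \<mu>^2. The
  hypothesis provides a scaling \<open>r\<close> of x that gives the dx^2 part the same factor, up
  to a constant that the t-coordinate absorbs.\<close>

lemma homothety_homogeneousI:
  assumes "\<And>\<mu>. \<mu> > 0 \<Longrightarrow> \<exists>r e. r \<noteq> 0 \<and> (\<forall>y>0. \<mu>\<^sup>2 * k y = r\<^sup>2 * k (\<mu> * y) - e)"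
  shows "homothety_homogeneous (manifold_f UNIV {0<..} (\<lambda>x y. k y))"
  unfolding homothety_homogeneous_def
proof (intro ballI)
  fix P Q assume "P \<in> fst (manifold_f UNIV {0<..} (\<lambda>x y. k y))" "Q \<in> fst (manifold_f UNIV {0<..} (\<lambda>x y. k y))"
  then obtain xP yP tP xQ yQ tQ where PQ: "P = (xP, yP, tP)" "Q = (xQ, yQ, tQ)" "yP > 0" "yQ > 0"
    by (auto simp: manifold_f_def)
  define \<mu> where "\<mu> = yQ / yP"
  have \<mu>: "\<mu> > 0" "0 = yQ - \<mu> * yP" using PQ by (auto simp: \<mu>_def)
  obtain r e where "r \<noteq> 0" "\<And>y. y > 0 \<Longrightarrow> \<mu>\<^sup>2 * k y = r\<^sup>2 * k (\<mu> * y) - e"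
    using assms[OF \<mu>(1)] by blast
  then obtain T where "scaled_isometry (\<mu>\<^sup>2) (manifold_f UNIV {0<..} (\<lambda>x y. k y))
      (manifold_f UNIV {0<..} (\<lambda>x y. k y)) T" "T P = Q"
    using model_homothety[of "{0<..}" r \<mu> 0 "\<lambda>x y. k y" _ e xQ xP yQ yP tP tQ] \<mu> PQ
    by (auto simp: zero_less_mult_iff)
  then show "\<exists>T. homothety (manifold_f UNIV {0<..} (\<lambda>x y. k y)) (manifold_f UNIV {0<..} (\<lambda>x y. k y)) T \<and> T P = Q"
    using \<mu>(1) unfolding homothety_def by (intro exI[of _ T] conjI exI[of _ \<mu>]) auto
qed

lemma homothety_homogeneous_ln:
  "homothety_homogeneous (manifold_f UNIV {0<..} (\<lambda>x y. s * ln y))"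
proof (rule homothety_homogeneousI)
  show "\<exists>r e. r \<noteq> 0 \<and> (\<forall>y>0. \<mu>\<^sup>2 * (s * ln y) = r\<^sup>2 * (s * ln (\<mu> * y)) - e)" if "\<mu> > 0" for \<mu> :: real
    using that by (intro exI[of _ \<mu>] exI[of _ "\<mu>\<^sup>2 * s * ln \<mu>"]) (auto simp: ln_mult algebra_simps)
qed

lemma homothety_homogeneous_powr:
  "homothety_homogeneous (manifold_f UNIV {0<..} (\<lambda>x y. s * y powr \<epsilon>))"
proof (rule homothety_homogeneousI)
  fix \<mu> :: real assume \<mu>: "\<mu> > 0"
  \<comment> \<open>The scaling of x is found by solving r^2 \<mu>^\<epsilon> = \<mu>^2 for
    r.\<close>
  have "(\<mu> powr (1 - \<epsilon> / 2))\<^sup>2 * \<mu> powr \<epsilon> = \<mu>\<^sup>2"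
    using \<mu> by (simp add: power2_eq_square powr_add[symmetric])
  then have "\<mu>\<^sup>2 * (s * y powr \<epsilon>) = (\<mu> powr (1 - \<epsilon> / 2))\<^sup>2 * (s * (\<mu> * y) powr \<epsilon>) - 0" if "y > 0" for y
    using that \<mu> by (simp add: powr_mult)
  then show "\<exists>r e. r \<noteq> 0 \<and> (\<forall>y>0. \<mu>\<^sup>2 * (s * y powr \<epsilon>) = r\<^sup>2 * (s * (\<mu> * y) powr \<epsilon>) - e)"
    using \<mu> by (metis powr_eq_0_iff less_irrefl)
qed

subsection \<open>Linear differential equations\<close>

text \<open>The interval may be unbounded, so it is described by extended real end points, for which
  an antiderivative exists on the whole interval. Vector values are allowed because complex
  functions occur below.\<close>

lemma open_interval_antiderivative:
  fixes g :: "real \<Rightarrow> 'a::euclidean_space"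
  assumes I: "open_interval I" and g: "continuous_on I g"
  obtains G where "\<And>x. x \<in> I \<Longrightarrow> (G has_vector_derivative g x) (at x)"
proof -
  define a b where "a = (INF x\<in>I. ereal x)" and "b = (SUP x\<in>I. ereal x)"
  have "open I" "is_interval I" "I \<noteq> {}" using I by (auto simp: open_interval_def)
  have in_I: "x \<in> I" if "a < ereal x" "ereal x < b" for x
  proof -
    have "\<exists>u\<in>I. ereal u < ereal x" "\<exists>v\<in>I. ereal x < ereal v"
      using that unfolding a_def b_def INF_less_iff less_SUP_iff by auto
    then obtain u v where "u \<in> I" "u < x" "v \<in> I" "x < v" by auto
    then show ?thesis
      using \<open>is_interval I\<close> unfolding is_interval_1 by (meson less_imp_le)
  qed
  \<comment> \<open>Openness turns the bounds by infimum and supremum into strict ones.\<close>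
  have bounds: "a < ereal x \<and> ereal x < b" if x: "x \<in> I" for x
  proof -
    obtain e where e: "e > 0" "ball x e \<subseteq> I" using x \<open>open I\<close> unfolding open_contains_ball by blast
    have "x - e / 2 \<in> ball x e" "x + e / 2 \<in> ball x e"
      using e(1) by (simp_all add: dist_real_def)
    then have "x - e / 2 \<in> I" "x + e / 2 \<in> I" using e(2) by (meson subsetD)+
    then have "a \<le> ereal (x - e / 2)" "ereal (x + e / 2) \<le> b"
      unfolding a_def b_def by (auto intro: INF_lower SUP_upper)
    moreover have "ereal (x - e / 2) < ereal x" "ereal x < ereal (x + e / 2)" using e by auto
    ultimately show ?thesis by (meson le_less_trans less_le_trans)
  qed
  have "a < b" using bounds \<open>I \<noteq> {}\<close> by (meson all_not_in_conv less_trans)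
  moreover have "isCont g x" if "a < ereal x" "ereal x < b" for x
    using in_I[OF that] g \<open>open I\<close> by (simp add: continuous_on_eq_continuous_at)
  ultimately obtain G where "\<forall>x. a < ereal x \<longrightarrow> ereal x < b \<longrightarrow> (G has_vector_derivative g x) (at x)"
    using einterval_antiderivative by blast
  then show ?thesis using that bounds by blast
qed

text \<open>Variation of constants with the integrating factor exp (-P) gives a solution on all of
  \<open>I\<close>, with no restriction to a smaller interval.\<close>

lemma first_order_linear_ode:
  fixes p q :: "real \<Rightarrow> complex"
  assumes I: "open_interval I" and p: "continuous_on I p" and q: "continuous_on I q" and x1: "x1 \<in> I"
  obtains u where "u x1 = c" "\<And>x. x \<in> I \<Longrightarrow> (u has_vector_derivative p x * u x + q x) (at x)"
proof -
  obtain P where P: "\<And>x. x \<in> I \<Longrightarrow> (P has_vector_derivative p x) (at x)"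
    using open_interval_antiderivative[OF I p] by blast
  have "continuous_on I P"
    using P by (meson continuous_at_imp_continuous_on has_vector_derivative_continuous)
  then have "continuous_on I (\<lambda>x. exp (- P x) * q x)" by (intro continuous_intros q)
  then obtain Q where Q: "\<And>x. x \<in> I \<Longrightarrow> (Q has_vector_derivative exp (- P x) * q x) (at x)"
    using open_interval_antiderivative[OF I] by blast
  define u where "u x = exp (P x) * (Q x + (exp (- P x1) * c - Q x1))" for x
  have "((\<lambda>x. exp (P x)) has_vector_derivative p x * exp (P x)) (at x)" if "x \<in> I" for x
    using field_vector_diff_chain_at[OF P[OF that] DERIV_exp] by (simp add: o_def)
  then have "(u has_vector_derivative
      exp (P x) * (exp (- P x) * q x) + p x * exp (P x) * (Q x + (exp (- P x1) * c - Q x1))) (at x)"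
    if "x \<in> I" for x
    unfolding u_def[abs_def] using Q[OF that] that
    by (intro has_vector_derivative_mult) (auto intro!: derivative_eq_intros)
  moreover have "exp (P x) * (exp (- P x) * q x) + p x * exp (P x) * (Q x + (exp (- P x1) * c - Q x1)) =
      p x * u x + q x" for x
  proof -
    have "exp (P x) * exp (- P x) = 1" by (simp add: exp_minus)
    then show ?thesis unfolding u_def by algebra
  qed
  ultimately have "(u has_vector_derivative p x * u x + q x) (at x)" if "x \<in> I" for x
    using that by metis
  moreover have "u x1 = c" by (simp add: u_def exp_minus)
  ultimately show ?thesis using that by blast
qed

text \<open>With \<open>m\<^sub>1 + m\<^sub>2 = 1\<close>, \<open>m\<^sub>1m\<^sub>2 = 2a\<close> and \<open>\<xi> = x - x\<^sub>0\<close> the Euler operator \<open>\<xi>\<^sup>2D\<^sup>2 + 2a\<close> factors as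
  \<open>(\<xi>D - m\<^sub>1)(\<xi>D - m\<^sub>2)\<close> over the complex numbers, so no case distinction on the sign of \<open>1 - 8a\<close>
  is needed.\<close>

lemma euler_ode:
  fixes g :: "real \<Rightarrow> real"
  assumes I: "open_interval I" and g: "continuous_on I g" and x1: "x1 \<in> I" and x0: "x0 \<notin> I"
  obtains \<eta> \<eta>' where "\<eta> x1 = d" "\<And>x. x \<in> I \<Longrightarrow> (\<eta> has_real_derivative \<eta>' x) (at x)"
    "\<And>x. x \<in> I \<Longrightarrow> (\<eta>' has_real_derivative g x - 2 * a / (x - x0)\<^sup>2 * \<eta> x) (at x)"
proof -
  define m1 where "m1 = (1 + csqrt (1 - 8 * of_real a)) / 2"
  define m2 where "m2 = 1 - m1"
  define \<xi> :: "real \<Rightarrow> complex" where "\<xi> x = of_real (x - x0)" for x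
  have "(csqrt (1 - 8 * of_real a))\<^sup>2 = 1 - 8 * complex_of_real a" by simp
  then have m: "m1 * m2 = 2 * of_real a"
    unfolding m2_def m1_def by (simp add: power2_eq_square field_simps)
  have nz: "\<xi> x \<noteq> 0" if "x \<in> I" for x using that x0 by (auto simp: \<xi>_def)
  have c\<xi>: "continuous_on I \<xi>" unfolding \<xi>_def by (intro continuous_intros)
  have d\<xi>: "(\<xi> has_vector_derivative 1) (at x)" for x
    unfolding \<xi>_def by (auto intro!: derivative_eq_intros)
  \<comment> \<open>The two factors are solved in turn: \<open>w\<close> plays the role of (\<xi>D -
    m2)u and solves (\<xi>D - m1)w = \<xi>^2 g. The initial value of \<open>w\<close> is arbitrary,
    since only the value of \<eta> at \<open>x1\<close> is prescribed.\<close>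
  obtain w where w: "\<And>x. x \<in> I \<Longrightarrow> (w has_vector_derivative m1 / \<xi> x * w x + \<xi> x * of_real (g x)) (at x)"
  proof (rule first_order_linear_ode[OF I _ _ x1, where c = 0])
    show "continuous_on I (\<lambda>x. m1 / \<xi> x)" "continuous_on I (\<lambda>x. \<xi> x * of_real (g x))"
      using nz c\<xi> g by (auto intro!: continuous_intros)
  qed blast
  have cw: "continuous_on I w"
    using w by (meson continuous_at_imp_continuous_on has_vector_derivative_continuous)
  obtain u where u1: "u x1 = of_real d"
    and u: "\<And>x. x \<in> I \<Longrightarrow> (u has_vector_derivative m2 / \<xi> x * u x + w x / \<xi> x) (at x)"
  proof (rule first_order_linear_ode[OF I _ _ x1])
    show "continuous_on I (\<lambda>x. m2 / \<xi> x)" "continuous_on I (\<lambda>x. w x / \<xi> x)"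
      using nz c\<xi> cw by (auto intro!: continuous_intros)
  qed blast
  define u' where "u' x = inverse (\<xi> x) * (m2 * u x + w x)" for x
  have u_u': "(u has_vector_derivative u' x) (at x)" if "x \<in> I" for x
    using u[OF that] nz[OF that] by (simp add: u'_def field_simps)
  have i\<xi>: "((\<lambda>x. inverse (\<xi> x)) has_vector_derivative - 1 / (\<xi> x)\<^sup>2) (at x)" if "x \<in> I" for x
    using field_vector_diff_chain_at[OF d\<xi> DERIV_inverse[OF nz[OF that]]]
    by (simp add: o_def power2_eq_square divide_inverse)
  have "(u' has_vector_derivative of_real (g x) - 2 * of_real a / (\<xi> x)\<^sup>2 * u x) (at x)" if x: "x \<in> I" for x
  proof -
    have "((\<lambda>x. inverse (\<xi> x) * (m2 * u x + w x)) has_vector_derivative inverse (\<xi> x) * (m2 * u' x + (m1 / \<xi> x * w x + \<xi> x * of_real (g x))) +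
        (- 1 / (\<xi> x)\<^sup>2) * (m2 * u x + w x)) (at x)"
      by (intro has_vector_derivative_mult i\<xi> x has_vector_derivative_add w
          has_vector_derivative_mult_right u_u')
    note this[folded u'_def]
    moreover have "inverse (\<xi> x) * (m2 * u' x + (m1 / \<xi> x * w x + \<xi> x * of_real (g x))) +
        (- 1 / (\<xi> x)\<^sup>2) * (m2 * u x + w x) = of_real (g x) - m1 * m2 / (\<xi> x)\<^sup>2 * u x"
    proof -
      have "(\<xi> x)\<^sup>2 * (inverse (\<xi> x) * (m2 * u' x + (m1 / \<xi> x * w x + \<xi> x * of_real (g x))) +
        (- 1 / (\<xi> x)\<^sup>2) * (m2 * u x + w x)) =
        m2 * (m2 * u x + w x) + m1 * w x + (\<xi> x)\<^sup>2 * of_real (g x) - (m2 * u x + w x)"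
        using nz[OF x] by (simp add: u'_def power2_eq_square field_simps)
      also have "\<dots> = (\<xi> x)\<^sup>2 * of_real (g x) - m1 * m2 * u x"
        unfolding m2_def by algebra
      also have "\<dots> = (\<xi> x)\<^sup>2 * (of_real (g x) - m1 * m2 / (\<xi> x)\<^sup>2 * u x)"
        using nz[OF x] by (simp add: field_simps)
      finally show ?thesis using nz[OF x] by simp
    qed
    ultimately show ?thesis unfolding m by simp
  qed
  note u'' = this
  \<comment> \<open>The coefficients of the original equation are real, so the real part of the
    complex solution solves it too.\<close>
  have re: "((\<lambda>x. Re (k x)) has_real_derivative Re k') (at x)" if "(k has_vector_derivative k') (at x)" for k k' x
    using bounded_linear.has_vector_derivative[OF bounded_linear_Re that]
    by (simp add: has_real_derivative_iff_has_vector_derivative)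
  have "Re (of_real (g x) - 2 * of_real a / (\<xi> x)\<^sup>2 * u x) = g x - 2 * a / (x - x0)\<^sup>2 * Re (u x)" for x
  proof -
    have "2 * of_real a / (\<xi> x)\<^sup>2 = complex_of_real (2 * a / (x - x0)\<^sup>2)" by (simp add: \<xi>_def)
    then show ?thesis by (simp only: minus_complex.sel Re_complex_of_real times_complex.sel Im_complex_of_real)
  qed
  then show ?thesis
    using that[of "\<lambda>x. Re (u x)" "\<lambda>x. Re (u' x)"] u1 re[OF u_u'] re[OF u''] by simp
qed

text \<open>Bootstrapping: order n for k gives order n for the derivative of k', hence order n + 1
  for k', and order n for k' gives order n + 1 for k.\<close>

lemma smooth_on_second_order:
  fixes k :: "real \<Rightarrow> real"
  assumes I: "open I" and A: "smooth_on I A" and B: "smooth_on I B"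
    and k: "\<And>x. x \<in> I \<Longrightarrow> (k has_real_derivative k' x) (at x)"
      "\<And>x. x \<in> I \<Longrightarrow> (k' has_real_derivative B x - A x * k x) (at x)"
  shows "smooth_on I k"
proof -
  have "smooth_upto n I k \<and> smooth_upto n I k'" for n
  proof (induction n)
    case 0
    show ?case
      using k I unfolding smooth_upto_0 differentiable_on_eq_differentiable_at[OF I]
      by (auto simp: real_differentiable_def)
  next
    case (Suc n)
    have "smooth_upto n I (\<lambda>x. B x + (- 1) * (A x * k x))"
      using A B Suc unfolding smooth_on_iff_upto
      by (intro smooth_upto_add smooth_upto_bilinear[OF _ bounded_bilinear_mult] smooth_upto_const I) auto
    then have "smooth_upto n I (\<lambda>x. B x - A x * k x)" by simp
    then show ?case
      using Suc smooth_upto_SucI_real[OF _ I k(1)] smooth_upto_SucI_real[OF _ I k(2)] by blast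
  qed
  then show ?thesis by (simp add: smooth_on_iff_upto)
qed

text \<open>An affine map of x fixing \<open>x0\<close> preserves the quadratic part of f dx^2.
  Matching the terms linear in y is an Euler equation for \<open>\<eta>\<close>, and the terms
  without y are absorbed by \<open>\<zeta>\<close>. The map is local because it may lead out of
  \<open>I\<close> or \<open>J\<close>.\<close>

lemma locally_homogeneous_quadratic:
  assumes I: "open_interval I" and J: "open J" and x0: "x0 \<notin> I"
    and \<beta>: "smooth_on I \<beta>" and \<gamma>: "smooth_on I \<gamma>"
    and f: "\<And>x y. x \<in> I \<Longrightarrow> y \<in> J \<Longrightarrow> f x y = a * (x - x0) powi (-2) * y\<^sup>2 + \<beta> x * y + \<gamma> x"
  shows "locally_homogeneous (manifold_f I J f)"
  unfolding locally_homogeneous_def manifold_f_def prod.case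
proof (intro ballI)
  let ?U = "I \<times> J \<times> (UNIV :: real set)"
  fix P Q assume "P \<in> ?U" "Q \<in> ?U"
  then obtain xP yP tP xQ yQ tQ where P: "P = (xP, yP, tP)" "xP \<in> I" "yP \<in> J"
    and Q: "Q = (xQ, yQ, tQ)" "xQ \<in> I" "yQ \<in> J" by auto
  have oI: "open I" using I by (simp add: open_interval_def)
  \<comment> \<open>The affine map r x + b has fixed point \<open>x0\<close> and sends
    \<open>xP\<close> to \<open>xQ\<close>.\<close>
  define r where "r = (xQ - x0) / (xP - x0)"
  define b where "b = x0 - r * x0"
  have "xP - x0 \<noteq> 0" "xQ - x0 \<noteq> 0" using P Q x0 by auto
  then have r: "r \<noteq> 0" and "r * (xP - x0) = xQ - x0"
    by (auto simp: r_def)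
  then have rxP: "r * xP + b = xQ" by (simp add: b_def algebra_simps)
  have L: "((\<lambda>x. r * x + b) has_derivative (*) r) (at x)" for x
    by (auto intro!: derivative_eq_intros)
  have "open (I \<inter> (\<lambda>x. r * x + b) -` I)"
    using oI by (intro open_Int open_vimage) (auto intro!: continuous_intros)
  moreover have "xP \<in> I \<inter> (\<lambda>x. r * x + b) -` I" using P Q rxP by simp
  ultimately obtain e where e: "e > 0" "ball xP e \<subseteq> I \<inter> (\<lambda>x. r * x + b) -` I"
    unfolding open_contains_ball by blast
  define I1 where "I1 = ball xP e"
  have I1: "open_interval I1" "open I1" "xP \<in> I1" "x0 \<notin> I1"
    using e x0 unfolding I1_def open_interval_def by (auto simp: is_interval_ball_real)
  have sub: "x \<in> I" "r * x + b \<in> I" if "x \<in> I1" for x using that e(2) by (auto simp: I1_def)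
  have comp: "smooth_on I1 (\<lambda>x. k (r * x + b))" if "smooth_on I k" for k :: "real \<Rightarrow> real"
    by (rule smooth_on_compose_affine[OF that oI I1(2) L]) (use sub in auto)
  have restr: "smooth_on I1 k" if "smooth_on I k" for k :: "real \<Rightarrow> real"
    by (rule smooth_on_subset[OF that]) (use sub in auto)
  \<comment> \<open>This is the mismatch of the linear coefficients of f, and hence the
    inhomogeneity of the Euler equation.\<close>
  define g where "g x = \<beta> x - r\<^sup>2 * \<beta> (r * x + b)" for x
  have sg: "smooth_on I1 g"
    unfolding g_def by (intro smooth_intros I1 comp[OF \<beta>] restr[OF \<beta>])
  obtain \<eta> \<eta>' where \<eta>0: "\<eta> xP = yQ - yP"
    and \<eta>: "\<And>x. x \<in> I1 \<Longrightarrow> (\<eta> has_real_derivative \<eta>' x) (at x)"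
      "\<And>x. x \<in> I1 \<Longrightarrow> (\<eta>' has_real_derivative g x - 2 * a / (x - x0)\<^sup>2 * \<eta> x) (at x)"
    using euler_ode[OF I1(1) smooth_on_continuous[OF sg I1(2)] I1(3,4)] by blast
  have "smooth_on I1 (\<lambda>x. 2 * a / (x - x0)\<^sup>2)"
    by (intro smooth_intros I1) (use I1(4) in auto)
  then have s\<eta>: "smooth_on I1 \<eta>"
    using smooth_on_second_order[OF I1(2) _ sg \<eta>] by blast
  have s\<eta>': "smooth_on I1 \<eta>'" using smooth_on_real_deriv[OF s\<eta> I1(2) \<eta>(1)] .
  define \<zeta>' where "\<zeta>' x = a / (x - x0)\<^sup>2 * (\<eta> x)\<^sup>2 + r\<^sup>2 * (\<beta> (r * x + b) * \<eta> x + \<gamma> (r * x + b)) -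
    \<gamma> x - (\<eta>' x)\<^sup>2 / 2" for x
  have s\<zeta>': "smooth_on I1 \<zeta>'"
    unfolding \<zeta>'_def by (intro smooth_intros I1 comp[OF \<beta>] comp[OF \<gamma>] restr[OF \<gamma>] s\<eta> s\<eta>') (use I1(4) in auto)
  obtain Z where Z: "\<And>x. x \<in> I1 \<Longrightarrow> (Z has_real_derivative \<zeta>' x) (at x)"
    using open_interval_antiderivative[OF I1(1) smooth_on_continuous[OF s\<zeta>' I1(2)]]
    unfolding has_real_derivative_iff_has_vector_derivative by blast
  \<comment> \<open>The constant of integration is chosen such that the t-coordinate of
    \<open>P\<close> goes to \<open>tQ\<close>.\<close>
  define \<zeta> where "\<zeta> x = Z x + (r * tQ - tP + \<eta>' xP * yP - Z xP)" for x
  have \<zeta>: "(\<zeta> has_real_derivative \<zeta>' x) (at x)" if "x \<in> I1" for x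
    unfolding \<zeta>_def[abs_def] using Z[OF that] by (auto intro!: derivative_eq_intros)
  have s\<zeta>: "smooth_on I1 \<zeta>" using smooth_on_antiderivative[OF s\<zeta>' I1(2) \<zeta>] .
  define T where "T = wave_map r b 1 \<eta> \<eta>' \<zeta>"
  \<comment> \<open>Intersecting with the preimage ensures that y + \<eta> x stays in
    \<open>J\<close>, where the formula for f may be used.\<close>
  define A where "A = (I1 \<times> J \<times> UNIV) \<inter> T -` ?U"
  have "continuous_on (I1 \<times> UNIV) T"
    unfolding T_def using smooth_wave_map(1)[OF I1(2) s\<eta> s\<eta>' s\<zeta> r, of 1 b] I1(2)
    by (auto intro!: smooth_on_continuous open_Times)
  then have "continuous_on (I1 \<times> J \<times> UNIV) T" by (rule continuous_on_subset) auto
  then have A: "open A"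
    unfolding A_def by (rule continuous_open_preimage) (auto intro!: open_Times I1 J oI)
  have TP: "T P = Q"
    using r rxP by (simp add: T_def wave_map_def P Q \<eta>0 \<zeta>_def)
  have eq: "1\<^sup>2 * f x y = r\<^sup>2 * f (r * x + b) (1 * y + \<eta> x) +
      1 * (g x - 2 * a / (x - x0)\<^sup>2 * \<eta> x) * y - \<zeta>' x - (\<eta>' x)\<^sup>2 / 2" if "(x, y, t) \<in> A" for x y t
  proof -
    have x: "x \<in> I1" "y \<in> J" "y + \<eta> x \<in> J"
      using that by (auto simp: A_def T_def wave_map_def)
    have fx: "f x y = a / (x - x0)\<^sup>2 * y\<^sup>2 + \<beta> x * y + \<gamma> x"
      using f[OF sub(1)[OF x(1)] x(2)] by (simp add: power_int_minus divide_inverse)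
    have "x - x0 \<noteq> 0" using x I1(4) by auto
    moreover have "r * x + b - x0 = r * (x - x0)" by (simp add: b_def algebra_simps)
    ultimately have "r\<^sup>2 * (a * (r * x + b - x0) powi (-2)) = a / (x - x0)\<^sup>2"
      using r by (simp add: power_int_minus divide_inverse power_mult_distrib)
    moreover have "f (r * x + b) (y + \<eta> x) =
        (a * (r * x + b - x0) powi (-2)) * (y + \<eta> x)\<^sup>2 + \<beta> (r * x + b) * (y + \<eta> x) + \<gamma> (r * x + b)"
      using f[OF sub(2)[OF x(1)] x(3)] by simp
    ultimately have rf: "r\<^sup>2 * f (r * x + b) (y + \<eta> x) =
        a / (x - x0)\<^sup>2 * (y + \<eta> x)\<^sup>2 + r\<^sup>2 * (\<beta> (r * x + b) * (y + \<eta> x) + \<gamma> (r * x + b))"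
      by (metis (no_types, lifting) add.assoc distrib_left mult.assoc)
    define q where "q = a / (x - x0)\<^sup>2"
    have q: "2 * a / (x - x0)\<^sup>2 = 2 * q" by (simp add: q_def)
    show ?thesis
      unfolding fx \<zeta>'_def g_def mult_1 q q_def[symmetric] rf by (simp add: power2_eq_square algebra_simps)
  qed
  have A1: "A \<subseteq> I1 \<times> UNIV" by (auto simp: A_def)
  have "open (T ` A)" "isometry (A, metric_f f) (T ` A, metric_f f) T"
    using scaled_isometry_wave_map[OF I1(2) A A1 s\<eta> s\<zeta> \<eta> \<zeta> r _ eq]
    unfolding T_def isometry_def by simp_all
  moreover have PA: "P \<in> A" using P Q I1 TP by (auto simp: A_def)
  moreover have "Q \<in> T ` A" using imageI[OF PA, of T] TP by simp
  moreover have "A \<subseteq> ?U" "T ` A \<subseteq> ?U" using sub by (auto simp: A_def)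
  ultimately show "\<exists>A B T. open A \<and> P \<in> A \<and> A \<subseteq> ?U \<and> open B \<and> Q \<in> B \<and> B \<subseteq> ?U \<and>
      isometry (A, metric_f f) (B, metric_f f) T \<and> T P = Q"
    using A TP by blast
qed

subsection \<open>Curvature homogeneous waves\<close>

lemma connected_same_sign:
  fixes k :: "'a::topological_space \<Rightarrow> real"
  assumes "connected S" "continuous_on S k" "\<And>x. x \<in> S \<Longrightarrow> k x \<noteq> 0" "p \<in> S" "q \<in> S"
  shows "k p * k q > 0"
proof -
  have "is_interval (k ` S)"
    using connected_continuous_image[OF assms(2,1)] is_interval_connected_1 by blast
  moreover have "0 \<notin> k ` S" "k p \<in> k ` S" "k q \<in> k ` S" using assms(3-5) by auto
  ultimately have "\<not> (k p \<le> 0 \<and> 0 \<le> k q)" "\<not> (k q \<le> 0 \<and> 0 \<le> k p)"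
    unfolding is_interval_1 by blast+
  then show ?thesis by (auto simp: zero_less_mult_iff)
qed

lemma zero_derivative_constant:
  fixes k :: "real \<Rightarrow> real"
  assumes "is_interval S" "\<And>x. x \<in> S \<Longrightarrow> (k has_real_derivative 0) (at x)" "x \<in> S" "y \<in> S"
  shows "k x = k y"
proof -
  have "convex S" using assms(1) is_interval_convex_1 by blast
  then obtain c where "\<forall>x\<in>S. k x = c"
    using has_field_derivative_zero_constant[of S k] assms(2) has_field_derivative_at_within by blast
  then show ?thesis using assms(3,4) by simp
qed

lemma dir_deriv_arith:
  fixes f g :: "'a::euclidean_space \<Rightarrow> real"
  assumes "f differentiable at p" "g differentiable at p"
  shows "dir_deriv v (\<lambda>p. f p + g p) p = dir_deriv v f p + dir_deriv v g p"
    and "dir_deriv v (\<lambda>p. f p * g p) p = dir_deriv v f p * g p + f p * dir_deriv v g p"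
    and "g p \<noteq> 0 \<Longrightarrow> dir_deriv v (\<lambda>p. f p / g p) p =
      (dir_deriv v f p * g p - f p * dir_deriv v g p) / (g p * g p)"
    and "dir_deriv v (\<lambda>p. f p - g p) p = dir_deriv v f p - dir_deriv v g p"
proof -
  note D = assms[THEN has_derivative_dir_deriv]
  show "dir_deriv v (\<lambda>p. f p + g p) p = dir_deriv v f p + dir_deriv v g p"
    using dir_deriv_eqI[OF has_derivative_add[OF D]] .
  show "dir_deriv v (\<lambda>p. f p * g p) p = dir_deriv v f p * g p + f p * dir_deriv v g p"
    using dir_deriv_eqI[OF has_derivative_mult[OF D]] by (simp add: add.commute)
  show "dir_deriv v (\<lambda>p. f p / g p) p =
      (dir_deriv v f p * g p - f p * dir_deriv v g p) / (g p * g p)" if "g p \<noteq> 0"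
    using dir_deriv_eqI[OF has_derivative_divide'[OF D that]] .
  show "dir_deriv v (\<lambda>p. f p - g p) p = dir_deriv v f p - dir_deriv v g p"
    using dir_deriv_eqI[OF has_derivative_diff[OF D]] .
qed

lemma dir_deriv_const: "dir_deriv v (\<lambda>_. c) p = 0"
  by (rule dir_deriv_eqI) simp

locale nonflat_wave = plane_wave +
  assumes I: "open_interval I" and J: "open_interval J" and h_nonzero: "\<And>p. p \<in> D \<Longrightarrow> h p \<noteq> 0"
begin

lemma interval_I: "is_interval I" and interval_J: "is_interval J" and connected_D: "connected D"
proof -
  show "is_interval I" "is_interval J" using I J by (auto simp: open_interval_def)
  then show "connected D" by (intro connected_Times) (auto simp: is_interval_connected)
qed

lemma sections:
  assumes "k differentiable at (x, y)"
  shows "((\<lambda>x. k (x, y)) has_real_derivative pd1 k (x, y)) (at x)"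
    "((\<lambda>y. k (x, y)) has_real_derivative pd2 k (x, y)) (at y)"
  using assms by (rule has_real_derivative_pd1, rule has_real_derivative_pd2)

lemma smooth_section1:
  assumes "smooth_on D k" "y \<in> J"
  shows "smooth_on I (\<lambda>x. k (x, y))"
  by (rule smooth_on_compose_affine[OF assms(1) open_D open_I, of _ "\<lambda>v. (v, 0)"])
    (use assms(2) in \<open>auto intro!: derivative_eq_intros\<close>)

text \<open>The quotient of the first two equations gives \<open>c\<close>, the first one then gives
  \<open>s\<close>, and the third is linear in \<open>n\<close> with a nonzero coefficient. The
  square root exists since h has constant sign on the connected domain.\<close>

lemma homogeneous_1:
  assumes hy: "\<And>p. p \<in> D \<Longrightarrow> pd2 h p \<noteq> 0"
  shows "homothety_curvature_homogeneous 1 (manifold_f I J f)"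
proof (rule homogeneous_1I)
  fix p q assume p: "p \<in> D" and q: "q \<in> D"
  define a where "a = h p / h q"
  define a' where "a' = pd2 h p / pd2 h q"
  have "h p * h q > 0"
    using connected_same_sign[OF connected_D smooth_on_continuous[OF smooth_iterated(4) open_D] h_nonzero p q] .
  then have a: "a > 0" unfolding a_def by (simp add: zero_less_divide_iff zero_less_mult_iff)
  have a': "a' \<noteq> 0" using hy[OF p] hy[OF q] by (simp add: a'_def)
  define c where "c = a' / a"
  define s where "s = sqrt a / c"
  have c: "c \<noteq> 0" "s \<noteq> 0" using a a' by (auto simp: c_def s_def)
  have s2: "s\<^sup>2 * c\<^sup>2 = a" using a c by (simp add: s_def power_divide)
  then have s3: "s\<^sup>2 * c ^ 3 = a'"
    using a by (simp add: power3_eq_cube power2_eq_square c_def field_simps)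
  define n where "n = (pd1 h p / a' - s * pd1 h q) / pd2 h q"
  have "s\<^sup>2 * c\<^sup>2 * h q = h p" unfolding s2 a_def using h_nonzero[OF q] by simp
  moreover have "1 * s\<^sup>2 * c ^ 3 * pd2 h q = pd2 h p" unfolding mult_1 s3 a'_def using hy[OF q] by simp
  moreover have "s\<^sup>2 * c ^ 3 * (s * pd1 h q + n * pd2 h q) = pd1 h p"
    unfolding s3 n_def using a' hy[OF q] by simp
  ultimately show "\<exists>s \<tau> n c. s \<noteq> 0 \<and> c \<noteq> 0 \<and> \<tau>\<^sup>2 = 1 \<and>
    s\<^sup>2 * c\<^sup>2 * h q = h p \<and> \<tau> * s\<^sup>2 * c ^ 3 * pd2 h q = pd2 h p \<and>
    s\<^sup>2 * c ^ 3 * (s * pd1 h q + n * pd2 h q) = pd1 h p"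
    using c by (metis one_power2)
qed

section \<open>Waves whose second derivative in y depends on x alone\<close>

context
  fixes \<alpha> :: "real \<Rightarrow> real"
  assumes \<alpha>: "\<And>x y. x \<in> I \<Longrightarrow> y \<in> J \<Longrightarrow> h (x, y) = \<alpha> x"
    and \<alpha>': "\<And>x. x \<in> I \<Longrightarrow> deriv \<alpha> x \<noteq> 0"
begin

lemma smooth_\<alpha>: "smooth_on I \<alpha>"
proof -
  obtain y where "y \<in> J" using J by (auto simp: open_interval_def)
  then show ?thesis
    using smooth_on_cong[OF open_I _ smooth_section1[OF smooth_iterated(4)]] \<alpha> by blast
qed

lemma DERIV_\<alpha>: "x \<in> I \<Longrightarrow> (\<alpha> has_real_derivative deriv \<alpha> x) (at x)"
  using smooth_on_differentiable[OF smooth_\<alpha> open_I] DERIV_deriv_iff_real_differentiable by blast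

lemma dir_deriv_h_\<alpha>:
  assumes "x \<in> I" "y \<in> J"
  shows "pd1 h (x, y) = deriv \<alpha> x" "pd2 h (x, y) = 0"
proof -
  have d: "h differentiable at (x, y)" using differentiable_iterated(4) assms by blast
  have "(\<alpha> has_real_derivative pd1 h (x, y)) (at x)"
    by (rule has_field_derivative_transform_within_open[OF sections(1)[OF d] open_I assms(1)])
      (use \<alpha> assms(2) in auto)
  then show "pd1 h (x, y) = deriv \<alpha> x" using DERIV_imp_deriv by metis
  have "((\<lambda>_. \<alpha> x) has_real_derivative pd2 h (x, y)) (at y)"
    by (rule has_field_derivative_transform_within_open[OF sections(2)[OF d] open_J assms(2)])
      (use \<alpha> assms(1) in auto)
  then show "pd2 h (x, y) = 0" using DERIV_unique DERIV_const by blast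
qed

lemma quadratic_imp_homogeneous_1:
  assumes x0: "x0 \<notin> I"
    and f: "\<And>x y. x \<in> I \<Longrightarrow> y \<in> J \<Longrightarrow> f x y = a * (x - x0) powi (-2) * y\<^sup>2 + \<beta> x * y + \<gamma> x"
  shows "homothety_curvature_homogeneous 1 (manifold_f I J f)"
proof -
  have Fy: "pd2 F (x, y) = 2 * a / (x - x0)\<^sup>2 * y + \<beta> x" if "x \<in> I" "y \<in> J" for x y
  proof -
    have "F differentiable at (x, y)" using differentiable_iterated(1) that by blast
    from sections(2)[OF this]
    have **: "((\<lambda>y. a * (x - x0) powi (-2) * y\<^sup>2 + \<beta> x * y + \<gamma> x) has_real_derivative pd2 F (x, y)) (at y)"
      by (rule has_field_derivative_transform_within_open[OF _ open_J that(2)]) (use f that in auto)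
    have *: "((\<lambda>y. c * y\<^sup>2 + \<beta> x * y + \<gamma> x) has_real_derivative 2 * c * y + \<beta> x) (at y)" for c
      by (auto intro!: derivative_eq_intros)
    have "((\<lambda>y. a * (x - x0) powi (-2) * y\<^sup>2 + \<beta> x * y + \<gamma> x) has_real_derivative
        2 * a / (x - x0)\<^sup>2 * y + \<beta> x) (at y)"
      using *[of "a * (x - x0) powi (-2)"] by (simp add: power_int_minus divide_inverse mult.assoc)
    with ** show ?thesis by (rule DERIV_unique)
  qed
  have \<alpha>_eq: "\<alpha> x = 2 * a / (x - x0)\<^sup>2" if x: "x \<in> I" for x
  proof -
    obtain y where y: "y \<in> J" using J by (auto simp: open_interval_def)
    have "pd2 F differentiable at (x, y)" using differentiable_iterated(3) x y by blast
    from sections(2)[OF this]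
    have "((\<lambda>y. 2 * a / (x - x0)\<^sup>2 * y + \<beta> x) has_real_derivative h (x, y)) (at y)"
      by (rule has_field_derivative_transform_within_open[OF _ open_J y]) (use Fy x in auto)
    moreover have "((\<lambda>y. 2 * a / (x - x0)\<^sup>2 * y + \<beta> x) has_real_derivative 2 * a / (x - x0)\<^sup>2) (at y)"
      by (rule real_derivative_affine)
    ultimately have "h (x, y) = 2 * a / (x - x0)\<^sup>2" by (rule DERIV_unique)
    then show ?thesis using \<alpha> x y by simp
  qed
  have d\<alpha>: "deriv \<alpha> x = - 4 * a / (x - x0) ^ 3" if x: "x \<in> I" for x
  proof -
    have nz: "x - x0 \<noteq> 0" using x x0 by auto
    have "((\<lambda>z. 2 * a / z\<^sup>2) has_real_derivative - 4 * a / z ^ 3) (at z)" if "z \<noteq> 0" for z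
      using that by (auto intro!: derivative_eq_intros simp: power2_eq_square power3_eq_cube field_simps)
    from this[of "x + - x0"] nz
    have "((\<lambda>x. 2 * a / (x - x0)\<^sup>2) has_real_derivative - 4 * a / (x - x0) ^ 3) (at x)"
      unfolding DERIV_shift by simp
    then have "(\<alpha> has_real_derivative - 4 * a / (x - x0) ^ 3) (at x)"
      by (rule has_field_derivative_transform_within_open[OF _ open_I x]) (use \<alpha>_eq in auto)
    then show ?thesis by (rule DERIV_imp_deriv)
  qed
  show ?thesis
  proof (rule homogeneous_1I)
    fix p q assume "p \<in> D" "q \<in> D"
    then obtain x y x' y' where p: "p = (x, y)" "x \<in> I" "y \<in> J" and q: "q = (x', y')" "x' \<in> I" "y' \<in> J"
      by auto
    \<comment> \<open>The ratio of the distances to \<open>x0\<close> solves the equations with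
      \<open>c = 1\<close>, as \<alpha> is homogeneous of degree -2 and its derivative of degree -3
      in x - x0; \<open>n\<close> has no effect when h_y = 0.\<close>
    define s where "s = (x' - x0) / (x - x0)"
    have nz: "x - x0 \<noteq> 0" "x' - x0 \<noteq> 0" using p q x0 by auto
    then have s: "s \<noteq> 0" "x' - x0 = s * (x - x0)" by (auto simp: s_def)
    have "s\<^sup>2 * \<alpha> x' = \<alpha> x" "s ^ 3 * deriv \<alpha> x' = deriv \<alpha> x"
      unfolding \<alpha>_eq[OF p(2)] \<alpha>_eq[OF q(2)] d\<alpha>[OF p(2)] d\<alpha>[OF q(2)] s(2)
      using s(1) by (simp_all add: power_mult_distrib)
    then show "\<exists>s \<tau> n c. s \<noteq> 0 \<and> c \<noteq> 0 \<and> \<tau>\<^sup>2 = 1 \<and>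
      s\<^sup>2 * c\<^sup>2 * h q = h p \<and> \<tau> * s\<^sup>2 * c ^ 3 * pd2 h q = pd2 h p \<and>
      s\<^sup>2 * c ^ 3 * (s * pd1 h q + n * pd2 h q) = pd1 h p"
      using s(1) p q
      by (intro exI[of _ s] exI[of _ 1] exI[of _ 0])
        (simp add: \<alpha> dir_deriv_h_\<alpha> power2_eq_square power3_eq_cube mult.assoc)
  qed
qed

text \<open>The function m = |\<alpha>|^(-1/2) has a derivative whose square is a multiple of the
  invariant, hence constant. Being continuous and without zeros, the derivative itself is constant,
  so m is affine; its zero \<open>x0\<close> lies outside \<open>I\<close> because m is positive
  there.\<close>

lemma homogeneous_1_imp_quadratic:
  assumes hom: "homothety_curvature_homogeneous 1 (manifold_f I J f)"
  obtains a x0 \<beta> \<gamma> where "a \<noteq> 0" "x0 \<notin> I" "smooth_on I \<beta>" "smooth_on I \<gamma>"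
    "\<And>x y. x \<in> I \<Longrightarrow> y \<in> J \<Longrightarrow> f x y = a * (x - x0) powi (-2) * y\<^sup>2 + \<beta> x * y + \<gamma> x"
proof -
  obtain x1 y0 where x1: "x1 \<in> I" and y0: "y0 \<in> J" using I J by (auto simp: open_interval_def)
  have nz: "\<alpha> x \<noteq> 0" if "x \<in> I" for x using h_nonzero[of "(x, y0)"] \<alpha>[OF that y0] that y0 by simp
  have cI: "connected I" using interval_I is_interval_connected by blast
  define \<sigma> where "\<sigma> = sgn (\<alpha> x1)"
  have \<sigma>: "\<sigma>\<^sup>2 = 1" "\<sigma> \<noteq> 0" using nz[OF x1] by (auto simp: \<sigma>_def power2_eq_square sgn_if)
  have pos: "\<sigma> * \<alpha> x > 0" if "x \<in> I" for x
    using connected_same_sign[OF cI smooth_on_continuous[OF smooth_\<alpha> open_I] nz x1 that]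
    by (auto simp: \<sigma>_def sgn_if zero_less_mult_iff split: if_splits)
  have inv: "(deriv \<alpha> x)\<^sup>2 * (\<alpha> x1) ^ 3 = (deriv \<alpha> x1)\<^sup>2 * (\<alpha> x) ^ 3" if x: "x \<in> I" for x
  proof -
    have "(x, y0) \<in> D" "(x1, y0) \<in> D" "h (x1, y0) \<noteq> 0" using x x1 y0 h_nonzero by auto
    from homogeneousE[OF hom _ this] obtain s \<tau> n c where
      e: "s\<^sup>2 * c\<^sup>2 * h (x1, y0) = h (x, y0)"
        "s\<^sup>2 * c ^ 3 * (s * pd1 h (x1, y0) + n * pd2 h (x1, y0)) = pd1 h (x, y0)"
      by (metis order_refl)
    have "s\<^sup>2 * c\<^sup>2 * \<alpha> x1 = \<alpha> x" "s\<^sup>2 * c ^ 3 * (s * deriv \<alpha> x1) = deriv \<alpha> x"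
      using e by (simp_all add: \<alpha>[OF x y0] \<alpha>[OF x1 y0] dir_deriv_h_\<alpha>[OF x y0] dir_deriv_h_\<alpha>[OF x1 y0])
    note e = this[symmetric]
    show ?thesis unfolding e by (simp add: power2_eq_square power3_eq_cube mult_ac)
  qed
  define m where "m x = 1 / sqrt (\<sigma> * \<alpha> x)" for x
  define m' where "m' x = - (\<sigma> * deriv \<alpha> x) / (2 * sqrt (\<sigma> * \<alpha> x) * (\<sigma> * \<alpha> x))" for x
  have m: "(m has_real_derivative m' x) (at x)" if x: "x \<in> I" for x
  proof -
    have "sqrt (\<sigma> * \<alpha> x) * sqrt (\<sigma> * \<alpha> x) = \<sigma> * \<alpha> x" using pos[OF x] by simp
    then show ?thesis
      unfolding m_def[abs_def] m'_def using pos[OF x] DERIV_\<alpha>[OF x]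
      by (auto intro!: derivative_eq_intros simp: field_simps)
  qed
  have m'nz: "m' x \<noteq> 0" if "x \<in> I" for x using pos[OF that] \<alpha>'[OF that] \<sigma> by (auto simp: m'_def)
  have sq: "(m' x)\<^sup>2 = (deriv \<alpha> x)\<^sup>2 / (4 * \<sigma> * (\<alpha> x) ^ 3)" if x: "x \<in> I" for x
  proof -
    have "(sqrt (\<sigma> * \<alpha> x))\<^sup>2 = \<sigma> * \<alpha> x" using pos[OF x] by simp
    then have "(m' x)\<^sup>2 = \<sigma>\<^sup>2 * (deriv \<alpha> x)\<^sup>2 / (4 * (\<sigma> * \<alpha> x) * (\<sigma> * \<alpha> x)\<^sup>2)"
      by (simp add: m'_def power_divide power_mult_distrib)
    then show ?thesis
      unfolding power_mult_distrib \<sigma> by (simp add: power2_eq_square power3_eq_cube mult.assoc)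
  qed
  have "continuous_on I m'"
    unfolding m'_def
    using smooth_on_continuous[OF smooth_\<alpha> open_I] pos
      smooth_on_continuous[OF smooth_on_real_deriv[OF smooth_\<alpha> open_I DERIV_\<alpha>] open_I] \<sigma>(2) nz
    by (intro continuous_intros) auto
  have m'_const: "m' x = m' x1" if x: "x \<in> I" for x
  proof -
    have "(deriv \<alpha> x)\<^sup>2 / (4 * \<sigma> * (\<alpha> x) ^ 3) = (deriv \<alpha> x1)\<^sup>2 / (4 * \<sigma> * (\<alpha> x1) ^ 3)"
      using inv[OF x] nz[OF x] nz[OF x1] \<sigma>(2) by (simp add: field_simps)
    then have "(m' x)\<^sup>2 = (m' x1)\<^sup>2" by (simp add: sq x x1)
    moreover have "m' x * m' x1 > 0"
      using connected_same_sign[OF cI \<open>continuous_on I m'\<close> m'nz x x1] .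
    ultimately show ?thesis by (auto simp: power2_eq_iff zero_less_mult_iff)
  qed
  define d where "d = m' x1"
  have d: "d \<noteq> 0" using m'nz[OF x1] by (simp add: d_def)
  have "m x - d * x = m x1 - d * x1" if x: "x \<in> I" for x
    by (rule zero_derivative_constant[OF interval_I _ x x1])
      (use m m'_const in \<open>auto intro!: derivative_eq_intros simp: d_def\<close>)
  define x0 where "x0 = x1 - m x1 / d"
  have mx: "m x = d * (x - x0)" if x: "x \<in> I" for x
    using \<open>x \<in> I \<Longrightarrow> m x - d * x = m x1 - d * x1\<close> x d by (simp add: x0_def algebra_simps)
  have x0: "x0 \<notin> I"
  proof
    assume "x0 \<in> I"
    then have "m x0 > 0" using pos by (simp add: m_def)
    then show False using mx[OF \<open>x0 \<in> I\<close>] by simp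
  qed
  \<comment> \<open>From \<open>\<sigma> * \<alpha> x = 1 / (m x)\<^sup>2\<close> and the affine
    form of \<open>m\<close> one gets \<alpha> as twice the coefficient of y^2 in f.\<close>
  define a where "a = \<sigma> / (2 * d\<^sup>2)"
  have \<alpha>_eq: "\<alpha> x = 2 * a * (x - x0) powi (-2)" if x: "x \<in> I" for x
  proof -
    have "(m x)\<^sup>2 = 1 / (\<sigma> * \<alpha> x)" using pos[OF x] by (simp add: m_def power_divide)
    then have "\<sigma> * \<alpha> x = 1 / (d\<^sup>2 * (x - x0)\<^sup>2)" by (simp add: mx[OF x] power_mult_distrib)
    then have "\<sigma>\<^sup>2 * \<alpha> x = \<sigma> / (d\<^sup>2 * (x - x0)\<^sup>2)" by (simp add: power2_eq_square mult.assoc)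
    then have "\<alpha> x = \<sigma> / (d\<^sup>2 * (x - x0)\<^sup>2)" unfolding \<sigma> by simp
    also have "\<dots> = 2 * a * (x - x0) powi (-2)"
    proof -
      have "(x - x0) powi (-2) = 1 / (x - x0)\<^sup>2" by (simp add: power_int_minus divide_inverse)
      then show ?thesis by (simp only: a_def) simp
    qed
    finally show ?thesis .
  qed
  \<comment> \<open>These are the constants of integration in y, normalized at the base point
    \<open>y0\<close>.\<close>
  define \<beta> where "\<beta> x = pd2 F (x, y0) - \<alpha> x * y0" for x
  define \<gamma> where "\<gamma> x = F (x, y0) - \<alpha> x / 2 * y0\<^sup>2 - \<beta> x * y0" for x
  have s\<beta>: "smooth_on I \<beta>"
    unfolding \<beta>_def
    by (intro smooth_intros open_I smooth_\<alpha> smooth_section1[OF smooth_iterated(3) y0])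
  have s\<gamma>: "smooth_on I \<gamma>"
    unfolding \<gamma>_def
    by (intro smooth_intros open_I smooth_\<alpha> s\<beta> smooth_section1[OF smooth_iterated(1) y0]) simp
  have "f x y = a * (x - x0) powi (-2) * y\<^sup>2 + \<beta> x * y + \<gamma> x" if x: "x \<in> I" and y: "y \<in> J" for x y
  proof -
    have Fy: "pd2 F (x, y) = \<alpha> x * y + \<beta> x" if y: "y \<in> J" for y
    proof -
      have "((\<lambda>y. pd2 F (x, y) - \<alpha> x * y) has_real_derivative 0) (at y)" if "y \<in> J" for y
        using sections(2)[OF differentiable_iterated(3), of x y] \<alpha>[OF x that] x that
        by (auto intro!: derivative_eq_intros)
      from zero_derivative_constant[OF interval_J this y y0] show ?thesis by (simp add: \<beta>_def)
    qed
    have "((\<lambda>y. F (x, y) - \<alpha> x / 2 * y\<^sup>2 - \<beta> x * y) has_real_derivative 0) (at y)" if "y \<in> J" for y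
      using sections(2)[OF differentiable_iterated(1), of x y] Fy[OF that] x that
      by (auto intro!: derivative_eq_intros)
    from zero_derivative_constant[OF interval_J this y y0]
    have "F (x, y) = \<alpha> x / 2 * y\<^sup>2 + \<beta> x * y + \<gamma> x" by (simp add: \<gamma>_def)
    then show ?thesis by (simp add: \<alpha>_eq[OF x])
  qed
  moreover have "a \<noteq> 0" using \<sigma> d by (simp add: a_def)
  ultimately show thesis using that[OF _ x0 s\<beta> s\<gamma>] by blast
qed

end

end

subsection \<open>Normal forms of curvature homogeneous waves\<close>

text \<open>The modulus of A is absorbed by scaling x with its square root, so only its sign
  remains; \<sigma> allows a reflection of y, and \<gamma> goes into the t-coordinate. One map
  defined on the whole wave suffices, since its image only has to be an open part of the
  model.\<close>

lemma locally_isometricI: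
  assumes I: "open_interval I" and J: "open J"
    and \<eta>: "smooth_on I \<eta>" "\<And>x. x \<in> I \<Longrightarrow> (\<eta> has_real_derivative \<eta>' x) (at x)"
      "\<And>x. x \<in> I \<Longrightarrow> (\<eta>' has_real_derivative \<eta>'' x) (at x)"
    and \<gamma>: "smooth_on I \<gamma>" and A: "A \<noteq> 0" and \<sigma>: "\<sigma>\<^sup>2 = (1::real)"
    and J': "\<And>x y. x \<in> I \<Longrightarrow> y \<in> J \<Longrightarrow> \<sigma> * (y + \<eta> x) \<in> J'"
    and f: "\<And>x y. x \<in> I \<Longrightarrow> y \<in> J \<Longrightarrow> f x y = \<eta>'' x * y + A * \<phi> (\<sigma> * (y + \<eta> x)) + \<gamma> x"
  shows "\<exists>s\<in>{1, -1}. locally_isometric (manifold_f I J f) (manifold_f UNIV J' (\<lambda>x y. s * \<phi> y))"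
proof -
  have oI: "open I" using I by (simp add: open_interval_def)
  have \<sigma>0: "\<sigma> \<noteq> 0" using \<sigma> by auto
  define s where "s = sgn A"
  define r where "r = sqrt \<bar>A\<bar>"
  have r: "r \<noteq> 0" "r\<^sup>2 * s = A" "s \<in> {1, -1}"
    using A by (auto simp: r_def s_def abs_mult_sgn sgn_if)
  define \<zeta>' where "\<zeta>' x = - \<gamma> x - (\<eta>' x)\<^sup>2 / 2" for x
  have s\<eta>': "smooth_on I \<eta>'" using smooth_on_real_deriv[OF \<eta>(1) oI \<eta>(2)] .
  have s\<zeta>': "smooth_on I \<zeta>'" unfolding \<zeta>'_def by (intro smooth_intros oI s\<eta>' \<gamma>) simp
  obtain \<zeta> where \<zeta>: "\<And>x. x \<in> I \<Longrightarrow> (\<zeta> has_real_derivative \<zeta>' x) (at x)"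
    using open_interval_antiderivative[OF I smooth_on_continuous[OF s\<zeta>' oI]]
    unfolding has_real_derivative_iff_has_vector_derivative by blast
  have s\<zeta>: "smooth_on I \<zeta>" using smooth_on_antiderivative[OF s\<zeta>' oI \<zeta>] .
  define T where "T = wave_map r 0 \<sigma> (\<lambda>x. \<sigma> * \<eta> x) (\<lambda>x. \<sigma> * \<eta>' x) \<zeta>"
  let ?U = "I \<times> J \<times> (UNIV :: real set)"
  have U: "open ?U" "?U \<subseteq> I \<times> UNIV" using oI J by (auto intro!: open_Times)
  have s\<sigma>: "smooth_on I (\<lambda>x. \<sigma> * \<eta> x)" by (intro smooth_intros oI \<eta>)
  have eq: "\<sigma>\<^sup>2 * f x y = r\<^sup>2 * (s * \<phi> (\<sigma> * y + \<sigma> * \<eta> x)) + \<sigma> * (\<sigma> * \<eta>'' x) * y - \<zeta>' x - (\<sigma> * \<eta>' x)\<^sup>2 / 2"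
    if "(x, y, t) \<in> ?U" for x y t
  proof -
    have "r\<^sup>2 * (s * \<phi> (\<sigma> * y + \<sigma> * \<eta> x)) = A * \<phi> (\<sigma> * (y + \<eta> x))"
      unfolding r(2)[symmetric] by (simp add: distrib_left)
    moreover have "\<sigma> * (\<sigma> * \<eta>'' x) * y = \<sigma>\<^sup>2 * (\<eta>'' x * y)" by (simp add: power2_eq_square)
    moreover have "f x y = \<eta>'' x * y + A * \<phi> (\<sigma> * (y + \<eta> x)) + \<gamma> x" using f that by simp
    ultimately show ?thesis by (simp add: power_mult_distrib \<sigma> \<zeta>'_def)
  qed
  note iso = scaled_isometry_wave_map[OF oI U s\<sigma> s\<zeta> DERIV_cmult[OF \<eta>(2)] DERIV_cmult[OF \<eta>(3)] \<zeta> r(1) \<sigma>0,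
      where k = "\<lambda>x y. s * \<phi> y" and f = f and b = 0, OF _ _ _ eq, folded T_def]
  have "open (T ` ?U)" "scaled_isometry (\<sigma>\<^sup>2) (?U, metric_f f) (T ` ?U, metric_f (\<lambda>x y. s * \<phi> y)) T"
    by (rule iso; assumption)+
  moreover have "T ` ?U \<subseteq> UNIV \<times> J' \<times> UNIV"
    using J' by (auto simp: T_def wave_map_def distrib_left)
  ultimately have "locally_isometric (manifold_f I J f) (manifold_f UNIV J' (\<lambda>x y. s * \<phi> y))"
    unfolding locally_isometric_def manifold_f_def isometry_def prod.case \<sigma> using U by blast
  then show ?thesis using r(3) by blast
qed

context nonflat_wave
begin

lemma constant_in_y:
  assumes "\<And>p. p \<in> D \<Longrightarrow> k differentiable at p" "\<And>p. p \<in> D \<Longrightarrow> pd2 k p = 0" "(x, y) \<in> D" "(x, y') \<in> D"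
  shows "k (x, y) = k (x, y')"
proof (rule zero_derivative_constant[OF interval_J, of "\<lambda>y. k (x, y)"])
  show "((\<lambda>y. k (x, y)) has_real_derivative 0) (at y)" if "y \<in> J" for y
    using sections(2)[of k x y] assms that by auto
qed (use assms in auto)

end

section \<open>Consequences of homothety 2-curvature homogeneity\<close>

locale homogeneous_2_wave = nonflat_wave +
  assumes hom: "homothety_curvature_homogeneous 2 (manifold_f I J f)"
    and hy_nonzero: "\<And>p. p \<in> D \<Longrightarrow> pd2 h p \<noteq> 0"
begin

text \<open>\<open>b\<close> is chosen such that the field \<open>X = \<partial>\<^sub>x + b\<partial>\<^sub>y\<close> annihilates \<open>h\<close>; modulo \<open>\<partial>\<^sub>t\<close> and up to a factor it
  is preserved by the linear isometries that match the curvature. \<open>H12\<close> and \<open>H11\<close> are \<open>\<nabla>\<^sup>2h(X, \<partial>\<^sub>y)\<close>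
  and \<open>\<nabla>\<^sup>2h(X, X)\<close>.\<close>

definition "b p = - pd1 h p / pd2 h p"
definition "w p = h p / pd2 h p"
definition "H12 p = pd2 (pd1 h) p + b p * pd2 (pd2 h) p"
definition "H11 p = pd1 (pd1 h) p + 2 * b p * pd2 (pd1 h) p + (b p)\<^sup>2 * pd2 (pd2 h) p - pd2 F p * pd2 h p"

lemma smooth_b: "smooth_on D b" and smooth_w: "smooth_on D w"
  unfolding b_def w_def
  by (intro smooth_intros open_D smooth_iterated hy_nonzero; assumption)+

lemma pd12_h: "p \<in> D \<Longrightarrow> pd1 (pd2 h) p = pd2 (pd1 h) p"
  using dir_deriv_commute[OF smooth_iterated(4) open_D] .

text \<open>The parameters are eliminated: passing to \<open>b\<close> removes \<open>n\<close>,
  squaring removes the sign \<tau>, and the products are arranged such that the powers of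
  \<open>s\<close> and \<open>c\<close> cancel.\<close>

lemma invariants:
  assumes p: "p \<in> D" and q: "q \<in> D"
  shows "h p * pd2 (pd2 h) p * (pd2 h q)\<^sup>2 = h q * pd2 (pd2 h) q * (pd2 h p)\<^sup>2"
    and "(H12 p)\<^sup>2 * (h q * (pd2 h q)\<^sup>2) = (H12 q)\<^sup>2 * (h p * (pd2 h p)\<^sup>2)"
    and "H11 p * (h q)\<^sup>2 = H11 q * (h p)\<^sup>2"
proof -
  obtain s \<tau> n c where \<tau>: "\<tau>\<^sup>2 = 1"
    and e0: "s\<^sup>2 * c\<^sup>2 * h q = h p" and e2: "\<tau> * s\<^sup>2 * c ^ 3 * pd2 h q = pd2 h p"
    and e1: "s\<^sup>2 * c ^ 3 * (s * pd1 h q + n * pd2 h q) = pd1 h p"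
    and e22: "s\<^sup>2 * c ^ 4 * pd2 (pd2 h) q = pd2 (pd2 h) p"
    and e12: "\<tau> * s\<^sup>2 * c ^ 4 * (s * pd2 (pd1 h) q + n * pd2 (pd2 h) q) = pd2 (pd1 h) p"
    and e11: "s\<^sup>2 * c ^ 4 * (s\<^sup>2 * pd1 (pd1 h) q + s * n * (pd2 (pd1 h) q + pd1 (pd2 h) q) +
       n\<^sup>2 * pd2 (pd2 h) q - pd2 F q * pd2 h q * s\<^sup>2) = pd1 (pd1 h) p - pd2 F p * pd2 h p"
    using homogeneousE[OF hom _ p q h_nonzero[OF q]] by (metis one_le_numeral order_refl)
  have bp: "b p * pd2 h p = - pd1 h p" "b q * pd2 h q = - pd1 h q"
    using hy_nonzero p q by (simp_all add: b_def)
  \<comment> \<open>In components this says that X at \<open>p\<close> is mapped to \<open>s\<close>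
    times X at \<open>q\<close>, modulo \<open>\<partial>\<^sub>t\<close>.\<close>
  have "pd2 h p * (b p - \<tau> * (s * b q - n)) = 0"
    using bp e1 e2 \<tau> by algebra
  then have b: "b p = \<tau> * (s * b q - n)" using hy_nonzero[OF p] by simp
  have H12: "H12 p = \<tau> * s ^ 3 * c ^ 4 * H12 q"
    unfolding H12_def b e12[symmetric] e22[symmetric] by algebra
  have "H11 p = (pd1 (pd1 h) p - pd2 F p * pd2 h p) + 2 * b p * pd2 (pd1 h) p + (b p)\<^sup>2 * pd2 (pd2 h) p"
    by (simp add: H11_def)
  also have "\<dots> = s ^ 4 * c ^ 4 * H11 q"
    unfolding e11[symmetric] e12[symmetric] e22[symmetric] b H11_def pd12_h[OF q] using \<tau> by algebra
  finally have H11: "H11 p = s ^ 4 * c ^ 4 * H11 q" .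
  show "h p * pd2 (pd2 h) p * (pd2 h q)\<^sup>2 = h q * pd2 (pd2 h) q * (pd2 h p)\<^sup>2"
    unfolding e0[symmetric] e2[symmetric] e22[symmetric] power_mult_distrib \<tau> by algebra
  show "(H12 p)\<^sup>2 * (h q * (pd2 h q)\<^sup>2) = (H12 q)\<^sup>2 * (h p * (pd2 h p)\<^sup>2)"
    unfolding e0[symmetric] e2[symmetric] H12 power_mult_distrib \<tau> by algebra
  show "H11 p * (h q)\<^sup>2 = H11 q * (h p)\<^sup>2"
    unfolding e0[symmetric] H11 by algebra
qed

lemma wave_equations:
  obtains k where "k \<noteq> 2" "\<And>p. p \<in> D \<Longrightarrow> pd2 w p = 1 - k" "\<And>p. p \<in> D \<Longrightarrow> pd1 w p = - (1 - k) * b p"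
    "\<And>p. p \<in> D \<Longrightarrow> pd2 b p = 0" "\<And>p. p \<in> D \<Longrightarrow> pd2 F p = - pd1 b p + h p * w p / (2 - k)"
proof -
  obtain p0 where p0: "p0 \<in> D" using I J by (auto simp: open_interval_def)
  note dif = differentiable_iterated smooth_on_differentiable[OF smooth_b open_D]
    smooth_on_differentiable[OF smooth_w open_D]
  define k where "k = h p0 * pd2 (pd2 h) p0 / (pd2 h p0)\<^sup>2"
  have k: "h p * pd2 (pd2 h) p = k * (pd2 h p)\<^sup>2" if "p \<in> D" for p
    using invariants(1)[OF that p0] hy_nonzero[OF p0] by (simp add: k_def field_simps)
  have hx: "pd1 h p = - b p * pd2 h p" if "p \<in> D" for p
    using hy_nonzero[OF that] by (simp add: b_def)
  have w: "w p * pd2 h p = h p" if "p \<in> D" for p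
    using hy_nonzero[OF that] by (simp add: w_def)
  have w0: "w p \<noteq> 0" if "p \<in> D" for p
    using h_nonzero[OF that] hy_nonzero[OF that] by (simp add: w_def)
  have w2: "pd2 w p = 1 - k" if p: "p \<in> D" for p
  proof -
    have "pd2 w p * (pd2 h p * pd2 h p) = pd2 h p * pd2 h p - h p * pd2 (pd2 h) p"
      unfolding w_def[abs_def] dir_deriv_arith(3)[OF dif(4)[OF p] dif(6)[OF p] hy_nonzero[OF p]]
      using hy_nonzero[OF p] by simp
    also have "\<dots> = (1 - k) * (pd2 h p * pd2 h p)"
      unfolding k[OF p] by (simp add: power2_eq_square algebra_simps)
    finally show ?thesis using hy_nonzero[OF p] by simp
  qed
  have b_eq: "dir_deriv v b p * pd2 h p = - dir_deriv v (pd1 h) p - b p * dir_deriv v (pd2 h) p"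
    if p: "p \<in> D" for v p
  proof -
    have "dir_deriv v (\<lambda>p. b p * pd2 h p + pd1 h p) p = dir_deriv v (\<lambda>_. 0) p"
      by (rule dir_deriv_cong[OF open_D p]) (simp add: hx)
    then show ?thesis
      using dif p by (simp add: dir_deriv_arith dir_deriv_const)
  qed
  have b2: "pd2 b p * pd2 h p = - H12 p" if "p \<in> D" for p
    using b_eq[OF that, of "(0, 1)"] by (simp add: H12_def)
  \<comment> \<open>This is Xw = w b_y, a consequence of Xh = 0 and of the commutator of
    \<open>\<partial>\<^sub>y\<close> and X, which is b_y times
    \<open>\<partial>\<^sub>y\<close>.\<close>
  have w1: "pd1 w p + b p * (1 - k) = w p * pd2 b p" if p: "p \<in> D" for p
  proof -
    have "dir_deriv v (\<lambda>p. w p * pd2 h p) p = dir_deriv v h p" for v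
      by (rule dir_deriv_cong[OF open_D p]) (simp add: w)
    then have D: "dir_deriv v w p * pd2 h p + w p * dir_deriv v (pd2 h) p = dir_deriv v h p" for v
      using dif p by (simp add: dir_deriv_arith)
    have "(pd1 w p + b p * (1 - k) - w p * pd2 b p) * pd2 h p = 0"
      using D[of "(1, 0)"] D[of "(0, 1)"] hx[OF p] b2[OF p] w2[OF p] pd12_h[OF p] unfolding H12_def by algebra
    then show ?thesis using hy_nonzero[OF p] by simp
  qed
  \<comment> \<open>The y-derivative of the previous equation, with w_y constant and hence w_xy = 0,
    leaves w b_yy = 0.\<close>
  have b22: "pd2 (pd2 b) p = 0" if p: "p \<in> D" for p
  proof -
    have pb: "pd2 b differentiable at p" "pd1 w differentiable at p"
      using smooth_on_differentiable[OF smooth_on_dir_deriv[OF smooth_b] open_D p]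
        smooth_on_differentiable[OF smooth_on_dir_deriv[OF smooth_w] open_D p] by blast+
    have "pd2 (\<lambda>p. pd1 w p + b p * (1 - k)) p = pd2 (\<lambda>p. w p * pd2 b p) p"
      by (rule dir_deriv_cong[OF open_D p]) (rule w1)
    then have "pd2 (pd1 w) p + pd2 b p * (1 - k) = (1 - k) * pd2 b p + w p * pd2 (pd2 b) p"
      using dif p pb w2[OF p] by (simp add: dir_deriv_arith dir_deriv_const)
    moreover have "pd2 (pd1 w) p = pd1 (pd2 w) p"
      using dir_deriv_commute[OF smooth_w open_D p] .
    moreover have "pd1 (pd2 w) p = pd1 (\<lambda>_. 1 - k) p"
      by (rule dir_deriv_cong[OF open_D p]) (rule w2)
    ultimately show ?thesis using w0[OF p] by (simp add: dir_deriv_const)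
  qed
  define \<kappa> where "\<kappa> = (H12 p0)\<^sup>2 / (h p0 * (pd2 h p0)\<^sup>2)"
  have \<kappa>: "pd2 b p * pd2 b p = \<kappa> * h p" if p: "p \<in> D" for p
  proof -
    have "(H12 p)\<^sup>2 = \<kappa> * (h p * (pd2 h p)\<^sup>2)"
      using invariants(2)[OF p p0] hy_nonzero[OF p0] h_nonzero[OF p0] by (simp add: \<kappa>_def field_simps)
    then have "(pd2 b p * pd2 b p - \<kappa> * h p) * (pd2 h p)\<^sup>2 = 0" using b2[OF p] by algebra
    then show ?thesis using hy_nonzero[OF p] by simp
  qed
  have "\<kappa> = 0"
  proof -
    have pb: "pd2 b differentiable at p0"
      using smooth_on_differentiable[OF smooth_on_dir_deriv[OF smooth_b] open_D p0] .
    have "pd2 (\<lambda>p. pd2 b p * pd2 b p) p0 = pd2 (\<lambda>p. \<kappa> * h p) p0"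
      by (rule dir_deriv_cong[OF open_D p0]) (rule \<kappa>)
    then have "0 = \<kappa> * pd2 h p0"
      using dif p0 pb b22[OF p0] by (simp add: dir_deriv_arith dir_deriv_const)
    then show ?thesis using hy_nonzero[OF p0] by simp
  qed
  then have b2_0: "pd2 b p = 0" if "p \<in> D" for p using \<kappa>[OF that] by simp
  define M where "M = - H11 p0 / (h p0)\<^sup>2"
  \<comment> \<open>Once b_y = 0, \<open>H11\<close> equals -(b_x + F_y) h_y, so the third invariant
    can be solved for F_y.\<close>
  have Fy: "pd2 F p = - pd1 b p + M * (h p * w p)" if p: "p \<in> D" for p
  proof -
    have "H11 p = - M * (h p)\<^sup>2"
      using invariants(3)[OF p p0] h_nonzero[OF p0] by (simp add: M_def field_simps)
    then have "(pd2 F p + pd1 b p - M * (h p * w p)) * pd2 h p = 0"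
      using b_eq[OF p, of "(1, 0)"] b2[OF p] b2_0[OF p] w[OF p] pd12_h[OF p]
      unfolding H11_def H12_def by algebra
    then show ?thesis using hy_nonzero[OF p] by simp
  qed
  \<comment> \<open>Differentiating the formula for F_y in y gives h on the left and M (2 - k) h on
    the right, because (h w)_y = h + (1 - k) h and b_x does not depend on y.\<close>
  have M: "M * (2 - k) = 1"
  proof -
    have pb: "pd1 b differentiable at p0"
      using smooth_on_differentiable[OF smooth_on_dir_deriv[OF smooth_b] open_D p0] .
    have "h p0 = pd2 (\<lambda>p. M * (h p * w p) - pd1 b p) p0"
      by (rule dir_deriv_cong[OF open_D p0]) (simp add: Fy)
    also have "\<dots> = - pd2 (pd1 b) p0 + M * (pd2 h p0 * w p0 + h p0 * pd2 w p0)"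
      using dif p0 pb by (simp add: dir_deriv_arith dir_deriv_const)
    also have "pd2 (pd1 b) p0 = pd1 (pd2 b) p0" using dir_deriv_commute[OF smooth_b open_D p0] .
    also have "\<dots> = pd1 (\<lambda>_. 0) p0" by (rule dir_deriv_cong[OF open_D p0]) (rule b2_0)
    finally have "h p0 * (M * (2 - k)) = h p0 * 1"
      using w[OF p0] w2[OF p0] by (simp add: dir_deriv_const algebra_simps)
    then show ?thesis using h_nonzero[OF p0] by (simp only: mult_cancel_left) simp
  qed
  have k2: "k \<noteq> 2" using M by auto
  then have M': "M = 1 / (2 - k)" using M by (simp add: eq_divide_eq)
  have "pd1 w p = - (1 - k) * b p" if "p \<in> D" for p
    using w1[OF that] b2_0[OF that] by (simp add: algebra_simps)
  moreover have "pd2 F p = - pd1 b p + h p * w p / (2 - k)" if "p \<in> D" for p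
    using Fy[OF that] by (simp add: M')
  moreover note k2
  ultimately show thesis using that w2 b2_0 by blast
qed

text \<open>The shift \<open>\<eta>\<close> straightens the integral curves of \<open>X\<close>.\<close>

lemma wave_profile:
  obtains k \<eta> \<eta>' \<eta>'' w0 where "k \<noteq> 2" "smooth_on I \<eta>"
    "\<And>x. x \<in> I \<Longrightarrow> (\<eta> has_real_derivative \<eta>' x) (at x)"
    "\<And>x. x \<in> I \<Longrightarrow> (\<eta>' has_real_derivative \<eta>'' x) (at x)"
    "\<And>x y. x \<in> I \<Longrightarrow> y \<in> J \<Longrightarrow> w (x, y) = (1 - k) * (y + \<eta> x) + w0"
    "\<And>x y. x \<in> I \<Longrightarrow> y \<in> J \<Longrightarrow> w (x, y) \<noteq> 0"
    "\<And>x y. x \<in> I \<Longrightarrow> y \<in> J \<Longrightarrow> ((\<lambda>y. h (x, y)) has_real_derivative h (x, y) / w (x, y)) (at y)"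
    "\<And>x y. x \<in> I \<Longrightarrow> y \<in> J \<Longrightarrow> ((\<lambda>x. h (x, y)) has_real_derivative \<eta>' x * h (x, y) / w (x, y)) (at x)"
    "\<And>x y. x \<in> I \<Longrightarrow> y \<in> J \<Longrightarrow>
      (f x has_real_derivative \<eta>'' x + h (x, y) * w (x, y) / (2 - k)) (at y)"
proof -
  obtain k where k: "k \<noteq> 2" and w2: "\<And>p. p \<in> D \<Longrightarrow> pd2 w p = 1 - k"
    and w1: "\<And>p. p \<in> D \<Longrightarrow> pd1 w p = - (1 - k) * b p" and b2: "\<And>p. p \<in> D \<Longrightarrow> pd2 b p = 0"
    and Fy: "\<And>p. p \<in> D \<Longrightarrow> pd2 F p = - pd1 b p + h p * w p / (2 - k)"
    by (rule wave_equations) (rule that; assumption)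
  obtain x0 y0 where x0: "x0 \<in> I" and y0: "y0 \<in> J" using I J by (auto simp: open_interval_def)
  note dif = smooth_on_differentiable[OF smooth_b open_D] smooth_on_differentiable[OF smooth_w open_D]
  have dpb: "pd1 b differentiable at p" if "p \<in> D" for p
    using smooth_on_differentiable[OF smooth_on_dir_deriv[OF smooth_b] open_D that] .
  have b: "b (x, y) = b (x, y0)" if "x \<in> I" "y \<in> J" for x y
    using that y0 by (intro constant_in_y[OF dif(1) b2]) auto
  have "pd2 (pd1 b) p = 0" if p: "p \<in> D" for p
  proof -
    have "pd2 (pd1 b) p = pd1 (pd2 b) p" using dir_deriv_commute[OF smooth_b open_D p] .
    also have "\<dots> = pd1 (\<lambda>_. 0) p" by (rule dir_deriv_cong[OF open_D p]) (rule b2)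
    finally show ?thesis by (simp add: dir_deriv_const)
  qed
  then have pb: "pd1 b (x, y) = pd1 b (x, y0)" if "x \<in> I" "y \<in> J" for x y
    using that y0 by (intro constant_in_y[OF dpb]) auto
  \<comment> \<open>Evaluating at \<open>y0\<close> is harmless, since b and b_x do not depend on
    y.\<close>
  define \<eta>' where "\<eta>' x = - b (x, y0)" for x
  define \<eta>'' where "\<eta>'' x = - pd1 b (x, y0)" for x
  have s\<eta>': "smooth_on I \<eta>'"
    unfolding \<eta>'_def by (intro smooth_intros open_I smooth_section1[OF smooth_b y0])
  have \<eta>': "(\<eta>' has_real_derivative \<eta>'' x) (at x)" if "x \<in> I" for x
    unfolding \<eta>'_def[abs_def] \<eta>''_def
    using that y0 by (intro DERIV_minus sections(1) dif(1)) auto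
  obtain \<eta> where \<eta>: "\<And>x. x \<in> I \<Longrightarrow> (\<eta> has_real_derivative \<eta>' x) (at x)"
    using open_interval_antiderivative[OF I smooth_on_continuous[OF s\<eta>' open_I]]
    unfolding has_real_derivative_iff_has_vector_derivative by blast
  have s\<eta>: "smooth_on I \<eta>" using smooth_on_antiderivative[OF s\<eta>' open_I \<eta>] .
  define w0 where "w0 = w (x0, y0) - (1 - k) * (y0 + \<eta> x0)"
  have weq: "w (x, y) = (1 - k) * (y + \<eta> x) + w0" if "x \<in> I" "y \<in> J" for x y
  proof -
    have "((\<lambda>x. w (x, y0) - (1 - k) * (y0 + \<eta> x)) has_real_derivative 0) (at x)" if "x \<in> I" for x
      using sections(1)[OF dif(2), of x y0] \<eta>[OF that] w1[of "(x, y0)"] that y0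
      by (auto intro!: derivative_eq_intros simp: \<eta>'_def algebra_simps)
    from zero_derivative_constant[OF interval_I this \<open>x \<in> I\<close> x0]
    have "w (x, y0) = (1 - k) * (y0 + \<eta> x) + w0" by (simp add: w0_def)
    moreover have "((\<lambda>y. w (x, y) - (1 - k) * (y + \<eta> x)) has_real_derivative 0) (at y)" if "y \<in> J" for y
      using sections(2)[OF dif(2), of x y] w2[of "(x, y)"] that \<open>x \<in> I\<close>
      by (auto intro!: derivative_eq_intros)
    from zero_derivative_constant[OF interval_J this \<open>y \<in> J\<close> y0]
    have "w (x, y) - (1 - k) * (y + \<eta> x) = w (x, y0) - (1 - k) * (y0 + \<eta> x)" .
    ultimately show ?thesis by simp
  qed
  show thesis
  proof (rule that[OF k s\<eta> \<eta> \<eta>' weq])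
    fix x y assume x: "x \<in> I" and y: "y \<in> J"
    then have p: "(x, y) \<in> D" by simp
    show "w (x, y) \<noteq> 0" using h_nonzero[OF p] hy_nonzero[OF p] by (simp add: w_def)
    have hw: "h (x, y) / w (x, y) = pd2 h (x, y)" using h_nonzero[OF p] by (simp add: w_def)
    show "((\<lambda>y. h (x, y)) has_real_derivative h (x, y) / w (x, y)) (at y)"
      unfolding hw by (rule sections(2)[OF differentiable_iterated(4)[OF p]])
    have "\<eta>' x * h (x, y) / w (x, y) = pd1 h (x, y)"
      unfolding times_divide_eq_right[symmetric] hw using b[OF x y] hy_nonzero[OF p]
      by (simp add: \<eta>'_def b_def[of "(x, y)"] flip: b[OF x y])
    then show "((\<lambda>x. h (x, y)) has_real_derivative \<eta>' x * h (x, y) / w (x, y)) (at x)"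
      using sections(1)[OF differentiable_iterated(4)[OF p]] by simp
    have "\<eta>'' x + h (x, y) * w (x, y) / (2 - k) = pd2 F (x, y)"
      using Fy[OF p] pb[OF x y] by (simp add: \<eta>''_def)
    then show "(f x has_real_derivative \<eta>'' x + h (x, y) * w (x, y) / (2 - k)) (at y)"
      using sections(2)[OF differentiable_iterated(1)[OF p]] by simp
  qed
qed

text \<open>It is enough to know f_y: integration in y leaves a function \<open>\<gamma>\<close> of
  x, evaluated at a base point. Smoothness of \<open>\<gamma>\<close> reduces to that of the
  composite in \<open>s\<phi>\<close>, which is checked for each model separately.\<close>

lemma locally_isometric_model:
  assumes \<eta>: "smooth_on I \<eta>" "\<And>x. x \<in> I \<Longrightarrow> (\<eta> has_real_derivative \<eta>' x) (at x)"
      "\<And>x. x \<in> I \<Longrightarrow> (\<eta>' has_real_derivative \<eta>'' x) (at x)"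
    and A: "A \<noteq> 0" and \<sigma>: "\<sigma>\<^sup>2 = (1::real)"
    and J': "\<And>x y. x \<in> I \<Longrightarrow> y \<in> J \<Longrightarrow> \<sigma> * (y + \<eta> x) \<in> J'"
    and fy: "\<And>x y. x \<in> I \<Longrightarrow> y \<in> J \<Longrightarrow> (f x has_real_derivative \<eta>'' x + A * (\<sigma> * \<phi>' (\<sigma> * (y + \<eta> x)))) (at y)"
    and \<phi>: "\<And>z. z \<in> J' \<Longrightarrow> (\<phi> has_real_derivative \<phi>' z) (at z)"
    and s\<phi>: "\<And>y. y \<in> J \<Longrightarrow> smooth_on I (\<lambda>x. A * \<phi> (\<sigma> * (y + \<eta> x)))"
  shows "\<exists>s\<in>{1, -1}. locally_isometric (manifold_f I J f) (manifold_f UNIV J' (\<lambda>x y. s * \<phi> y))"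
proof -
  obtain y0 where y0: "y0 \<in> J" using J by (auto simp: open_interval_def)
  define \<gamma> where "\<gamma> x = F (x, y0) - \<eta>'' x * y0 - A * \<phi> (\<sigma> * (y0 + \<eta> x))" for x
  have s\<eta>': "smooth_on I \<eta>'" using smooth_on_real_deriv[OF \<eta>(1) open_I \<eta>(2)] .
  have s\<eta>'': "smooth_on I \<eta>''" using smooth_on_real_deriv[OF s\<eta>' open_I \<eta>(3)] .
  have "smooth_on I \<gamma>"
    unfolding \<gamma>_def
    by (intro smooth_on_diff smooth_on_mult smooth_on_const open_I s\<eta>'' s\<phi> y0 smooth_section1[OF smooth_iterated(1) y0])
  moreover have "f x y = \<eta>'' x * y + A * \<phi> (\<sigma> * (y + \<eta> x)) + \<gamma> x" if x: "x \<in> I" and y: "y \<in> J" for x y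
  proof -
    have "((\<lambda>y. f x y - \<eta>'' x * y - A * \<phi> (\<sigma> * (y + \<eta> x))) has_real_derivative 0) (at y)" if y: "y \<in> J" for y
    proof -
      have "((\<lambda>y. \<sigma> * (y + \<eta> x)) has_real_derivative \<sigma>) (at y)"
        by (auto intro!: derivative_eq_intros)
      from DERIV_chain2[OF \<phi>[OF J'[OF x y]] this]
      show ?thesis using fy[OF x y] by (auto intro!: derivative_eq_intros)
    qed
    from zero_derivative_constant[OF interval_J this y y0] show ?thesis by (simp add: \<gamma>_def)
  qed
  ultimately show ?thesis
    using locally_isometricI[OF I open_J \<eta> _ A \<sigma> J'] by blast
qed

text \<open>If k = 1 then w is constant and h is exponential. Otherwise h is a power \<nu> = 1 / (1
  - k) of a shifted variable, and two integrations give a logarithm for \<nu> = -2 and else the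
  power \<epsilon> = \<nu> + 2. The exponent 2 would need \<nu> = 0, and 1 would need k = 2.\<close>

lemma locally_isometric_classification:
  "(\<exists>s\<in>{1, -1}. \<exists>a. a \<noteq> 0 \<and>
     locally_isometric (manifold_f I J f) (manifold_f UNIV UNIV (\<lambda>x y. s * exp (a * y)))) \<or>
   (\<exists>s\<in>{1, -1}. locally_isometric (manifold_f I J f) (manifold_f UNIV {0<..} (\<lambda>x y. s * ln y))) \<or>
   (\<exists>s\<in>{1, -1}. \<exists>\<epsilon>. \<epsilon> \<notin> {0, 1, 2} \<and>
     locally_isometric (manifold_f I J f) (manifold_f UNIV {0<..} (\<lambda>x y. s * y powr \<epsilon>)))"
proof -
  obtain k \<eta>\<^sub>0 \<eta>' \<eta>'' w0 where k: "k \<noteq> 2" and s\<eta>\<^sub>0: "smooth_on I \<eta>\<^sub>0"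
    and \<eta>\<^sub>0: "\<And>x. x \<in> I \<Longrightarrow> (\<eta>\<^sub>0 has_real_derivative \<eta>' x) (at x)"
    and \<eta>': "\<And>x. x \<in> I \<Longrightarrow> (\<eta>' has_real_derivative \<eta>'' x) (at x)"
    and w: "\<And>x y. x \<in> I \<Longrightarrow> y \<in> J \<Longrightarrow> w (x, y) = (1 - k) * (y + \<eta>\<^sub>0 x) + w0"
    and wnz: "\<And>x y. x \<in> I \<Longrightarrow> y \<in> J \<Longrightarrow> w (x, y) \<noteq> 0"
    and hy: "\<And>x y. x \<in> I \<Longrightarrow> y \<in> J \<Longrightarrow> ((\<lambda>y. h (x, y)) has_real_derivative h (x, y) / w (x, y)) (at y)"
    and hx: "\<And>x y. x \<in> I \<Longrightarrow> y \<in> J \<Longrightarrow> ((\<lambda>x. h (x, y)) has_real_derivative \<eta>' x * h (x, y) / w (x, y)) (at x)"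
    and fy: "\<And>x y. x \<in> I \<Longrightarrow> y \<in> J \<Longrightarrow> (f x has_real_derivative \<eta>'' x + h (x, y) * w (x, y) / (2 - k)) (at y)"
    by (rule wave_profile) (rule that; assumption)
  obtain x0 y0 where x0: "x0 \<in> I" and y0: "y0 \<in> J" using I J by (auto simp: open_interval_def)
  have const: "C (x, y) = C (x0, y0)" if "x \<in> I" "y \<in> J"
    "\<And>x y. x \<in> I \<Longrightarrow> y \<in> J \<Longrightarrow> ((\<lambda>x. C (x, y)) has_real_derivative 0) (at x)"
    "\<And>x y. x \<in> I \<Longrightarrow> y \<in> J \<Longrightarrow> ((\<lambda>y. C (x, y)) has_real_derivative 0) (at y)"
    for C :: "real \<times> real \<Rightarrow> real" and x y
    using zero_derivative_constant[OF interval_I that(3)[OF _ y0] that(1) x0]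
      zero_derivative_constant[OF interval_J that(4)[OF that(1)] that(2) y0] that by simp
  show ?thesis
  proof (cases "k = 1")
    case True
    then have w: "w (x, y) = w0" if "x \<in> I" "y \<in> J" for x y using w that by simp
    then have w0: "w0 \<noteq> 0" using wnz x0 y0 by metis
    define a where "a = 1 / w0"
    have a: "a \<noteq> 0" using w0 by (simp add: a_def)
    \<comment> \<open>Multiplying h by the reciprocal of the expected solution gives a function with
      both partial derivatives zero.\<close>
    define C where "C p = h p * exp (- a * (snd p + \<eta>\<^sub>0 (fst p)))" for p
    define A where "A = C (x0, y0) / a\<^sup>2"
    have "C (x, y) = C (x0, y0)" if "x \<in> I" "y \<in> J" for x y
    proof (rule const[OF that])
      show "((\<lambda>x. C (x, y)) has_real_derivative 0) (at x)" if "x \<in> I" "y \<in> J" for x y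
        unfolding C_def using hx[OF that] \<eta>\<^sub>0[OF that(1)] w[OF that] w0
        by (auto intro!: derivative_eq_intros simp: a_def)
      show "((\<lambda>y. C (x, y)) has_real_derivative 0) (at y)" if "x \<in> I" "y \<in> J" for x y
        unfolding C_def using hy[OF that] w[OF that] w0
        by (auto intro!: derivative_eq_intros simp: a_def)
    qed
    then have "h (x, y) * (exp (- a * (y + \<eta>\<^sub>0 x)) * exp (a * (y + \<eta>\<^sub>0 x))) = A * a\<^sup>2 * exp (a * (y + \<eta>\<^sub>0 x))"
      if "x \<in> I" "y \<in> J" for x y
      using that a by (simp add: A_def C_def mult.assoc[symmetric])
    then have h: "h (x, y) = A * a\<^sup>2 * exp (a * (y + \<eta>\<^sub>0 x))" if "x \<in> I" "y \<in> J" for x y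
      using that by (simp flip: exp_add)
    have A: "A \<noteq> 0" using h_nonzero[of "(x0, y0)"] x0 y0 a by (simp add: A_def C_def)
    have "\<exists>s\<in>{1, -1}. locally_isometric (manifold_f I J f) (manifold_f UNIV UNIV (\<lambda>x y. s * exp (a * y)))"
    proof (rule locally_isometric_model[OF s\<eta>\<^sub>0 \<eta>\<^sub>0 \<eta>' A, where \<sigma> = 1 and \<phi>' = "\<lambda>z. a * exp (a * z)"])
      show "(f x has_real_derivative \<eta>'' x + A * (1 * (a * exp (a * (1 * (y + \<eta>\<^sub>0 x)))))) (at y)"
        if "x \<in> I" "y \<in> J" for x y
        using fy[OF that] a unfolding h[OF that] w[OF that] True a_def
        by (simp add: power2_eq_square mult.assoc)
      show "((\<lambda>z. exp (a * z)) has_real_derivative a * exp (a * z)) (at z)" for z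
        by (auto intro!: derivative_eq_intros)
      show "smooth_on I (\<lambda>x. A * exp (a * (1 * (y + \<eta>\<^sub>0 x))))" if y: "y \<in> J" for y
      proof (rule smooth_on_cong[OF open_I])
        show "smooth_on I (\<lambda>x. (1 / a\<^sup>2) * h (x, y))"
          by (intro smooth_on_mult smooth_on_const open_I smooth_section1[OF smooth_iterated(4) y])
      qed (use h y a in auto)
    qed auto
    then show ?thesis using a by blast
  next
    case False
    define \<nu> where "\<nu> = 1 / (1 - k)"
    have \<nu>: "\<nu> \<noteq> 0" "\<nu> + 1 \<noteq> 0" "1 - k = 1 / \<nu>" "2 - k = (\<nu> + 1) / \<nu>"
      using False k by (auto simp: \<nu>_def field_simps)
    \<comment> \<open>The additional constant absorbs \<open>w0\<close>, so that w becomes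
      homogeneous in y + \<eta> x.\<close>
    define \<eta> where "\<eta> x = \<eta>\<^sub>0 x + \<nu> * w0" for x
    have s\<eta>: "smooth_on I \<eta>" unfolding \<eta>_def by (intro smooth_intros open_I s\<eta>\<^sub>0)
    have \<eta>: "(\<eta> has_real_derivative \<eta>' x) (at x)" if "x \<in> I" for x
      unfolding \<eta>_def[abs_def] using \<eta>\<^sub>0[OF that] by (auto intro!: derivative_eq_intros)
    have w: "w (x, y) = (y + \<eta> x) / \<nu>" if "x \<in> I" "y \<in> J" for x y
      using w[OF that] \<nu> by (simp add: \<eta>_def field_simps)
    \<comment> \<open>As w has no zeros on a connected domain, y + \<eta> x has a fixed sign, and
      reflecting y by \<sigma> makes the variable positive, as the models require.\<close>
    define \<sigma> where "\<sigma> = sgn (y0 + \<eta> x0)"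
    have nz: "y + \<eta> x \<noteq> 0" if "x \<in> I" "y \<in> J" for x y using wnz[OF that] w[OF that] by simp
    have \<sigma>: "\<sigma>\<^sup>2 = 1" "\<sigma> * \<sigma> = 1" using nz[OF x0 y0] by (auto simp: \<sigma>_def power2_eq_square sgn_if)
    define z where "z x y = \<sigma> * (y + \<eta> x)" for x y
    have z: "z x y > 0" if "x \<in> I" "y \<in> J" for x y
    proof -
      have "w (x, y) * w (x0, y0) > 0"
        using that x0 y0 by (intro connected_same_sign[OF connected_D smooth_on_continuous[OF smooth_w open_D]])
          (auto simp: wnz)
      then have "(y + \<eta> x) * (y0 + \<eta> x0) > 0"
        using w[OF that] w[OF x0 y0] \<nu>(1) by (auto simp: zero_less_mult_iff zero_less_divide_iff)
      then show ?thesis by (auto simp: z_def \<sigma>_def sgn_if zero_less_mult_iff)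
    qed
    have wz: "w (x, y) = \<sigma> * z x y / \<nu>" if "x \<in> I" "y \<in> J" for x y
      using w[OF that] \<sigma>(2) by (simp add: z_def mult.assoc[symmetric])
    have zx: "((\<lambda>x. z x y) has_real_derivative \<sigma> * \<eta>' x) (at x)" if "x \<in> I" for x y
      unfolding z_def using \<eta>[OF that] by (auto intro!: derivative_eq_intros)
    have zy: "(z x has_real_derivative \<sigma>) (at y)" for x y
      unfolding z_def by (auto intro!: derivative_eq_intros)
    define C where "C p = h p * z (fst p) (snd p) powr (- \<nu>)" for p
    define c where "c = C (x0, y0)"
    \<comment> \<open>The derivatives of C in x and in y have the same shape, with \<open>m\<close>
      equal to \<open>\<eta>' x\<close> and to 1 respectively.\<close>
    have key: "m * H / (\<sigma> * Z / \<nu>) * Z powr (- \<nu>) + H * (- \<nu> * Z powr (- \<nu> - 1) * (\<sigma> * m)) = 0"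
      if "Z > 0" for m H Z :: real
    proof -
      have "Z powr (- \<nu>) = Z * Z powr (- \<nu> - 1)" using that by (simp add: powr_mult_base)
      moreover have "\<sigma> = 1 \<or> \<sigma> = - 1" using \<sigma>(1) power2_eq_1_iff by blast
      ultimately show ?thesis using that \<nu>(1) by (auto simp: field_simps)
    qed
    have "C (x, y) = c" if "x \<in> I" "y \<in> J" for x y
      unfolding c_def
    proof (rule const[OF that])
      show "((\<lambda>x. C (x, y)) has_real_derivative 0) (at x)" if "x \<in> I" "y \<in> J" for x y
      proof -
        have "((\<lambda>x. z x y powr (- \<nu>)) has_real_derivative - \<nu> * z x y powr (- \<nu> - 1) * (\<sigma> * \<eta>' x)) (at x)"
          using DERIV_chain2[OF has_real_derivative_powr[OF z[OF that]] zx[OF that(1)]] .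
        from DERIV_mult[OF hx[OF that] this] show ?thesis
          unfolding C_def wz[OF that] using key[OF z[OF that], of "\<eta>' x" "h (x, y)"] by (simp add: mult.commute)
      qed
      show "((\<lambda>y. C (x, y)) has_real_derivative 0) (at y)" if "x \<in> I" "y \<in> J" for x y
      proof -
        have "((\<lambda>y. z x y powr (- \<nu>)) has_real_derivative - \<nu> * z x y powr (- \<nu> - 1) * \<sigma>) (at y)"
          using DERIV_chain2[OF has_real_derivative_powr[OF z[OF that]] zy] .
        from DERIV_mult[OF hy[OF that] this] show ?thesis
          unfolding C_def wz[OF that] using key[OF z[OF that], of 1 "h (x, y)"] by (simp add: mult.commute)
      qed
    qed
    then have "h (x, y) / z x y powr \<nu> = c" if "x \<in> I" "y \<in> J" for x y
      using that by (simp add: C_def powr_minus divide_inverse)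
    then have h: "h (x, y) = c * z x y powr \<nu>" if "x \<in> I" "y \<in> J" for x y
      using that z[OF that] by (metis nonzero_eq_divide_eq powr_eq_0_iff less_irrefl)
    have c: "c \<noteq> 0" using h_nonzero[of "(x0, y0)"] x0 y0 z[OF x0 y0] by (simp add: c_def C_def)
    have fy: "(f x has_real_derivative \<eta>'' x + c / (\<nu> + 1) * (\<sigma> * z x y powr (\<nu> + 1))) (at y)"
      if "x \<in> I" "y \<in> J" for x y
    proof -
      have "z x y powr (\<nu> + 1) = z x y powr \<nu> * z x y" using z[OF that] by (simp add: powr_add)
      then have "h (x, y) * w (x, y) / (2 - k) = c / (\<nu> + 1) * (\<sigma> * z x y powr (\<nu> + 1))"
        unfolding h[OF that] wz[OF that] \<nu>(4) using \<nu>(1,2) by (simp add: field_simps)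
      then show ?thesis using fy[OF that] by simp
    qed
    show ?thesis
    proof (cases "\<nu> = -2")
      case True
      have "\<exists>s\<in>{1, -1}. locally_isometric (manifold_f I J f) (manifold_f UNIV {0<..} (\<lambda>x y. s * ln y))"
      proof (rule locally_isometric_model[OF s\<eta> \<eta> \<eta>' _ \<sigma>(1), where A = "- c" and \<phi>' = "\<lambda>z. 1 / z"])
        show "\<sigma> * (y + \<eta> x) \<in> {0<..}" if "x \<in> I" "y \<in> J" for x y using z[OF that] by (simp add: z_def)
        show "(f x has_real_derivative \<eta>'' x + - c * (\<sigma> * (1 / (\<sigma> * (y + \<eta> x))))) (at y)"
          if "x \<in> I" "y \<in> J" for x y
        proof -
          have "z x y powr (\<nu> + 1) = 1 / z x y"
            using z[OF that] by (simp add: True powr_minus divide_inverse)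
          moreover have "c / (\<nu> + 1) = - c" by (simp add: True)
          ultimately show ?thesis using fy[OF that] unfolding z_def by metis
        qed
        show "(ln has_real_derivative 1 / z) (at z)" if "z \<in> {0<..}" for z :: real
          using that DERIV_ln[of z] by (simp add: divide_inverse)
        \<comment> \<open>Here smoothness comes from the derivative in x, a quotient of smooth
          functions.\<close>
        show "smooth_on I (\<lambda>x. - c * ln (\<sigma> * (y + \<eta> x)))" if y: "y \<in> J" for y
        proof (rule smooth_on_antiderivative[OF _ open_I])
          have "((\<lambda>x. ln (z x y)) has_real_derivative \<sigma> * \<eta>' x / z x y) (at x)" if "x \<in> I" for x
            using DERIV_chain2[OF DERIV_ln[OF z[OF that y]] zx[OF that, of y]] by (simp add: divide_inverse mult.commute)
          then show "((\<lambda>x. - c * ln (\<sigma> * (y + \<eta> x))) has_real_derivative - c * (\<sigma> * \<eta>' x / z x y)) (at x)"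
            if "x \<in> I" for x
            using that DERIV_cmult unfolding z_def by blast
          have "z x y \<noteq> 0" if "x \<in> I" for x using z[OF that y] by simp
          then show "smooth_on I (\<lambda>x. - c * (\<sigma> * \<eta>' x / z x y))"
            unfolding z_def
            by (intro smooth_on_mult smooth_on_divide smooth_on_add smooth_on_const open_I s\<eta>
                smooth_on_real_deriv[OF s\<eta> open_I \<eta>])
        qed
      qed (use c in auto)
      then show ?thesis by blast
    next
      case False
      define \<epsilon> where "\<epsilon> = \<nu> + 2"
      have \<epsilon>: "\<epsilon> \<notin> {0, 1, 2}" using False \<nu> by (auto simp: \<epsilon>_def)
      define A where "A = c / ((\<nu> + 1) * \<epsilon>)"
      have A: "A \<noteq> 0" using c \<nu> \<epsilon> by (simp add: A_def)
      have "\<exists>s\<in>{1, -1}. locally_isometric (manifold_f I J f) (manifold_f UNIV {0<..} (\<lambda>x y. s * y powr \<epsilon>))"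
      proof (rule locally_isometric_model[OF s\<eta> \<eta> \<eta>' A \<sigma>(1), where \<phi>' = "\<lambda>z. \<epsilon> * z powr (\<epsilon> - 1)"])
        show "\<sigma> * (y + \<eta> x) \<in> {0<..}" if "x \<in> I" "y \<in> J" for x y using z[OF that] by (simp add: z_def)
        show "(f x has_real_derivative \<eta>'' x + A * (\<sigma> * (\<epsilon> * (\<sigma> * (y + \<eta> x)) powr (\<epsilon> - 1)))) (at y)"
          if "x \<in> I" "y \<in> J" for x y
        proof -
          have "A * (\<sigma> * (\<epsilon> * (\<sigma> * (y + \<eta> x)) powr (\<epsilon> - 1))) = c / (\<nu> + 1) * (\<sigma> * z x y powr (\<nu> + 1))"
            using \<epsilon> by (simp add: A_def z_def \<epsilon>_def add.commute[of 1 \<nu>])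
          then show ?thesis using fy[OF that] by simp
        qed
        show "((\<lambda>z. z powr \<epsilon>) has_real_derivative \<epsilon> * z powr (\<epsilon> - 1)) (at z)" if "z \<in> {0<..}" for z :: real
          using that has_real_derivative_powr by simp
        show "smooth_on I (\<lambda>x. A * (\<sigma> * (y + \<eta> x)) powr \<epsilon>)" if y: "y \<in> J" for y
        proof (rule smooth_on_cong[OF open_I])
          \<comment> \<open>The power is expressed through h, which is a multiple of z^\<nu>, times
            z^2, where the sign \<sigma> disappears.\<close>
          show "smooth_on I (\<lambda>x. (1 / ((\<nu> + 1) * \<epsilon>)) * (h (x, y) * (y + \<eta> x)\<^sup>2))"
            by (intro smooth_on_mult smooth_on_power smooth_on_add smooth_on_const open_I s\<eta>
                smooth_section1[OF smooth_iterated(4) y])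
          fix x assume x: "x \<in> I"
          have "(y + \<eta> x)\<^sup>2 = (z x y)\<^sup>2" by (simp add: z_def power_mult_distrib \<sigma>)
          moreover have "z x y powr \<nu> * (z x y)\<^sup>2 = z x y powr \<epsilon>"
            using z[OF x y] by (simp add: \<epsilon>_def powr_add)
          ultimately show "(1 / ((\<nu> + 1) * \<epsilon>)) * (h (x, y) * (y + \<eta> x)\<^sup>2) = A * (\<sigma> * (y + \<eta> x)) powr \<epsilon>"
            by (simp add: h[OF x y] A_def mult.assoc) (simp add: z_def)
        qed
      qed
      then show ?thesis using \<epsilon> by blast
    qed
  qed
qed

end

subsection \<open>Isometries of plane waves\<close>

lemma dir_deriv_bounded_linear:
  assumes "bounded_linear l" "T differentiable at p"
  shows "dir_deriv v (\<lambda>p. l (T p)) p = l (dir_deriv v T p)"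
  using dir_deriv_eqI[OF bounded_linear.has_derivative[OF assms(1) has_derivative_dir_deriv[OF assms(2)]]] .

lemma smooth_upto_linear_compose:
  assumes S: "open S" and l: "bounded_linear l" and "smooth_upto n S T"
  shows "smooth_upto n S (\<lambda>p. l (T p))"
  using assms(3)
proof (induction n arbitrary: T)
  case 0
  have "((\<lambda>p. l (T p)) has_derivative (\<lambda>v. l (dir_deriv v T p))) (at p)" if "p \<in> S" for p
    using bounded_linear.has_derivative[OF l smooth_upto_has_derivative[OF 0 S that]] .
  then show ?case
    unfolding smooth_upto_0 differentiable_on_eq_differentiable_at[OF S] differentiable_def by blast
next
  case (Suc n)
  show ?case
    by (rule smooth_upto_SucI[OF S bounded_linear.has_derivative[OF l smooth_upto_has_derivative[OF Suc.prems S]]])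
      (use Suc in \<open>auto simp: smooth_upto_Suc\<close>)
qed

lemma smooth_on_linear_compose:
  "open S \<Longrightarrow> bounded_linear l \<Longrightarrow> smooth_on S T \<Longrightarrow> smooth_on S (\<lambda>p. l (T p))"
  by (simp add: smooth_on_iff_upto smooth_upto_linear_compose)

lemma dir_deriv_commute_vector:
  fixes T :: "'a::euclidean_space \<Rightarrow> 'b::euclidean_space"
  assumes T: "smooth_on S T" and S: "open S" and p: "p \<in> S"
  shows "dir_deriv v (dir_deriv u T) p = dir_deriv u (dir_deriv v T) p"
proof (rule euclidean_eqI)
  fix i :: 'b
  have l: "bounded_linear (\<lambda>x. x \<bullet> i)" by (rule bounded_linear_inner_left)
  have D: "dir_deriv v (dir_deriv u (\<lambda>p. T p \<bullet> i)) p = dir_deriv v (dir_deriv u T) p \<bullet> i" for u v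
  proof -
    have "dir_deriv v (dir_deriv u (\<lambda>p. T p \<bullet> i)) p = dir_deriv v (\<lambda>p. dir_deriv u T p \<bullet> i) p"
      by (rule dir_deriv_cong[OF S p])
        (rule dir_deriv_bounded_linear[OF l smooth_on_differentiable[OF T S]])
    also have "\<dots> = dir_deriv v (dir_deriv u T) p \<bullet> i"
      by (rule dir_deriv_bounded_linear[OF l smooth_on_differentiable[OF smooth_on_dir_deriv[OF T] S p]])
    finally show ?thesis .
  qed
  show "dir_deriv v (dir_deriv u T) p \<bullet> i = dir_deriv u (dir_deriv v T) p \<bullet> i"
    using dir_deriv_commute[OF smooth_on_linear_compose[OF S l T] S p, of v u] by (simp only: D)
qed

text \<open>This is metric compatibility for vector fields \<open>a\<close> and \<open>b\<close>
  along the map \<open>T\<close>: the connection of the target is pulled back, so its first argument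
  is the image of the direction of differentiation.\<close>

lemma dir_deriv_metric_f:
  assumes f: "case_prod f differentiable at (fst (T p), fst (snd (T p)))"
    and T: "(T has_derivative T') (at p)" and a: "(a has_derivative a') (at p)" and b: "(b has_derivative b') (at p)"
  shows "dir_deriv w (\<lambda>p. metric_f f (T p) (a p) (b p)) p =
    metric_f f (T p) (a' w + christoffel (case_prod f) (T p) (T' w) (a p)) (b p) +
    metric_f f (T p) (a p) (b' w + christoffel (case_prod f) (T p) (T' w) (b p))"
proof -
  define q where "q = (fst (T p), fst (snd (T p)))"
  have F: "((\<lambda>p. f (fst (T p)) (fst (snd (T p)))) has_derivative
      (\<lambda>w. fst (T' w) * pd1 (case_prod f) q + fst (snd (T' w)) * pd2 (case_prod f) q)) (at p)"
    using has_derivative_compose[OF T dir_deriv_pullback(1)[OF f]] by (simp add: q_def)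
  have *: "((\<lambda>p. metric_f f (T p) (a p) (b p)) has_derivative (\<lambda>w.
      - 2 * (fst (T' w) * pd1 (case_prod f) q + fst (snd (T' w)) * pd2 (case_prod f) q) * fst (a p) * fst (b p) +
      metric_f f (T p) (a' w) (b p) + metric_f f (T p) (a p) (b' w))) (at p)"
    unfolding metric_f_eq using F a b
    by (auto intro!: derivative_eq_intros simp: algebra_simps)
  show ?thesis
    unfolding dir_deriv_eqI[OF *] by (simp add: metric_f_eq christoffel_def Let_def q_def algebra_simps)
qed

text \<open>Isometries preserve the Levi-Civita connection. The defect \<open>Q\<close> is
  symmetric, and its metric product with images of vectors is skew in the last two slots by metric
  compatibility; a trilinear form with both symmetries is zero.\<close>

lemma isometry_hessian:
  assumes A: "open A" and T: "smooth_on A T"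
    and iso: "\<And>p u v. p \<in> A \<Longrightarrow> metric_f k (T p) (dir_deriv u T p) (dir_deriv v T p) = metric_f f p u v"
    and f: "\<And>p. p \<in> A \<Longrightarrow> case_prod f differentiable at (fst p, fst (snd p))"
    and k: "\<And>p. p \<in> A \<Longrightarrow> case_prod k differentiable at (fst (T p), fst (snd (T p)))"
    and p: "p \<in> A"
  shows "dir_deriv u (dir_deriv v T) p + christoffel (case_prod k) (T p) (dir_deriv u T p) (dir_deriv v T p) =
    dir_deriv (christoffel (case_prod f) p u v) T p"
proof -
  let ?G = "christoffel (case_prod f) p" and ?G' = "christoffel (case_prod k) (T p)"
  let ?D = "\<lambda>v. dir_deriv v T p"
  define Q where "Q u v = dir_deriv u (dir_deriv v T) p + ?G' (?D u) (?D v) - ?D (?G u v)" for u v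
  define B where "B u v w = metric_f k (T p) (Q u v) (?D w)" for u v w
  note add = bilinear_ladd[OF metric_f_bilinear] and sub = bilinear_lsub[OF metric_f_bilinear]
  have lin: "linear ?D"
    using has_derivative_linear[OF smooth_on_has_derivative[OF T A p]] .
  have "Q u v = Q v u" for u v
    using dir_deriv_commute_vector[OF T A p, of u v]
    by (simp add: Q_def christoffel_def Let_def add.commute mult.commute)
  then have s: "B u v w = B v u w" for u v w by (simp add: B_def)
  have sk: "B w u v = - B w v u" for u v w
  proof -
    have DT: "(dir_deriv v T has_derivative (\<lambda>w. dir_deriv w (dir_deriv v T) p)) (at p)" for v
      by (rule smooth_on_has_derivative[OF smooth_on_dir_deriv[OF T] A p])
    have "dir_deriv w (\<lambda>p. metric_f k (T p) (dir_deriv u T p) (dir_deriv v T p)) p =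
        dir_deriv w (\<lambda>p. metric_f f p u v) p"
      by (rule dir_deriv_cong[OF A p]) (rule iso)
    then have "metric_f k (T p) (dir_deriv w (dir_deriv u T) p + ?G' (?D w) (?D u)) (?D v) +
        metric_f k (T p) (?D u) (dir_deriv w (dir_deriv v T) p + ?G' (?D w) (?D v)) =
        metric_f f p (?G w u) v + metric_f f p u (?G w v)"
      unfolding dir_deriv_metric_f[OF k[OF p] smooth_on_has_derivative[OF T A p] DT DT]
      using is_levi_civita_at_christoffel[OF f[OF p]] unfolding is_levi_civita_at_def by metis
    then show ?thesis
      unfolding B_def Q_def sub
      using iso[OF p, of "?G w u" v] iso[OF p, of "?G w v" u]
        metric_f_sym[of k "T p" "?D u"] metric_f_sym[of f p u "?G w v"] by smt
  qed
  have B0: "B u v w = 0" for u v w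
    using s[of u v w] sk[of v u w] s[of v w u] sk[of w v u] s[of w u v] sk[of u w v] by linarith
  have "v = 0" if "?D v = 0" for v
  proof (rule metric_f_nondegenerate)
    show "metric_f f p v w = 0" for w
      using iso[OF p, of v w] that by (simp add: metric_f_eq)
  qed
  then have "surj ?D"
    using lin linear_injective_0 linear_injective_imp_surjective by blast
  have "metric_f k (T p) (Q u v) w = 0" for w
  proof -
    obtain z where "w = ?D z" using \<open>surj ?D\<close> by (meson surjD)
    then show ?thesis using B0[of u v z] by (simp add: B_def)
  qed
  then have "Q u v = 0" by (rule metric_f_nondegenerate)
  then show ?thesis by (simp add: Q_def)
qed

lemma dir_deriv_compose_real:
  assumes "(\<kappa> has_real_derivative \<kappa>') (at (Y p))" "Y differentiable at p"
  shows "(\<lambda>p. \<kappa> (Y p)) differentiable at p" "dir_deriv v (\<lambda>p. \<kappa> (Y p)) p = \<kappa>' * dir_deriv v Y p"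
proof -
  have *: "((\<lambda>p. \<kappa> (Y p)) has_derivative (\<lambda>v. \<kappa>' * dir_deriv v Y p)) (at p)"
    using has_derivative_compose[OF has_derivative_dir_deriv[OF assms(2)], of \<kappa> "(*) \<kappa>'"] assms(1)
    by (simp add: has_field_derivative_def)
  then show "(\<lambda>p. \<kappa> (Y p)) differentiable at p" by (auto simp: differentiable_def)
  show "dir_deriv v (\<lambda>p. \<kappa> (Y p)) p = \<kappa>' * dir_deriv v Y p" using dir_deriv_eqI[OF *] .
qed

context
  fixes k k1 k2 k3 :: "real \<Rightarrow> real" and J :: "real set"
  assumes J: "open J"
    and k1: "\<And>y. y \<in> J \<Longrightarrow> (k has_real_derivative k1 y) (at y)"
    and k2: "\<And>y. y \<in> J \<Longrightarrow> (k1 has_real_derivative k2 y) (at y)"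
    and k3: "\<And>y. y \<in> J \<Longrightarrow> (k2 has_real_derivative k3 y) (at y)"
    and k2_nonzero: "\<And>y. y \<in> J \<Longrightarrow> k2 y \<noteq> 0"
begin

lemma profile_differentiable:
  assumes "y \<in> J"
  shows "case_prod (\<lambda>x y. k y) differentiable at (x, y)"
    "pd1 (case_prod (\<lambda>x y. k y)) (x, y) = 0" "pd2 (case_prod (\<lambda>x y. k y)) (x, y) = k1 y"
proof -
  have "((\<lambda>p :: real \<times> real. k (snd p)) has_derivative (\<lambda>v. k1 y * snd v)) (at (x, y))"
    using has_derivative_compose[OF has_derivative_snd[OF has_derivative_ident], of k "(*) (k1 y)" "(x, y)" UNIV]
      k1[OF assms] by (simp add: has_field_derivative_def)
  then have *: "(case_prod (\<lambda>x y. k y) has_derivative (\<lambda>v. k1 y * snd v)) (at (x, y))"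
    by (simp add: case_prod_beta')
  then show "case_prod (\<lambda>x y. k y) differentiable at (x, y)" unfolding differentiable_def by blast
  show "pd1 (case_prod (\<lambda>x y. k y)) (x, y) = 0" "pd2 (case_prod (\<lambda>x y. k y)) (x, y) = k1 y"
    using dir_deriv_eqI[OF *] by simp_all
qed

text \<open>Write the isometry as (X, Y, ...). The connection equations give its second derivatives,
  and equality of mixed third derivatives forces X_y = X_t = 0 and k''(Y) X_x^2 = k''(y). One more
  y-derivative, with Y_y^2 = 1, allows X_x to be eliminated.\<close>

lemma isometry_profile:
  assumes A: "open A" and AU: "A \<subseteq> UNIV \<times> J \<times> UNIV" and T: "smooth_on A T" and TU: "T ` A \<subseteq> UNIV \<times> J \<times> UNIV"
    and iso: "\<And>p u v. p \<in> A \<Longrightarrow>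
      metric_f (\<lambda>x y. k y) (T p) (dir_deriv u T p) (dir_deriv v T p) = metric_f (\<lambda>x y. k y) p u v"
    and p: "p \<in> A"
  shows "(k3 (fst (snd (T p))))\<^sup>2 * (k2 (fst (snd p)))\<^sup>2 = (k3 (fst (snd p)))\<^sup>2 * (k2 (fst (snd (T p))))\<^sup>2"
proof -
  define X Y where "X p = fst (T p)" and "Y p = fst (snd (T p))" for p
  let ?d1 = "dir_deriv (1, 0, 0)" and ?d2 = "dir_deriv (0, 1, 0)" and ?d3 = "dir_deriv (0, 0, 1)"
  define y where "y p = fst (snd p)" for p :: "real \<times> real \<times> real"
  have blY: "bounded_linear (\<lambda>q :: real \<times> real \<times> real. fst (snd q))"
    by (rule bounded_linear_compose[OF bounded_linear_fst bounded_linear_snd])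
  have sX: "smooth_on A X" and sY: "smooth_on A Y"
    unfolding X_def[abs_def] Y_def[abs_def]
    by (rule smooth_on_linear_compose[OF A bounded_linear_fst T], rule smooth_on_linear_compose[OF A blY T])
  have sy: "smooth_on A y" unfolding y_def[abs_def] by (rule smooth_on_bounded_linear[OF blY])
  have yJ: "y p \<in> J" "Y p \<in> J" if "p \<in> A" for p
    using that AU TU by (auto simp: y_def Y_def)
  note dif = smooth_on_differentiable[OF _ A]
  have dT: "T differentiable at p" "dir_deriv v T differentiable at p" if "p \<in> A" for p v
    using dif[OF T that] dif[OF smooth_on_dir_deriv[OF T] that] .
  have dX: "X differentiable at p" "dir_deriv v X differentiable at p" if "p \<in> A" for p v
    using dif[OF sX that] dif[OF smooth_on_dir_deriv[OF sX] that] .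
  have dY: "Y differentiable at p" "dir_deriv v Y differentiable at p" if "p \<in> A" for p v
    using dif[OF sY that] dif[OF smooth_on_dir_deriv[OF sY] that] .
  have DX: "dir_deriv v X p = fst (dir_deriv v T p)" if "p \<in> A" for v p
    unfolding X_def[abs_def] by (rule dir_deriv_bounded_linear[OF bounded_linear_fst dT(1)[OF that]])
  have DY: "dir_deriv v Y p = fst (snd (dir_deriv v T p))" if "p \<in> A" for v p
    unfolding Y_def[abs_def] by (rule dir_deriv_bounded_linear[OF blY dT(1)[OF that]])
  have DDX: "dir_deriv u (dir_deriv v X) p = fst (dir_deriv u (dir_deriv v T) p)" if p: "p \<in> A" for u v p
  proof -
    have "dir_deriv u (dir_deriv v X) p = dir_deriv u (\<lambda>p. fst (dir_deriv v T p)) p"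
      by (rule dir_deriv_cong[OF A p]) (rule DX)
    then show ?thesis using dir_deriv_bounded_linear[OF bounded_linear_fst dT(2)[OF p]] by simp
  qed
  have DDY: "dir_deriv u (dir_deriv v Y) p = fst (snd (dir_deriv u (dir_deriv v T) p))" if p: "p \<in> A" for u v p
  proof -
    have "dir_deriv u (dir_deriv v Y) p = dir_deriv u (\<lambda>p. fst (snd (dir_deriv v T p))) p"
      by (rule dir_deriv_cong[OF A p]) (rule DY)
    then show ?thesis using dir_deriv_bounded_linear[OF blY dT(2)[OF p]] by simp
  qed
  have dir: "dir_deriv (0, a, b) T p = a *\<^sub>R ?d2 T p + b *\<^sub>R ?d3 T p" if "p \<in> A" for a b p
  proof -
    have l: "linear (\<lambda>v. dir_deriv v T p)"
      using has_derivative_linear[OF smooth_on_has_derivative[OF T A that]] .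
    show ?thesis
      using linear_add[OF l, of "a *\<^sub>R (0, 1, 0)" "b *\<^sub>R (0, 0, 1)"] linear_scale[OF l, of a "(0, 1, 0)"]
        linear_scale[OF l, of b "(0, 0, 1)"] by simp
  qed
  have hess: "dir_deriv u (dir_deriv v X) p =
      k1 (y p) * (fst u * fst v) * ?d2 X p - k1 (y p) * (fst u * fst (snd v) + fst (snd u) * fst v) * ?d3 X p"
    "dir_deriv u (dir_deriv v Y) p + k1 (Y p) * (dir_deriv u X p * dir_deriv v X p) =
      k1 (y p) * (fst u * fst v) * ?d2 Y p - k1 (y p) * (fst u * fst (snd v) + fst (snd u) * fst v) * ?d3 Y p"
    if p: "p \<in> A" for u v p
  proof -
    have dk: "case_prod (\<lambda>x y. k y) differentiable at (fst p, fst (snd p))"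
      "case_prod (\<lambda>x y. k y) differentiable at (fst (T p), fst (snd (T p)))" if "p \<in> A" for p
      using profile_differentiable(1) yJ[OF that] by (auto simp: y_def Y_def)
    have *: "dir_deriv u (dir_deriv v T) p + christoffel (case_prod (\<lambda>x y. k y)) (T p) (dir_deriv u T p) (dir_deriv v T p) =
      dir_deriv (christoffel (case_prod (\<lambda>x y. k y)) p u v) T p"
      by (rule isometry_hessian[OF A T iso dk p])
    have ch: "christoffel (case_prod (\<lambda>x y. k y)) q a b =
        (0, k1 (fst (snd q)) * (fst a * fst b), - k1 (fst (snd q)) * (fst a * fst (snd b) + fst (snd a) * fst b))"
      if "fst (snd q) \<in> J" for q a b
      using profile_differentiable(2,3)[OF that] by (simp add: christoffel_def Let_def)
    note * = trans[OF *[unfolded ch[OF yJ(1)[OF p, unfolded y_def]] ch[OF yJ(2)[OF p, unfolded Y_def]]] dir[OF p]]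
    show "dir_deriv u (dir_deriv v X) p =
      k1 (y p) * (fst u * fst v) * ?d2 X p - k1 (y p) * (fst u * fst (snd v) + fst (snd u) * fst v) * ?d3 X p"
      using arg_cong[OF *, of fst] by (simp add: DDX[OF p] DX[OF p] y_def algebra_simps)
    show "dir_deriv u (dir_deriv v Y) p + k1 (Y p) * (dir_deriv u X p * dir_deriv v X p) =
      k1 (y p) * (fst u * fst v) * ?d2 Y p - k1 (y p) * (fst u * fst (snd v) + fst (snd u) * fst v) * ?d3 Y p"
      using arg_cong[OF *, of "\<lambda>q. fst (snd q)"]
      by (simp add: DDY[OF p] DY[OF p] DX[OF p] y_def Y_def algebra_simps)
  qed
  have zero: "dir_deriv v g p = 0" if "p \<in> A" "\<And>q. q \<in> A \<Longrightarrow> g q = 0" for v p and g :: "_ \<Rightarrow> real"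
    using dir_deriv_cong[OF A that(1), of g "\<lambda>_. 0"] that(2) by (simp add: dir_deriv_const)
  have dy: "?d2 y p = 1" for p
    unfolding y_def[abs_def] using dir_deriv_eqI[OF bounded_linear_imp_has_derivative[OF blY]] by simp
  have k1y: "(\<lambda>p. k1 (y p)) differentiable at p" "?d2 (\<lambda>p. k1 (y p)) p = k2 (y p)"
    "(\<lambda>p. k2 (y p)) differentiable at p" "?d2 (\<lambda>p. k2 (y p)) p = k3 (y p)" if p: "p \<in> A" for p
    using dir_deriv_compose_real[OF k2[OF yJ(1)[OF p]] dif[OF sy p]]
      dir_deriv_compose_real[OF k3[OF yJ(1)[OF p]] dif[OF sy p]] dy by simp_all
  have k1Y: "(\<lambda>p. k1 (Y p)) differentiable at p" "?d2 (\<lambda>p. k1 (Y p)) p = k2 (Y p) * ?d2 Y p"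
    "(\<lambda>p. k2 (Y p)) differentiable at p" "?d2 (\<lambda>p. k2 (Y p)) p = k3 (Y p) * ?d2 Y p" if p: "p \<in> A" for p
    using dir_deriv_compose_real[OF k2[OF yJ(2)[OF p]] dY(1)[OF p]]
      dir_deriv_compose_real[OF k3[OF yJ(2)[OF p]] dY(1)[OF p]] by simp_all
  have X22: "?d2 (?d2 X) p = 0" and X23: "?d2 (?d3 X) p = 0" and X12: "?d1 (?d2 X) p = - k1 (y p) * ?d3 X p"
    and X21: "?d2 (?d1 X) p = - k1 (y p) * ?d3 X p" and X11: "?d1 (?d1 X) p = k1 (y p) * ?d2 X p" if "p \<in> A" for p
    using hess(1)[OF that] by simp_all
  \<comment> \<open>Compare X_yxy, computed from X_xy = -k'(y) X_t and X_yt = 0, with the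
    x-derivative of X_yy = 0.\<close>
  have X3: "?d3 X p = 0" if p: "p \<in> A" for p
  proof -
    have "?d2 (?d1 (?d2 X)) p = ?d2 (\<lambda>p. - 1 * (k1 (y p) * ?d3 X p)) p"
      by (rule dir_deriv_cong[OF A p]) (simp add: X12)
    also have "\<dots> = - (k2 (y p) * ?d3 X p)"
      using dX[OF p] k1y[OF p] X23[OF p]
      by (subst dir_deriv_arith(2)) (auto simp: dir_deriv_arith dir_deriv_const intro!: derivative_intros)
    finally have "k2 (y p) * ?d3 X p = - ?d2 (?d1 (?d2 X)) p" by simp
    also have "?d2 (?d1 (?d2 X)) p = ?d1 (?d2 (?d2 X)) p"
      using dir_deriv_commute[OF smooth_on_dir_deriv[OF sX] A p] .
    also have "\<dots> = 0" using zero[OF p X22] .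
    finally show ?thesis using k2_nonzero[OF yJ(1)[OF p]] by simp
  qed
  \<comment> \<open>The y-derivative of X_xx = k'(y) X_y equals the x-derivative of X_xy, which now
    vanishes.\<close>
  have X2: "?d2 X p = 0" if p: "p \<in> A" for p
  proof -
    have "?d2 (?d1 (?d1 X)) p = ?d2 (\<lambda>p. k1 (y p) * ?d2 X p) p"
      by (rule dir_deriv_cong[OF A p]) (rule X11)
    also have "\<dots> = k2 (y p) * ?d2 X p"
      using dX[OF p] k1y[OF p] X22[OF p] by (simp add: dir_deriv_arith)
    finally have "k2 (y p) * ?d2 X p = ?d2 (?d1 (?d1 X)) p" by simp
    also have "\<dots> = ?d1 (?d2 (?d1 X)) p"
      using dir_deriv_commute[OF smooth_on_dir_deriv[OF sX] A p] .
    also have "\<dots> = 0" by (rule zero[OF p]) (simp add: X21 X3)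
    finally show ?thesis using k2_nonzero[OF yJ(1)[OF p]] by simp
  qed
  have Y2: "(?d2 Y p)\<^sup>2 = 1" and Y3: "?d3 Y p = 0" if p: "p \<in> A" for p
    using iso[OF p, of "(0, 1, 0)" "(0, 1, 0)"] iso[OF p, of "(0, 0, 1)" "(0, 0, 1)"]
      X2[OF p] X3[OF p] DX[OF p] DY[OF p] by (simp_all add: metric_f_eq power2_eq_square)
  have Y22: "?d2 (?d2 Y) p = 0" and Y21: "?d2 (?d1 Y) p = 0"
    and Y11: "?d1 (?d1 Y) p = k1 (y p) * ?d2 Y p - k1 (Y p) * (?d1 X p * ?d1 X p)" if p: "p \<in> A" for p
    using hess(2)[OF p, of "(0, 1, 0)" "(0, 1, 0)"] hess(2)[OF p, of "(0, 1, 0)" "(1, 0, 0)"]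
      hess(2)[OF p, of "(1, 0, 0)" "(1, 0, 0)"] X2[OF p] Y3[OF p] by simp_all
  have X1: "?d2 (?d1 X) p = 0" if "p \<in> A" for p using X21 X3 that by simp
  \<comment> \<open>The same comparison for Y leaves a factor Y_y, which is nonzero as its square is
    1.\<close>
  have r: "k2 (Y p) * (?d1 X p * ?d1 X p) = k2 (y p)" if p: "p \<in> A" for p
  proof -
    have "?d2 (?d1 (?d1 Y)) p = ?d1 (?d2 (?d1 Y)) p"
      using dir_deriv_commute[OF smooth_on_dir_deriv[OF sY] A p] .
    also have "\<dots> = 0" using zero[OF p Y21] .
    finally have "0 = ?d2 (?d1 (?d1 Y)) p" by simp
    also have "\<dots> = ?d2 (\<lambda>p. k1 (y p) * ?d2 Y p - k1 (Y p) * (?d1 X p * ?d1 X p)) p"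
      by (rule dir_deriv_cong[OF A p]) (rule Y11)
    also have "\<dots> = k2 (y p) * ?d2 Y p - k2 (Y p) * ?d2 Y p * (?d1 X p * ?d1 X p)"
      using dX[OF p] dY[OF p] k1y[OF p] k1Y[OF p] X1[OF p] Y22[OF p] by (simp add: dir_deriv_arith)
    finally have "?d2 Y p * (k2 (Y p) * (?d1 X p * ?d1 X p) - k2 (y p)) = 0" by (simp add: algebra_simps)
    then show ?thesis using Y2[OF p] by auto
  qed
  have "k3 (Y p) * ?d2 Y p * (?d1 X p * ?d1 X p) = ?d2 (\<lambda>p. k2 (Y p) * (?d1 X p * ?d1 X p)) p"
    using dX[OF p] dY[OF p] k1Y[OF p] X1[OF p] by (simp add: dir_deriv_arith)
  also have "\<dots> = ?d2 (\<lambda>p. k2 (y p)) p" by (rule dir_deriv_cong[OF A p]) (rule r)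
  also have "\<dots> = k3 (y p)" using k1y[OF p] by simp
  finally have e: "k3 (Y p) * ?d2 Y p * (?d1 X p * ?d1 X p) = k3 (y p)" .
  have "(k3 (Y p))\<^sup>2 * (k2 (y p))\<^sup>2 = (k3 (y p))\<^sup>2 * (k2 (Y p))\<^sup>2"
    unfolding e[symmetric] r[OF p, symmetric] power_mult_distrib Y2[OF p] by simp
  then show ?thesis by (simp add: Y_def y_def)
qed

end

text \<open>The invariant (k'''/k'')^2 equals m^2 / y^2 here, and so takes different values at y = 1
  and y = 2.\<close>

lemma not_locally_homogeneousI:
  fixes k k1 k2 :: "real \<Rightarrow> real"
  assumes k: "\<And>y. y > 0 \<Longrightarrow> (k has_real_derivative k1 y) (at y)" "\<And>y. y > 0 \<Longrightarrow> (k1 has_real_derivative k2 y) (at y)"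
    "\<And>y. y > 0 \<Longrightarrow> (k2 has_real_derivative m * k2 y / y) (at y)" "\<And>y. y > 0 \<Longrightarrow> k2 y \<noteq> 0" and m: "m \<noteq> 0"
  shows "\<not> locally_homogeneous (manifold_f UNIV {0<..} (\<lambda>x y. k y))"
proof
  assume "locally_homogeneous (manifold_f UNIV {0<..} (\<lambda>x y. k y))"
  moreover have "(0, 1, 0) \<in> (UNIV \<times> {0<..} \<times> UNIV :: (real \<times> real \<times> real) set)"
    "(0, 2, 0) \<in> (UNIV \<times> {0<..} \<times> UNIV :: (real \<times> real \<times> real) set)" by auto
  ultimately obtain A B T where A: "open A" "(0, 1, 0) \<in> A" "A \<subseteq> UNIV \<times> {0<..} \<times> UNIV"
    and B: "B \<subseteq> UNIV \<times> {0<..} \<times> UNIV" and T: "isometry (A, metric_f (\<lambda>x y. k y)) (B, metric_f (\<lambda>x y. k y)) T"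
    "T (0, 1, 0) = (0, 2, 0)"
    unfolding locally_homogeneous_def manifold_f_def prod.case by meson
  have "smooth_on A T" "T ` A \<subseteq> UNIV \<times> {0<..} \<times> UNIV"
    "\<And>p u v. p \<in> A \<Longrightarrow> metric_f (\<lambda>x y. k y) (T p) (dir_deriv u T p) (dir_deriv v T p) = metric_f (\<lambda>x y. k y) p u v"
    using T(1) B unfolding isometry_def scaled_isometry_def diffeomorphism_on_def bij_betw_def by auto
  from isometry_profile[of "{0<..}" k k1 k2 "\<lambda>y. m * k2 y / y", OF _ _ _ _ _ A(1,3) this A(2)] k
  have "(m * k2 2 / 2)\<^sup>2 * (k2 1)\<^sup>2 = (m * k2 1 / 1)\<^sup>2 * (k2 2)\<^sup>2" by (auto simp: T(2))
  then have "m\<^sup>2 * (k2 1)\<^sup>2 * (k2 2)\<^sup>2 = 0" by (auto simp: power_mult_distrib power_divide)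
  then show False using k(4)[of 1] k(4)[of 2] m by auto
qed

lemma not_locally_homogeneous_ln:
  assumes "s \<noteq> 0"
  shows "\<not> locally_homogeneous (manifold_f UNIV {0<..} (\<lambda>x y. s * ln y))"
proof (rule not_locally_homogeneousI[where m = "-2" and ?k1.0 = "\<lambda>y. s / y" and ?k2.0 = "\<lambda>y. - s / y\<^sup>2"])
  fix y :: real assume y: "y > 0"
  show "((\<lambda>y. s * ln y) has_real_derivative s / y) (at y)"
    using y by (auto intro!: derivative_eq_intros)
  show "((\<lambda>y. s / y) has_real_derivative - s / y\<^sup>2) (at y)"
    using y by (auto intro!: derivative_eq_intros simp: power2_eq_square)
  show "((\<lambda>y. - s / y\<^sup>2) has_real_derivative - 2 * (- s / y\<^sup>2) / y) (at y)"
    using y by (auto intro!: derivative_eq_intros simp: field_simps) (simp add: power2_eq_square power3_eq_cube power4_eq_xxxx)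
qed (use assms in auto)

lemma not_locally_homogeneous_powr:
  assumes "s \<noteq> 0" "\<epsilon> \<notin> {0, 1, 2}"
  shows "\<not> locally_homogeneous (manifold_f UNIV {0<..} (\<lambda>x y. s * y powr \<epsilon>))"
proof (rule not_locally_homogeneousI[where m = "\<epsilon> - 2" and ?k1.0 = "\<lambda>y. s * (\<epsilon> * y powr (\<epsilon> - 1))" and
      ?k2.0 = "\<lambda>y. s * (\<epsilon> * ((\<epsilon> - 1) * y powr (\<epsilon> - 2)))"])
  fix y :: real assume y: "y > 0"
  show "((\<lambda>y. s * y powr \<epsilon>) has_real_derivative s * (\<epsilon> * y powr (\<epsilon> - 1))) (at y)"
    by (intro DERIV_cmult has_real_derivative_powr y)
  show "((\<lambda>y. s * (\<epsilon> * y powr (\<epsilon> - 1))) has_real_derivative s * (\<epsilon> * ((\<epsilon> - 1) * y powr (\<epsilon> - 2)))) (at y)"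
    using has_real_derivative_powr[OF y, of "\<epsilon> - 1"] by (intro DERIV_cmult) simp
  have "y powr (\<epsilon> - 2 - 1) = y powr (\<epsilon> - 2) / y" using powr_diff[of y "\<epsilon> - 2" 1] y by simp
  then show "((\<lambda>y. s * (\<epsilon> * ((\<epsilon> - 1) * y powr (\<epsilon> - 2)))) has_real_derivative
      (\<epsilon> - 2) * (s * (\<epsilon> * ((\<epsilon> - 1) * y powr (\<epsilon> - 2)))) / y) (at y)"
    using DERIV_cmult[OF has_real_derivative_powr[OF y, of "\<epsilon> - 2"], of "s * (\<epsilon> * (\<epsilon> - 1))"] by (simp add: mult_ac)
  show "s * (\<epsilon> * ((\<epsilon> - 1) * y powr (\<epsilon> - 2))) \<noteq> 0" using y assms by auto
qed (use assms in auto)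

subsection \<open>The classification\<close>

lemma (in plane_wave) partial_y_iterated:
  assumes "x \<in> I" "y \<in> J"
  shows "partial_y f x y = pd2 F (x, y)" "partial_y (partial_y f) x y = h (x, y)"
    "partial_y (partial_y (partial_y f)) x y = pd2 h (x, y)"
proof -
  have 1: "partial_y f x y = pd2 F (x, y)" if "x \<in> I" "y \<in> J" for x y
    by (rule partial_y_eq_pd2[OF open_J]) (use that differentiable_iterated in auto)
  have 2: "partial_y (partial_y f) x y = h (x, y)" if "x \<in> I" "y \<in> J" for x y
    by (rule partial_y_eq_pd2[OF open_J]) (use that 1 differentiable_iterated in auto)
  have 3: "partial_y (partial_y (partial_y f)) x y = pd2 h (x, y)" if "x \<in> I" "y \<in> J" for x y
    by (rule partial_y_eq_pd2[OF open_J]) (use that 2 differentiable_iterated in auto)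
  show "partial_y f x y = pd2 F (x, y)" "partial_y (partial_y f) x y = h (x, y)"
    "partial_y (partial_y (partial_y f)) x y = pd2 h (x, y)"
    using 1 2 3 assms by blast+
qed

theorem theorem1p9:
  fixes I J :: "real set" and f :: "real \<Rightarrow> real \<Rightarrow> real"
  assumes "open_interval I" and "open_interval J"
    and "smooth_on (I \<times> J) (\<lambda>(x, y). f x y)"
    and "\<forall>x\<in>I. \<forall>y\<in>J. partial_y (partial_y f) x y \<noteq> 0"
    and "\<not> (\<exists>c. \<forall>x\<in>I. \<forall>y\<in>J. partial_y (partial_y f) x y = c)"
  shows
    "((\<forall>x\<in>I. \<forall>y\<in>J. partial_y (partial_y (partial_y f)) x y \<noteq> 0) \<longrightarrow>
        homothety_curvature_homogeneous 1 (manifold_f I J f))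
     \<and>
     (\<forall>\<alpha> :: real \<Rightarrow> real.
        (\<forall>x\<in>I. \<forall>y\<in>J. partial_y (partial_y f) x y = \<alpha> x) \<and> (\<forall>x\<in>I. deriv \<alpha> x \<noteq> 0) \<longrightarrow>
        (homothety_curvature_homogeneous 1 (manifold_f I J f) \<longleftrightarrow>
           (\<exists>a x0 \<beta> \<gamma>. a \<noteq> 0 \<and> x0 \<notin> I \<and> smooth_on I \<beta> \<and> smooth_on I \<gamma> \<and>
              (\<forall>x\<in>I. \<forall>y\<in>J. f x y = a * (x - x0) powi (-2) * y\<^sup>2 + \<beta> x * y + \<gamma> x))))
     \<and>
     ((\<exists>a x0 \<beta> \<gamma>. a \<noteq> 0 \<and> x0 \<notin> I \<and> smooth_on I \<beta> \<and> smooth_on I \<gamma> \<and>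
          (\<forall>x\<in>I. \<forall>y\<in>J. f x y = a * (x - x0) powi (-2) * y\<^sup>2 + \<beta> x * y + \<gamma> x)) \<longrightarrow>
        locally_homogeneous (manifold_f I J f))
     \<and>
     (homothety_curvature_homogeneous 2 (manifold_f I J f) \<and>
      (\<forall>x\<in>I. \<forall>y\<in>J. partial_y (partial_y f) x y \<noteq> 0) \<and>
      (\<forall>x\<in>I. \<forall>y\<in>J. partial_y (partial_y (partial_y f)) x y \<noteq> 0) \<longrightarrow>
        (\<exists>s\<in>{1, -1}. \<exists>a. a \<noteq> 0 \<and>
           locally_isometric (manifold_f I J f)
             (manifold_f UNIV UNIV (\<lambda>x y. s * exp (a * y)))) \<or>
        (\<exists>s\<in>{1, -1}.
           locally_isometric (manifold_f I J f)
             (manifold_f UNIV {0<..} (\<lambda>x y. s * ln y))) \<or>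
        (\<exists>s\<in>{1, -1}. \<exists>\<epsilon>. \<epsilon> \<notin> {0, 1, 2} \<and>
           locally_isometric (manifold_f I J f)
             (manifold_f UNIV {0<..} (\<lambda>x y. s * y powr \<epsilon>))))
     \<and>
     (\<forall>s\<in>{1, -1}. \<forall>a. a \<noteq> 0 \<longrightarrow>
        homogeneous (manifold_f UNIV UNIV (\<lambda>x y. s * exp (a * y))))
     \<and>
     (\<forall>s\<in>{1, -1}.
        homothety_homogeneous (manifold_f UNIV {0<..} (\<lambda>x y. s * ln y)) \<and>
        \<not> locally_homogeneous (manifold_f UNIV {0<..} (\<lambda>x y. s * ln y)))
     \<and>
     (\<forall>s\<in>{1, -1}. \<forall>\<epsilon>. \<epsilon> \<notin> {0, 1, 2} \<longrightarrow>
        homothety_homogeneous (manifold_f UNIV {0<..} (\<lambda>x y. s * y powr \<epsilon>)) \<and>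
        \<not> locally_homogeneous (manifold_f UNIV {0<..} (\<lambda>x y. s * y powr \<epsilon>)))"
proof -
  interpret plane_wave I J f
    using assms(1-3) by unfold_locales (auto simp: open_interval_def)
  interpret nonflat_wave I J f
    using assms(1,2,4) by unfold_locales (auto simp: partial_y_iterated(2))
  have 1: "homothety_curvature_homogeneous 1 (manifold_f I J f)"
    if "\<forall>x\<in>I. \<forall>y\<in>J. partial_y (partial_y (partial_y f)) x y \<noteq> 0"
    by (rule homogeneous_1) (use that in \<open>auto simp: partial_y_iterated(3)\<close>)
  have 2: "homothety_curvature_homogeneous 1 (manifold_f I J f) \<longleftrightarrow>
      (\<exists>a x0 \<beta> \<gamma>. a \<noteq> 0 \<and> x0 \<notin> I \<and> smooth_on I \<beta> \<and> smooth_on I \<gamma> \<and>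
        (\<forall>x\<in>I. \<forall>y\<in>J. f x y = a * (x - x0) powi (-2) * y\<^sup>2 + \<beta> x * y + \<gamma> x))"
    if "\<forall>x\<in>I. \<forall>y\<in>J. partial_y (partial_y f) x y = \<alpha> x" "\<forall>x\<in>I. deriv \<alpha> x \<noteq> 0" for \<alpha>
  proof -
    have \<alpha>: "\<And>x y. x \<in> I \<Longrightarrow> y \<in> J \<Longrightarrow> h (x, y) = \<alpha> x" and \<alpha>': "\<And>x. x \<in> I \<Longrightarrow> deriv \<alpha> x \<noteq> 0"
      using that by (auto simp: partial_y_iterated(2))
    show ?thesis
      using quadratic_imp_homogeneous_1[OF \<alpha> \<alpha>'] homogeneous_1_imp_quadratic[OF \<alpha> \<alpha>'] by metis
  qed
  have 3: "locally_homogeneous (manifold_f I J f)"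
    if "\<exists>a x0 \<beta> \<gamma>. a \<noteq> 0 \<and> x0 \<notin> I \<and> smooth_on I \<beta> \<and> smooth_on I \<gamma> \<and>
      (\<forall>x\<in>I. \<forall>y\<in>J. f x y = a * (x - x0) powi (-2) * y\<^sup>2 + \<beta> x * y + \<gamma> x)"
    using that locally_homogeneous_quadratic[OF I open_J] by metis
  have 4: "(\<exists>s\<in>{1, -1}. \<exists>a. a \<noteq> 0 \<and>
        locally_isometric (manifold_f I J f) (manifold_f UNIV UNIV (\<lambda>x y. s * exp (a * y)))) \<or>
      (\<exists>s\<in>{1, -1}. locally_isometric (manifold_f I J f) (manifold_f UNIV {0<..} (\<lambda>x y. s * ln y))) \<or>
      (\<exists>s\<in>{1, -1}. \<exists>\<epsilon>. \<epsilon> \<notin> {0, 1, 2} \<and>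
        locally_isometric (manifold_f I J f) (manifold_f UNIV {0<..} (\<lambda>x y. s * y powr \<epsilon>)))"
    if "homothety_curvature_homogeneous 2 (manifold_f I J f)"
      "\<forall>x\<in>I. \<forall>y\<in>J. partial_y (partial_y (partial_y f)) x y \<noteq> 0"
  proof -
    interpret homogeneous_2_wave I J f
      using that by unfold_locales (auto simp: partial_y_iterated(3))
    show ?thesis by (rule locally_isometric_classification)
  qed
  have s: "s \<noteq> 0" if "s \<in> {1, -1}" for s :: real using that by auto
  show ?thesis
    by (intro conjI allI impI ballI; (elim conjE)?; (rule 1 2 3 4 homogeneous_exp homothety_homogeneous_ln
          homothety_homogeneous_powr not_locally_homogeneous_ln[OF s] not_locally_homogeneous_powr[OF s]; assumption))
qed

end
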